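(* Let $(s_n)$ be a sequence of positive real numbers. Then $$\sum_{\lambda\in\widehat{\mathfrak{S}_n}^{**}}\frac{1}{(d_\lambda)^{s_n}}\xrightarrow[n\to\infty]{}0\quad\text{if and only if}\quad s_n\ln n\xrightarrow[n\to\infty]{}\infty.$$
   Context: $\widehat{\mathfrak{S}_n}$ denotes the set of irreducible representations of the symmetric group $\mathfrak{S}_n$, indexed by integer partitions $\lambda\vdash n$; $d_\lambda$ is the dimension of the representation $\lambda$. $\widehat{\mathfrak{S}_n}^{**}=\widehat{\mathfrak{S}_n}\setminus\{[n],[1^n]\}$ is the set of irreducible representations other than the trivial representation $[n]$ and the sign representation $[1^n]$. (The sum is the Witten zeta function $\zeta_n(A,s)=\sum_{\lambda\in A}d_\lambda^{-s}$ with $A=\widehat{\mathfrak{S}_n}^{**}$, $s=s_n$.) *)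

theory Defs
  imports
    Complex_Main
    "HOL-Algebra.Sym_Groups"
    "Jordan_Normal_Form.VS_Connect"
begin

text \<open>
  A finite-dimensional complex representation of a group is taken in matrix form, as a pair
  \<open>(d, \<rho>)\<close> of a degree and a homomorphism to \<open>GL d\<close>; every finite-dimensional
  representation is isomorphic to one of this form.  The values of \<open>\<rho>\<close> outside the carrier
  of the group are irrelevant, and isomorphism below does not look at them.
\<close>

definition GL :: "nat \<Rightarrow> complex mat monoid" where
  "GL d = units_of (ring_mat TYPE(complex) d ())"

type_synonym 'g mat_rep = "nat \<times> ('g \<Rightarrow> complex mat)"

definition is_rep :: "('g, 'x) monoid_scheme \<Rightarrow> 'g mat_rep \<Rightarrow> bool" where
  "is_rep G = (\<lambda>(d, \<rho>). \<rho> \<in> hom G (GL d))"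

definition invariant_subspace ::
    "('g, 'x) monoid_scheme \<Rightarrow> 'g mat_rep \<Rightarrow> complex vec set \<Rightarrow> bool" where
  "invariant_subspace G = (\<lambda>(d, \<rho>) W.
     VectorSpace.subspace class_ring W (module_vec TYPE(complex) d) \<and>
     (\<forall>g\<in>carrier G. \<forall>w\<in>W. \<rho> g *\<^sub>v w \<in> W))"

definition irreducible_rep :: "('g, 'x) monoid_scheme \<Rightarrow> 'g mat_rep \<Rightarrow> bool" where
  "irreducible_rep G = (\<lambda>(d, \<rho>).
     is_rep G (d, \<rho>) \<and> d \<noteq> 0 \<and>
     (\<forall>W. invariant_subspace G (d, \<rho>) W \<longrightarrow> W = {0\<^sub>v d} \<or> W = carrier_vec d))"

definition iso_rep :: "('g, 'x) monoid_scheme \<Rightarrow> 'g mat_rep \<Rightarrow> 'g mat_rep \<Rightarrow> bool" where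
  "iso_rep G = (\<lambda>(d, \<rho>) (e, \<sigma>).
     d = e \<and> (\<exists>P\<in>carrier (GL d). \<forall>g\<in>carrier G. P * \<rho> g = \<sigma> g * P))"

definition irrep_rel :: "('g, 'x) monoid_scheme \<Rightarrow> ('g mat_rep \<times> 'g mat_rep) set" where
  "irrep_rel G = {(r, s). irreducible_rep G r \<and> irreducible_rep G s \<and> iso_rep G r s}"

definition Irr :: "('g, 'x) monoid_scheme \<Rightarrow> 'g mat_rep set set" where
  "Irr G = {r. irreducible_rep G r} // irrep_rel G"

text \<open>Isomorphic representations have the same degree, so this picks the unique element.\<close>

definition dim_irr :: "'g mat_rep set \<Rightarrow> nat" where
  "dim_irr C = the_elem (fst ` C)"

text \<open>
  In the labelling of the irreducible representations of the symmetric group by partitions,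
  these two are \<open>[n]\<close> and \<open>[1\<^sup>n]\<close>.
\<close>

definition triv_rep :: "'g mat_rep" where
  "triv_rep = (1, \<lambda>g. 1\<^sub>m 1)"

definition sign_rep :: "(nat \<Rightarrow> nat) mat_rep" where
  "sign_rep = (1, \<lambda>p. of_int (sign p) \<cdot>\<^sub>m 1\<^sub>m 1)"

definition Irr_Sym_star :: "nat \<Rightarrow> (nat \<Rightarrow> nat) mat_rep set set" where
  "Irr_Sym_star n =
     Irr (sym_group n) - {irrep_rel (sym_group n) `` {triv_rep}, irrep_rel (sym_group n) `` {sign_rep}}"

text \<open>
  A finite group has finitely many irreducible representations up to isomorphism, so for
  \<open>A \<subseteq> Irr (sym_group n)\<close> the following is a genuine finite sum.
\<close>

definition witten_zeta :: "(nat \<Rightarrow> nat) mat_rep set set \<Rightarrow> real \<Rightarrow> real" where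
  "witten_zeta A s = (\<Sum>C\<in>A. 1 / real (dim_irr C) powr s)"

lemma carrier_GL:
  "carrier (GL d) =
     {A \<in> carrier_mat d d. \<exists>B\<in>carrier_mat d d. B * A = 1\<^sub>m d \<and> A * B = 1\<^sub>m d}"
  by (auto simp: GL_def units_of_def Units_def ring_mat_simps)

lemma mult_GL: "A \<otimes>\<^bsub>GL d\<^esub> B = A * B"
  by (simp add: GL_def units_of_def ring_mat_simps)

lemma one_GL: "\<one>\<^bsub>GL d\<^esub> = 1\<^sub>m d"
  by (simp add: GL_def units_of_def ring_mat_simps)

lemma group_GL: "group (GL d)"
proof -
  interpret ring "ring_mat TYPE(complex) d ()" by (rule ring_mat)
  show ?thesis unfolding GL_def by (rule units_group)
qed

lemma rep_carrier:
  assumes "is_rep G (d, \<rho>)" "g \<in> carrier G"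
  shows "\<rho> g \<in> carrier_mat d d"
  using assms by (auto simp: is_rep_def hom_def carrier_GL Pi_iff)

lemma iso_rep_refl:
  assumes "is_rep G r"
  shows "iso_rep G r r"
proof -
  obtain d \<rho> where r: "r = (d, \<rho>)" by force
  have "1\<^sub>m d \<in> carrier (GL d)"
    by (auto simp: carrier_GL intro!: bexI[of _ "1\<^sub>m d"])
  moreover have "1\<^sub>m d * \<rho> g = \<rho> g * 1\<^sub>m d" if "g \<in> carrier G" for g
    using rep_carrier[of G d \<rho> g] assms that by (simp add: r)
  ultimately show ?thesis by (auto simp: iso_rep_def r)
qed

lemma iso_rep_sym:
  assumes "is_rep G r" "is_rep G s" "iso_rep G r s"
  shows "iso_rep G s r"
proof -
  obtain d \<rho> \<sigma> P where r: "r = (d, \<rho>)" and s: "s = (d, \<sigma>)" and P: "P \<in> carrier (GL d)"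
    and eq: "\<And>g. g \<in> carrier G \<Longrightarrow> P * \<rho> g = \<sigma> g * P"
    using assms(3) by (force simp: iso_rep_def)
  obtain Q where Q: "Q \<in> carrier_mat d d" "Q * P = 1\<^sub>m d" "P * Q = 1\<^sub>m d"
    and Pc: "P \<in> carrier_mat d d"
    using P by (auto simp: carrier_GL)
  have "Q * \<sigma> g = \<rho> g * Q" if g: "g \<in> carrier G" for g
  proof -
    have rc: "\<rho> g \<in> carrier_mat d d" and sc: "\<sigma> g \<in> carrier_mat d d"
      using rep_carrier[OF _ g] assms(1,2) unfolding r s by simp_all
    have "Q * \<sigma> g = Q * (\<sigma> g * (P * Q))" using Q sc by simp
    also have "\<dots> = Q * ((\<sigma> g * P) * Q)"
      using assoc_mult_mat[OF sc Pc Q(1)] by simp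
    also have "\<dots> = Q * ((P * \<rho> g) * Q)" using eq[OF g] by simp
    also have "\<dots> = Q * (P * (\<rho> g * Q))" using assoc_mult_mat[OF Pc rc Q(1)] by simp
    also have "\<dots> = (Q * P) * (\<rho> g * Q)"
      using assoc_mult_mat[OF Q(1) Pc mult_carrier_mat[OF rc Q(1)]] by simp
    also have "\<dots> = \<rho> g * Q" using Q rc by simp
    finally show ?thesis .
  qed
  moreover have "Q \<in> carrier (GL d)" using Q Pc by (auto simp: carrier_GL)
  ultimately show ?thesis by (auto simp: iso_rep_def r s)
qed

lemma iso_rep_trans:
  assumes "is_rep G r" "is_rep G s" "is_rep G t" "iso_rep G r s" "iso_rep G s t"
  shows "iso_rep G r t"
proof -
  obtain d \<rho> \<sigma> \<tau> P Q where r: "r = (d, \<rho>)" and s: "s = (d, \<sigma>)" and t: "t = (d, \<tau>)"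
    and P: "P \<in> carrier (GL d)" and Q: "Q \<in> carrier (GL d)"
    and eq: "\<And>g. g \<in> carrier G \<Longrightarrow> P * \<rho> g = \<sigma> g * P"
    and eq': "\<And>g. g \<in> carrier G \<Longrightarrow> Q * \<sigma> g = \<tau> g * Q"
    using assms(4,5) by (force simp: iso_rep_def)
  have Pc: "P \<in> carrier_mat d d" and Qc: "Q \<in> carrier_mat d d"
    using P Q by (auto simp: carrier_GL)
  have "(Q * P) * \<rho> g = \<tau> g * (Q * P)" if g: "g \<in> carrier G" for g
  proof -
    have rc: "\<rho> g \<in> carrier_mat d d" and sc: "\<sigma> g \<in> carrier_mat d d"
      and tc: "\<tau> g \<in> carrier_mat d d"
      using rep_carrier[OF _ g] assms(1-3) unfolding r s t by simp_all
    have "(Q * P) * \<rho> g = Q * (P * \<rho> g)" by (rule assoc_mult_mat[OF Qc Pc rc])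
    also have "\<dots> = (Q * \<sigma> g) * P" unfolding eq[OF g] by (rule assoc_mult_mat[OF Qc sc Pc, symmetric])
    also have "\<dots> = \<tau> g * (Q * P)" unfolding eq'[OF g] by (rule assoc_mult_mat[OF tc Qc Pc])
    finally show ?thesis .
  qed
  moreover have "Q * P \<in> carrier (GL d)"
    using group.is_monoid[OF group_GL, of d] P Q monoid.m_closed[of "GL d" Q P]
    by (simp add: mult_GL)
  ultimately show ?thesis by (auto simp: iso_rep_def r t)
qed

lemma irreducible_imp_rep: "irreducible_rep G r \<Longrightarrow> is_rep G r"
  by (cases r) (simp add: irreducible_rep_def)

lemma equiv_irrep_rel: "equiv {r. irreducible_rep G r} (irrep_rel G)"
proof (rule equivI)
  show "irrep_rel G \<subseteq> {r. irreducible_rep G r} \<times> {r. irreducible_rep G r}"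
    by (auto simp: irrep_rel_def)
  show "refl_on {r. irreducible_rep G r} (irrep_rel G)"
    by (rule refl_onI) (simp add: irrep_rel_def iso_rep_refl irreducible_imp_rep)
  show "sym (irrep_rel G)"
    by (rule symI) (simp add: irrep_rel_def iso_rep_sym irreducible_imp_rep)
  show "trans (irrep_rel G)"
    by (rule transI)
      (simp add: irrep_rel_def, metis iso_rep_trans irreducible_imp_rep)
qed

lemma dim_irr_class:
  assumes "irreducible_rep G (d, \<rho>)"
  shows "dim_irr (irrep_rel G `` {(d, \<rho>)}) = d"
proof -
  have "(d, \<rho>) \<in> irrep_rel G `` {(d, \<rho>)}"
    using assms equiv_class_self[OF equiv_irrep_rel] by blast
  then have "fst ` (irrep_rel G `` {(d, \<rho>)}) = {d}"
    by (force simp: irrep_rel_def iso_rep_def)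
  then show ?thesis by (simp add: dim_irr_def)
qed

lemma irreducible_degree_one:
  assumes rep: "is_rep G (1, \<rho>)"
  shows "irreducible_rep G (1, \<rho>)"
proof -
  have "W = {0\<^sub>v 1} \<or> W = carrier_vec 1" if "invariant_subspace G (1, \<rho>) W" for W
  proof -
    have sub: "submodule class_ring W (module_vec TYPE(complex) 1)"
      using that by (simp add: invariant_subspace_def VectorSpace.subspace_def)
    have Wc: "W \<subseteq> carrier_vec 1" and W0: "0\<^sub>v 1 \<in> W"
      and Ws: "\<And>c w. w \<in> W \<Longrightarrow> c \<cdot>\<^sub>v w \<in> W"
      using submodule.subset[OF sub] submodule.zero_closed[OF sub] submodule.smult_closed[OF sub]
      by (auto simp: module_vec_simps)
    show ?thesis
    proof (cases "W = {0\<^sub>v 1}")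
      case False
      then obtain w where w: "w \<in> W" "w \<noteq> 0\<^sub>v 1" using W0 by blast
      have wc: "w \<in> carrier_vec 1" using w Wc by blast
      have w0: "w $ 0 \<noteq> 0"
      proof
        assume "w $ 0 = 0"
        then have "w = 0\<^sub>v 1" using wc by (intro eq_vecI) auto
        then show False using w by simp
      qed
      have "v \<in> W" if v: "v \<in> carrier_vec 1" for v
      proof -
        have "v = (v $ 0 / w $ 0) \<cdot>\<^sub>v w" using v wc w0 by (intro eq_vecI) auto
        then show ?thesis using Ws[OF w(1)] by metis
      qed
      then show ?thesis using Wc by blast
    qed simp
  qed
  then show ?thesis using rep by (simp add: irreducible_rep_def)
qed

lemma irreducible_triv_rep: "irreducible_rep G triv_rep"
proof -
  have "1\<^sub>m 1 \<in> carrier (GL 1)"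
    by (auto simp: carrier_GL intro!: bexI[of _ "1\<^sub>m 1"])
  then have "is_rep G (1, \<lambda>g. 1\<^sub>m 1)"
    by (auto simp: is_rep_def hom_def mult_GL)
  then show ?thesis unfolding triv_rep_def by (rule irreducible_degree_one)
qed

lemma irreducible_sign_rep: "irreducible_rep (sym_group n) sign_rep"
proof -
  let ?\<sigma> = "\<lambda>p :: nat \<Rightarrow> nat. of_int (sign p) \<cdot>\<^sub>m (1\<^sub>m 1 :: complex mat)"
  have mult: "(a \<cdot>\<^sub>m 1\<^sub>m 1) * (b \<cdot>\<^sub>m 1\<^sub>m 1) = (a * b) \<cdot>\<^sub>m (1\<^sub>m 1 :: complex mat)" for a b
    by (intro eq_matI) (auto simp: scalar_prod_def)
  have sq: "?\<sigma> p * ?\<sigma> p = 1\<^sub>m 1" for p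
    unfolding mult by (intro eq_matI) (auto simp: sign_def)
  have "?\<sigma> p \<in> carrier (GL 1)" for p
    using sq by (auto simp: carrier_GL intro!: bexI[of _ "?\<sigma> p"])
  moreover have "?\<sigma> (p \<circ> q) = ?\<sigma> p * ?\<sigma> q" if "p permutes {1..n}" "q permutes {1..n}" for p q
  proof -
    have "permutation p" "permutation q" using that permutation_permutes by blast+
    then show ?thesis unfolding mult by (simp add: sign_compose)
  qed
  ultimately have "is_rep (sym_group n) (1, ?\<sigma>)"
    by (auto simp: is_rep_def hom_def mult_GL sym_group_def)
  then show ?thesis unfolding sign_rep_def by (rule irreducible_degree_one)
qed

end

theory Submission
  imports Defs "HOL-Library.Function_Algebras" "HOL-Combinatorics.Orbits"
    "Jordan_Normal_Form.Spectral_Radius" "HOL-Real_Asymp.Real_Asymp"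
begin

text \<open>
  Restrict an irreducible representation \<open>V\<close> of \<open>S\<^sub>n\<close> to the subgroup generated by the
  transpositions \<open>(1 2), (3 4), \<dots>\<close>, \<open>m = n div 2\<close> in number. It splits into weight spaces indexed by the
  set of transpositions acting as \<open>-1\<close>. Conjugation makes only the number \<open>j\<close> of minus signs matter, so
  \<open>dim V \<ge> (m choose j)\<close> for every \<open>j\<close> that occurs. The occurring \<open>j\<close> leave no gap of
  length three: a transposition moves \<open>j\<close> by at most two, so the part of \<open>V\<close> below a gap would be
  invariant. If \<open>j\<close> is the largest number that occurs, a weight vector for it is fixed by all
  permutations of the remaining \<open>n - 2j\<close> points, since otherwise one more minus sign could be produced.
  Hence, with \<open>q\<close> of order \<open>n powr (3/4)\<close>, either \<open>dim V \<ge> 2 ^ q\<close>, or for some \<open>j \<le> q\<close> the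
  representation \<open>V\<close> or its sign twist has a vector fixed by the permutations of \<open>n - 2j\<close> points,
  and \<open>dim V \<ge> (m choose j)\<close>; here \<open>j = 0\<close> means trivial or sign.

  Representations of the second kind are counted through characters. Let \<open>n - k\<close> be the largest number of
  points whose permutations fix a nonzero vector of \<open>V\<close>. For such \<open>V\<close>, averaging the character over
  \<open>S\<^sub>n\<^sub>-\<^sub>k\<close> gives linearly independent functions which are determined by their values on the conjugacy
  classes of the complementary \<open>S\<^sub>k\<close>, because averaging over \<open>S\<^sub>n\<^sub>-\<^sub>k\<^sub>+\<^sub>1\<close> gives zero. So there are
  at most as many such \<open>V\<close> as conjugacy classes of \<open>S\<^sub>k\<close>, which is subexponential in \<open>k\<close>. Summing
  \<open>dim V powr (-s)\<close> over both kinds gives one implication; the other one follows from the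
  \<open>(n - 1)\<close>-dimensional standard representation.
\<close>

section \<open>Representations acting on functions\<close>

text \<open>
  \<open>complex vec\<close> carries its dimension in the value, so it is not an additive group as a type.
  Vectors are therefore functions vanishing from index \<open>d\<close> on, for which sums over finite sets are available.
\<close>

definition fvec :: "nat \<Rightarrow> (nat \<Rightarrow> complex) set" where
  "fvec d = {v. \<forall>i\<ge>d. v i = 0}"

definition cscale :: "complex \<Rightarrow> (nat \<Rightarrow> complex) \<Rightarrow> nat \<Rightarrow> complex" where
  "cscale c v = (\<lambda>i. c * v i)"

definition fun_linear :: "((nat \<Rightarrow> complex) \<Rightarrow> nat \<Rightarrow> complex) \<Rightarrow> bool" where
  "fun_linear f \<longleftrightarrow> (\<forall>u v. f (u + v) = f u + f v) \<and> (\<forall>c v. f (cscale c v) = cscale c (f v))"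

definition fun_subspace :: "(nat \<Rightarrow> complex) set \<Rightarrow> bool" where
  "fun_subspace W \<longleftrightarrow> 0 \<in> W \<and> (\<forall>u\<in>W. \<forall>v\<in>W. u + v \<in> W) \<and> (\<forall>c. \<forall>v\<in>W. cscale c v \<in> W)"

definition mat_fun :: "nat \<Rightarrow> nat \<Rightarrow> (nat \<Rightarrow> nat \<Rightarrow> complex) \<Rightarrow> (nat \<Rightarrow> complex) \<Rightarrow> nat \<Rightarrow> complex" where
  "mat_fun d e M v = (\<lambda>i. if i < d then \<Sum>j<e. M i j * v j else 0)"

text \<open>Only entries with both indices below the degree enter, so \<open>act r g\<close> is
  linear and lands in \<open>fvec (fst r)\<close> for every \<open>g\<close>, whether or not
  \<open>g\<close> lies in the group.\<close>

definition act :: "'g mat_rep \<Rightarrow> 'g \<Rightarrow> (nat \<Rightarrow> complex) \<Rightarrow> nat \<Rightarrow> complex" where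
  "act r g = mat_fun (fst r) (fst r) (\<lambda>i j. snd r g $$ (i, j))"

section \<open>Linear maps and subspaces of functions\<close>

lemma sum_fun_apply: "(\<Sum>x\<in>A. f x) i = (\<Sum>x\<in>A. f x i :: 'b :: comm_monoid_add)"
  by (induction A rule: infinite_finite_induct) auto

lemma cscale_simps [simp]:
  "cscale c 0 = 0" "cscale 0 v = 0" "cscale 1 v = v" "cscale c (cscale b v) = cscale (c * b) v"
  "cscale (-1) v = - v"
  by (auto simp: cscale_def fun_eq_iff)

lemma cscale_add: "cscale c (u + v) = cscale c u + cscale c v"
  and cscale_diff: "cscale c (u - v) = cscale c u - cscale c v"
  by (auto simp: cscale_def fun_eq_iff algebra_simps)

lemma cscale_eq_0_iff: "cscale c v = 0 \<longleftrightarrow> c = 0 \<or> v = 0"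
  by (auto simp: cscale_def fun_eq_iff)

context
  fixes f assumes f: "fun_linear f"
begin

lemma fun_linear_add: "f (u + v) = f u + f v"
  and fun_linear_scale: "f (cscale c v) = cscale c (f v)"
  using f by (auto simp: fun_linear_def)

lemma fun_linear_0: "f 0 = 0"
  using fun_linear_scale[of 0 0] by simp

lemma fun_linear_uminus: "f (- v) = - f v"
  using fun_linear_scale[of "-1" v] by simp

lemma fun_linear_diff: "f (u - v) = f u - f v"
  using fun_linear_add[of u "- v"] fun_linear_uminus by simp

lemma fun_linear_sum: "f (\<Sum>x\<in>A. g x) = (\<Sum>x\<in>A. f (g x))"
  by (induction A rule: infinite_finite_induct) (simp_all only: sum.infinite sum.empty sum.insert fun_linear_0 fun_linear_add simp_thms)

end

context
  fixes W assumes W: "fun_subspace W"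
begin

lemma fun_subspace_0: "0 \<in> W"
  and fun_subspace_add: "u \<in> W \<Longrightarrow> v \<in> W \<Longrightarrow> u + v \<in> W"
  and fun_subspace_scale: "v \<in> W \<Longrightarrow> cscale c v \<in> W"
  using W by (auto simp: fun_subspace_def)

lemma fun_subspace_diff: "u \<in> W \<Longrightarrow> v \<in> W \<Longrightarrow> u - v \<in> W"
  using fun_subspace_add[of u "cscale (-1) v"] fun_subspace_scale[of v "-1"] by simp

lemma fun_subspace_sum: "(\<And>x. x \<in> A \<Longrightarrow> g x \<in> W) \<Longrightarrow> (\<Sum>x\<in>A. g x) \<in> W"
  by (induction A rule: infinite_finite_induct) (auto simp: fun_subspace_0 fun_subspace_add)

end

lemma fun_subspace_fvec: "fun_subspace (fvec d)"
  by (auto simp: fun_subspace_def fvec_def cscale_def)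

section \<open>Matrices as linear maps on functions\<close>

lemma mat_fun_linear: "fun_linear (mat_fun d e M)"
  by (auto simp: fun_linear_def mat_fun_def cscale_def fun_eq_iff algebra_simps sum.distrib
      sum_distrib_left)

lemma mat_fun_in_fvec: "mat_fun d e M v \<in> fvec d"
  by (auto simp: mat_fun_def fvec_def)

lemma mat_fun_comp:
  "mat_fun d e M (mat_fun e f N v) = mat_fun d f (\<lambda>i k. \<Sum>j<e. M i j * N j k) v"
proof
  fix i
  have "(\<Sum>j<e. M i j * (\<Sum>k<f. N j k * v k)) = (\<Sum>k<f. (\<Sum>j<e. M i j * N j k) * v k)"
    by (simp add: sum_distrib_left sum_distrib_right mult.assoc) (rule sum.swap)
  then show "mat_fun d e M (mat_fun e f N v) i = mat_fun d f (\<lambda>i k. \<Sum>j<e. M i j * N j k) v i"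
    by (simp add: mat_fun_def)
qed

lemma mat_fun_cong:
  "(\<And>i j. i < d \<Longrightarrow> j < e \<Longrightarrow> M i j = N i j) \<Longrightarrow> mat_fun d e M = mat_fun d e N"
  by (auto simp: mat_fun_def fun_eq_iff)

definition delta :: "nat \<Rightarrow> nat \<Rightarrow> complex" where
  "delta i = (\<lambda>j. if j = i then 1 else 0)"

lemma delta_in_fvec: "i < d \<Longrightarrow> delta i \<in> fvec d"
  by (auto simp: delta_def fvec_def)

lemma mat_fun_delta: "j < e \<Longrightarrow> mat_fun d e M (delta j) = (\<lambda>i. if i < d then M i j else 0)"
  by (auto simp: mat_fun_def delta_def fun_eq_iff if_distrib cong: if_cong)

section \<open>The action attached to a matrix representation\<close>

lemma act_linear: "fun_linear (act r g)"
  by (simp add: act_def mat_fun_linear)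

lemmas act_simps = fun_linear_add[OF act_linear] fun_linear_scale[OF act_linear]
  fun_linear_0[OF act_linear] fun_linear_uminus[OF act_linear] fun_linear_diff[OF act_linear]
  fun_linear_sum[OF act_linear]

lemma act_in_fvec [simp]: "act r g v \<in> fvec (fst r)"
  by (simp add: act_def mat_fun_in_fvec)

lemma rep_entry_mult:
  assumes "is_rep G r" "g \<in> carrier G" "h \<in> carrier G" "i < fst r" "k < fst r"
  shows "snd r (g \<otimes>\<^bsub>G\<^esub> h) $$ (i, k) = (\<Sum>j<fst r. snd r g $$ (i, j) * snd r h $$ (j, k))"
proof -
  obtain d \<rho> where r: "r = (d, \<rho>)" by force
  have "\<rho> (g \<otimes>\<^bsub>G\<^esub> h) = \<rho> g * \<rho> h"
    using assms(1-3) by (auto simp: r is_rep_def hom_def mult_GL)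
  moreover have "\<rho> g \<in> carrier_mat d d" "\<rho> h \<in> carrier_mat d d"
    using rep_carrier assms(1-3) by (auto simp: r)
  ultimately show ?thesis
    using assms(4,5) by (auto simp: r scalar_prod_def lessThan_atLeast0)
qed

lemma act_mult:
  assumes "is_rep G r" "g \<in> carrier G" "h \<in> carrier G"
  shows "act r (g \<otimes>\<^bsub>G\<^esub> h) v = act r g (act r h v)"
  unfolding act_def mat_fun_comp
  by (rule fun_cong[OF mat_fun_cong]) (rule rep_entry_mult[OF assms])

lemma rep_one:
  assumes "is_rep G (d, \<rho>)" "group G"
  shows "\<rho> \<one>\<^bsub>G\<^esub> = 1\<^sub>m d"
  using hom_one[of \<rho> G "GL d"] assms by (simp add: is_rep_def one_GL group_GL)

lemma act_one:
  assumes "is_rep G r" "group G" "v \<in> fvec (fst r)"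
  shows "act r \<one>\<^bsub>G\<^esub> v = v"
proof -
  obtain d \<rho> where r: "r = (d, \<rho>)" by force
  show ?thesis
    using assms rep_one[of G d \<rho>]
    by (auto simp: r act_def mat_fun_def fvec_def fun_eq_iff of_bool_def if_distrib[of "\<lambda>x. x * _"]
      cong: if_cong)
qed

text \<open>\<open>vec d\<close> is a linear bijection from \<open>fvec d\<close> onto
  \<open>carrier_vec d\<close> that turns \<open>act\<close> into matrix-vector multiplication. It
  carries \<open>W\<close> to an invariant subspace in the sense of the definition, so later
  arguments can stay with functions.\<close>

lemma irreducible_rep_invariant_cases:
  assumes irr: "irreducible_rep G r" and W: "fun_subspace W" "W \<subseteq> fvec (fst r)"
    and inv: "\<And>g w. g \<in> carrier G \<Longrightarrow> w \<in> W \<Longrightarrow> act r g w \<in> W"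
  shows "W = {0} \<or> W = fvec (fst r)"
proof -
  obtain d \<rho> where r: "r = (d, \<rho>)" by force
  have inj: "v = w" if "vec d v = vec d w" "v \<in> fvec d" "w \<in> fvec d" for v w
  proof
    fix i
    show "v i = w i"
      using index_vec[of i d v] index_vec[of i d w] that by (cases "i < d") (auto simp: fvec_def)
  qed
  have Wd: "W \<subseteq> fvec d" using W by (simp add: r)
  have mult: "\<rho> g *\<^sub>v vec d w = vec d (act r g w)" if "g \<in> carrier G" for g w
  proof -
    have "\<rho> g \<in> carrier_mat d d"
      using rep_carrier[of G d \<rho> g] irr that by (simp add: irreducible_imp_rep r)
    then show ?thesis
      by (intro eq_vecI) (auto simp: r act_def mat_fun_def scalar_prod_def lessThan_atLeast0)
  qed
  have "invariant_subspace G (d, \<rho>) (vec d ` W)"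
    unfolding invariant_subspace_def prod.case
  proof (intro conjI ballI)
    have "submodule class_ring (vec d ` W) (module_vec TYPE(complex) d)"
    proof (rule submodule.intro[OF vec_module])
      show "vec d ` W \<subseteq> carrier (module_vec TYPE(complex) d)"
        by (auto simp: module_vec_simps)
      have "vec d 0 = 0\<^sub>v d" by auto
      then show "\<zero>\<^bsub>module_vec TYPE(complex) d\<^esub> \<in> vec d ` W"
        using fun_subspace_0[OF W(1)] unfolding module_vec_simps by (metis imageI)
      fix x y assume "x \<in> vec d ` W" "y \<in> vec d ` W"
      then obtain u v where uv: "x = vec d u" "y = vec d v" "u \<in> W" "v \<in> W" by blast
      then have "x + y = vec d (u + v)" by (intro eq_vecI) auto
      then show "x \<oplus>\<^bsub>module_vec TYPE(complex) d\<^esub> y \<in> vec d ` W"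
        using uv fun_subspace_add[OF W(1)] by (simp add: module_vec_simps)
    next
      fix c :: complex and x assume "x \<in> vec d ` W"
      then obtain u where u: "x = vec d u" "u \<in> W" by blast
      then have "c \<cdot>\<^sub>v x = vec d (cscale c u)" by (intro eq_vecI) (auto simp: cscale_def)
      then show "c \<odot>\<^bsub>module_vec TYPE(complex) d\<^esub> x \<in> vec d ` W"
        using u fun_subspace_scale[OF W(1)] by (simp add: module_vec_simps)
    qed
    then show "VectorSpace.subspace class_ring (vec d ` W) (module_vec TYPE(complex) d)"
      by (simp add: VectorSpace.subspace_def vec_vs)
  next
    fix g w assume "g \<in> carrier G" "w \<in> vec d ` W"
    then show "\<rho> g *\<^sub>v w \<in> vec d ` W" using mult inv by auto
  qed
  then consider "vec d ` W = {0\<^sub>v d}" | "vec d ` W = carrier_vec d"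
    using irr by (auto simp: irreducible_rep_def r)
  then show ?thesis
  proof cases
    case 1
    have "w = 0" if "w \<in> W" for w
    proof (rule inj)
      have "vec d w = 0\<^sub>v d" using 1 that by blast
      then show "vec d w = vec d 0" by auto
    qed (use that Wd fun_subspace_0[OF fun_subspace_fvec] in auto)
    then show ?thesis using fun_subspace_0[OF W(1)] by blast
  next
    case 2
    have "v \<in> W" if v: "v \<in> fvec d" for v
    proof -
      have "vec d v \<in> vec d ` W" using 2 by simp
      then show ?thesis using inj[OF _ v] Wd by blast
    qed
    then show ?thesis using Wd by (auto simp: r)
  qed
qed

section \<open>Schur orthogonality\<close>

text \<open>Gaussian elimination by induction on the set of equations: an unknown \<open>p\<close>
  with nonzero coefficient in equation \<open>c\<close> is eliminated together with that
  equation.\<close>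

lemma homogeneous_system_nontrivial_solution:
  fixes f :: "'i \<Rightarrow> 'c \<Rightarrow> 'a :: field"
  assumes "finite C" "finite I" "card C < card I"
  shows "\<exists>\<alpha>. (\<exists>i\<in>I. \<alpha> i \<noteq> 0) \<and> (\<forall>c\<in>C. (\<Sum>i\<in>I. \<alpha> i * f i c) = 0)"
  using assms
proof (induction C arbitrary: I f rule: finite_induct)
  case empty
  then have "I \<noteq> {}" by auto
  then show ?case by (intro exI[of _ "\<lambda>_. 1"]) auto
next
  case (insert c C)
  show ?case
  proof (cases "\<forall>i\<in>I. f i c = 0")
    case True
    obtain \<alpha> where "\<exists>i\<in>I. \<alpha> i \<noteq> 0" "\<forall>c\<in>C. (\<Sum>i\<in>I. \<alpha> i * f i c) = 0"
      using insert.IH[of I f] insert.prems insert.hyps by auto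
    then show ?thesis using True by (intro exI[of _ \<alpha>]) auto
  next
    case False
    then obtain p where p: "p \<in> I" "f p c \<noteq> 0" by blast
    define h where "h = (\<lambda>i x. f i x - f i c / f p c * f p x)"
    have "card C < card (I - {p})" using insert p by simp
    then obtain \<alpha> where \<alpha>: "\<exists>i\<in>I - {p}. \<alpha> i \<noteq> 0" "\<forall>x\<in>C. (\<Sum>i\<in>I - {p}. \<alpha> i * h i x) = 0"
      using insert.IH[of "I - {p}" h] insert.prems by auto
    \<comment> \<open>The value at \<open>p\<close> is the one that equation \<open>c\<close>
      forces. The full system then reduces to the coefficients \<open>h\<close>, which vanish at
      \<open>c\<close>.\<close>
    define \<beta> where "\<beta> = (\<lambda>i. if i = p then - (\<Sum>i\<in>I - {p}. \<alpha> i * f i c) / f p c else \<alpha> i)"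
    have sum: "(\<Sum>i\<in>I. \<beta> i * f i x) = (\<Sum>i\<in>I - {p}. \<alpha> i * h i x)" for x
    proof -
      have "(\<Sum>i\<in>I. \<beta> i * f i x) = \<beta> p * f p x + (\<Sum>i\<in>I - {p}. \<beta> i * f i x)"
        by (rule sum.remove) (use insert.prems p in auto)
      also have "(\<Sum>i\<in>I - {p}. \<beta> i * f i x) = (\<Sum>i\<in>I - {p}. \<alpha> i * f i x)"
        by (rule sum.cong) (auto simp: \<beta>_def)
      finally show ?thesis
        by (simp add: h_def \<beta>_def algebra_simps sum_subtractf sum_distrib_left sum_distrib_right
            sum_divide_distrib)
    qed
    have "(\<Sum>i\<in>I. \<beta> i * f i x) = 0" if "x \<in> insert c C" for x
      unfolding sum using that \<alpha>(2) p(2) by (auto simp: h_def)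
    moreover have "\<exists>i\<in>I. \<beta> i \<noteq> 0" using \<alpha>(1) by (auto simp: \<beta>_def)
    ultimately show ?thesis by blast
  qed
qed

text \<open>More than \<open>d\<close> vectors would give more unknowns than equations, one equation
  per coordinate, hence a nontrivial relation.\<close>

lemma card_independent_le:
  assumes "finite I" and v: "\<And>i. i \<in> I \<Longrightarrow> v i \<in> fvec d"
    and indep: "\<And>\<alpha>. (\<Sum>i\<in>I. cscale (\<alpha> i) (v i)) = 0 \<Longrightarrow> \<forall>i\<in>I. \<alpha> i = 0"
  shows "card I \<le> d"
proof (rule ccontr)
  assume "\<not> card I \<le> d"
  then obtain \<alpha> where \<alpha>: "\<exists>i\<in>I. \<alpha> i \<noteq> 0" "\<forall>k\<in>{..<d}. (\<Sum>i\<in>I. \<alpha> i * v i k) = 0"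
    using homogeneous_system_nontrivial_solution[of "{..<d}" I v] assms(1) by auto
  have "(\<Sum>i\<in>I. cscale (\<alpha> i) (v i)) k = 0" for k
  proof (cases "k < d")
    case False
    then have "v i k = 0" if "i \<in> I" for i using v[OF that] by (simp add: fvec_def)
    then show ?thesis by (simp add: sum_fun_apply cscale_def)
  qed (use \<alpha>(2) in \<open>simp add: sum_fun_apply cscale_def\<close>)
  then have "(\<Sum>i\<in>I. cscale (\<alpha> i) (v i)) = 0" by (intro ext) simp
  then show False using indep[of \<alpha>] \<alpha>(1) by blast
qed

lemma fvec_expand: "v \<in> fvec d \<Longrightarrow> v = (\<Sum>i<d. cscale (v i) (delta i))"
  by (auto simp: fun_eq_iff sum_fun_apply cscale_def delta_def fvec_def if_distrib cong: if_cong)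

text \<open>An injective map sends the \<open>e\<close> unit vectors to independent vectors of
  \<open>fvec d\<close>.\<close>

lemma mat_fun_injective_le:
  assumes "\<And>v. v \<in> fvec e \<Longrightarrow> mat_fun d e M v = 0 \<Longrightarrow> v = 0"
  shows "e \<le> d"
proof -
  have "card {..<e} \<le> d"
  proof (rule card_independent_le[where v = "\<lambda>j. mat_fun d e M (delta j)"])
    fix \<alpha> assume 0: "(\<Sum>j\<in>{..<e}. cscale (\<alpha> j) (mat_fun d e M (delta j))) = 0"
    define v where "v = (\<Sum>j<e. cscale (\<alpha> j) (delta j))"
    have v: "v \<in> fvec e" unfolding v_def
      by (intro fun_subspace_sum[OF fun_subspace_fvec] fun_subspace_scale[OF fun_subspace_fvec]
          delta_in_fvec) auto
    have "mat_fun d e M v = 0"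
      unfolding v_def fun_linear_sum[OF mat_fun_linear] fun_linear_scale[OF mat_fun_linear] 0 ..
    then have "v = 0" using assms v by blast
    moreover have "v j = \<alpha> j" if "j < e" for j
      using that by (simp add: v_def sum_fun_apply cscale_def delta_def if_distrib cong: if_cong)
    ultimately show "\<forall>i\<in>{..<e}. \<alpha> i = 0" by force
  qed (auto simp: mat_fun_in_fvec)
  then show ?thesis by simp
qed

section \<open>Schur's lemma\<close>

lemma kernel_subspace: "fun_linear f \<Longrightarrow> fun_subspace {v \<in> fvec e. f v = 0}"
  using fun_subspace_0[OF fun_subspace_fvec] fun_subspace_add[OF fun_subspace_fvec]
    fun_subspace_scale[OF fun_subspace_fvec]
  unfolding fun_subspace_def by (auto simp: fun_linear_0 fun_linear_add fun_linear_scale)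

lemma image_subspace: "fun_linear f \<Longrightarrow> fun_subspace (f ` fvec e)"
  unfolding fun_subspace_def
proof (intro conjI ballI allI)
  assume f: "fun_linear f"
  show "0 \<in> f ` fvec e"
    using fun_linear_0[OF f] fun_subspace_0[OF fun_subspace_fvec] by (metis imageI)
  show "u + v \<in> f ` fvec e" if "u \<in> f ` fvec e" "v \<in> f ` fvec e" for u v
    using that fun_subspace_add[OF fun_subspace_fvec]
    by (auto simp flip: fun_linear_add[OF f] intro!: imageI)
  show "cscale c v \<in> f ` fvec e" if "v \<in> f ` fvec e" for c v
    using that fun_subspace_scale[OF fun_subspace_fvec]
    by (auto simp flip: fun_linear_scale[OF f] intro!: imageI)
qed

text \<open>Kernel and image of an intertwining map are invariant, so a nonzero one is injective and
  surjective. Since \<open>iso_rep\<close> asks for equal degrees and an invertible matrix, an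
  explicit inverse is built.\<close>

lemma schur_zero_or_iso:
  assumes r: "irreducible_rep G r" and s: "irreducible_rep G s"
    and int: "\<And>g v. g \<in> carrier G \<Longrightarrow> v \<in> fvec (fst s) \<Longrightarrow>
      act r g (mat_fun (fst r) (fst s) T v) = mat_fun (fst r) (fst s) T (act s g v)"
  shows "(\<forall>v\<in>fvec (fst s). mat_fun (fst r) (fst s) T v = 0) \<or> iso_rep G s r"
proof (cases "\<forall>v\<in>fvec (fst s). mat_fun (fst r) (fst s) T v = 0")
  case False
  obtain d \<rho> where r_eq: "r = (d, \<rho>)" by force
  obtain e \<sigma> where s_eq: "s = (e, \<sigma>)" by force
  let ?T = "mat_fun d e T"
  have int: "act r g (?T v) = ?T (act s g v)" if "g \<in> carrier G" "v \<in> fvec e" for g v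
    using int[of g v] that by (simp add: r_eq s_eq)
  have nz: "\<exists>v\<in>fvec e. ?T v \<noteq> 0" using False by (simp add: r_eq s_eq)
  have "{v \<in> fvec e. ?T v = 0} = {0} \<or> {v \<in> fvec e. ?T v = 0} = fvec (fst s)"
  proof (rule irreducible_rep_invariant_cases[OF s kernel_subspace[OF mat_fun_linear]])
    fix g w assume "g \<in> carrier G" "w \<in> {v \<in> fvec e. ?T v = 0}"
    then show "act s g w \<in> {v \<in> fvec e. ?T v = 0}"
      using int[of g w] act_in_fvec[of s g w] by (simp add: s_eq act_simps)
  qed (auto simp: s_eq)
  then have inj: "v = 0" if "v \<in> fvec e" "?T v = 0" for v
    using nz that by (auto simp: s_eq)
  have "?T ` fvec e = {0} \<or> ?T ` fvec e = fvec (fst r)"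
  proof (rule irreducible_rep_invariant_cases[OF r image_subspace[OF mat_fun_linear]])
    fix g w assume "g \<in> carrier G" "w \<in> ?T ` fvec e"
    then show "act r g w \<in> ?T ` fvec e"
      using int act_in_fvec[of s g] by (force simp: s_eq)
  qed (auto simp: r_eq mat_fun_in_fvec)
  then have surj: "?T ` fvec e = fvec d" using nz by (auto simp: r_eq)
  \<comment> \<open>Preimages of the unit vectors are the columns of a right inverse of
    \<open>T\<close>.\<close>
  have "\<forall>k\<in>{..<d}. \<exists>w. w \<in> fvec e \<and> ?T w = delta k"
    using surj delta_in_fvec[of _ d] by (metis imageE lessThan_iff)
  then obtain w where w: "\<And>k. k < d \<Longrightarrow> w k \<in> fvec e \<and> ?T (w k) = delta k"
    by (metis lessThan_iff)
  have TS: "(\<Sum>j<e. T i j * w k j) = (if i = k then 1 else 0)" if "i < d" "k < d" for i k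
  proof -
    have "?T (w k) i = delta k i" using w[OF that(2)] by simp
    then show ?thesis using that by (simp add: mat_fun_def delta_def)
  qed
  have "e \<le> d" by (rule mat_fun_injective_le[of e d T]) (rule inj)
  moreover have "d \<le> e"
  \<comment> \<open>The right inverse is injective because applying \<open>T\<close> recovers its
    argument; this bounds \<open>d\<close> by \<open>e\<close>.\<close>
  proof (rule mat_fun_injective_le[of d e "\<lambda>j k. w k j"])
    fix v assume v: "v \<in> fvec d" "mat_fun e d (\<lambda>j k. w k j) v = 0"
    have "v i = ?T (mat_fun e d (\<lambda>j k. w k j) v) i" for i
      unfolding mat_fun_comp using v(1)
      by (auto simp: mat_fun_def TS fvec_def if_distrib[of "\<lambda>x. x * _"] cong: if_cong)
    then show "v = 0" unfolding v(2) fun_linear_0[OF mat_fun_linear] by auto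
  qed
  ultimately have de: "e = d" by simp
  define P where "P = mat d d (\<lambda>(i, j). T i j)"
  define S where "S = mat d d (\<lambda>(j, k). w k j)"
  have "P * S = 1\<^sub>m d"
    by (rule eq_matI) (use TS de in \<open>auto simp: P_def S_def scalar_prod_def lessThan_atLeast0\<close>)
  moreover from this have "S * P = 1\<^sub>m d"
    by (rule mat_mult_left_right_inverse[rotated 2]) (auto simp: P_def S_def)
  ultimately have "P \<in> carrier (GL d)"
    unfolding carrier_GL by (auto simp: P_def S_def intro!: bexI[of _ S])
  moreover have "P * \<sigma> g = \<rho> g * P" if g: "g \<in> carrier G" for g
  proof (rule eq_matI)
    have c: "\<sigma> g \<in> carrier_mat d d" "\<rho> g \<in> carrier_mat d d"
      using rep_carrier[OF _ g] r s de by (auto simp: r_eq s_eq dest: irreducible_imp_rep)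
    then show "dim_row (P * \<sigma> g) = dim_row (\<rho> g * P)" "dim_col (P * \<sigma> g) = dim_col (\<rho> g * P)"
      by (auto simp: P_def)
    fix i l assume "i < dim_row (\<rho> g * P)" "l < dim_col (\<rho> g * P)"
    then have il: "i < d" "l < d" using c by (auto simp: P_def)
    have "act r g (?T (delta l)) i = ?T (act s g (delta l)) i"
      using int[OF g delta_in_fvec, of l] il de by simp
    then show "(P * \<sigma> g) $$ (i, l) = (\<rho> g * P) $$ (i, l)"
      using il c de by (simp add: act_def r_eq s_eq mat_fun_delta)
        (simp add: P_def mat_fun_def scalar_prod_def lessThan_atLeast0)
  qed
  ultimately show ?thesis by (auto simp: iso_rep_def r_eq s_eq de)
qed simp

text \<open>A complex matrix of positive size has an eigenvalue \<open>c\<close>. The corresponding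
  eigenspace is invariant and nonzero, hence everything.\<close>

lemma schur_scalar:
  assumes r: "irreducible_rep G r"
    and int: "\<And>g v. g \<in> carrier G \<Longrightarrow> v \<in> fvec (fst r) \<Longrightarrow>
      act r g (mat_fun (fst r) (fst r) T v) = mat_fun (fst r) (fst r) T (act r g v)"
  shows "\<exists>c. \<forall>v\<in>fvec (fst r). mat_fun (fst r) (fst r) T v = cscale c v"
proof -
  define d where "d = fst r"
  have "d > 0" using r by (cases r) (simp add: irreducible_rep_def d_def)
  let ?M = "mat d d (\<lambda>(i, j). T i j)"
  obtain c where "eigenvalue ?M c"
    using spectrum_non_empty[of ?M d] \<open>d > 0\<close> by (auto simp: spectrum_def)
  then obtain x where x: "x \<in> carrier_vec d" "x \<noteq> 0\<^sub>v d" "?M *\<^sub>v x = c \<cdot>\<^sub>v x"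
    by (auto simp: eigenvalue_def eigenvector_def)
  define v where "v = (\<lambda>i. if i < d then x $ i else 0)"
  define f where "f = (\<lambda>v. mat_fun d d T v - cscale c v)"
  have lin: "fun_linear f"
    unfolding fun_linear_def f_def fun_linear_add[OF mat_fun_linear] fun_linear_scale[OF mat_fun_linear]
    by (auto simp: cscale_add cscale_diff mult.commute)
  have "f v i = 0" for i
  proof (cases "i < d")
    case True
    have "(?M *\<^sub>v x) $ i = c * x $ i" using x True by simp
    moreover have "(?M *\<^sub>v x) $ i = (\<Sum>j<d. T i j * v j)"
      using True x(1) by (simp add: scalar_prod_def v_def lessThan_atLeast0)
    ultimately show ?thesis using True by (simp add: f_def mat_fun_def cscale_def v_def)
  qed (simp add: f_def mat_fun_def cscale_def v_def)
  then have "v \<in> {v \<in> fvec d. f v = 0}" by (auto simp: fvec_def v_def)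
  moreover have "v \<noteq> 0"
  proof
    assume "v = 0"
    then have "v i = 0" for i by simp
    then have "x $ i = 0" if "i < d" for i using that by (metis v_def)
    then have "x = 0\<^sub>v d" using x(1) by (intro eq_vecI) auto
    then show False using x(2) by simp
  qed
  moreover have "{v \<in> fvec d. f v = 0} = {0} \<or> {v \<in> fvec d. f v = 0} = fvec (fst r)"
  proof (rule irreducible_rep_invariant_cases[OF r kernel_subspace[OF lin]])
    fix g w assume g: "g \<in> carrier G" and w: "w \<in> {v \<in> fvec d. f v = 0}"
    have "f (act r g w) = act r g (f w)"
      using int[OF g, of w] w by (simp add: f_def act_simps d_def)
    then show "act r g w \<in> {v \<in> fvec d. f v = 0}"
      using w by (simp add: act_simps d_def)
  qed (auto simp: d_def)
  ultimately have "{v \<in> fvec d. f v = 0} = fvec d" unfolding d_def by blast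
  then have "mat_fun d d T v = cscale c v" if "v \<in> fvec d" for v
    using that by (auto simp: f_def)
  then show ?thesis by (auto simp: d_def)
qed

section \<open>Orthogonality and independence of matrix coefficients\<close>

context
  fixes G :: "('g, 'x) monoid_scheme" (structure)
  assumes G: "group G" and fin: "finite (carrier G)"
begin

text \<open>\<open>T\<close> is the sum over \<open>g\<close> of \<open>r(g) E s(g)^-1\<close>,
  where \<open>E\<close> is the elementary matrix with its 1 at position \<open>(j, k)\<close>. The
  substitution of \<open>h \<otimes> g\<close> for \<open>g\<close> moves \<open>h\<close> from the
  left of \<open>T\<close> to its right.\<close>

lemma sum_coefficients_intertwines:
  assumes r: "is_rep G r" and s: "is_rep G s" and "j < fst r" "k < fst s"
    and h: "h \<in> carrier G" and "i < fst r" "l < fst s"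
  defines "T \<equiv> \<lambda>i l. \<Sum>g\<in>carrier G. snd r g $$ (i, j) * snd s (inv\<^bsub>G\<^esub> g) $$ (k, l)"
  shows "(\<Sum>a<fst r. snd r h $$ (i, a) * T a l) = (\<Sum>b<fst s. T i b * snd s h $$ (b, l))"
proof -
  interpret group G by (rule G)
  have "(\<Sum>a<fst r. snd r h $$ (i, a) * T a l) =
      (\<Sum>g\<in>carrier G. (\<Sum>a<fst r. snd r h $$ (i, a) * snd r g $$ (a, j)) * snd s (inv g) $$ (k, l))"
    by (simp add: T_def sum_distrib_left sum_distrib_right mult.assoc) (rule sum.swap)
  also have "\<dots> = (\<Sum>g\<in>carrier G. snd r (h \<otimes> g) $$ (i, j) * snd s (inv g) $$ (k, l))"
    using assms by (intro sum.cong refl) (simp add: rep_entry_mult[OF r])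
  also have "\<dots> = (\<Sum>g\<in>carrier G. snd r g $$ (i, j) * snd s (inv g \<otimes> h) $$ (k, l))"
  proof (rule sum.reindex_bij_witness[of _ "\<lambda>g. inv h \<otimes> g" "\<lambda>g. h \<otimes> g"])
    fix g assume "g \<in> carrier G"
    then show "snd r (h \<otimes> g) $$ (i, j) * snd s (inv (h \<otimes> g) \<otimes> h) $$ (k, l) =
        snd r (h \<otimes> g) $$ (i, j) * snd s (inv g) $$ (k, l)"
      using h by (simp add: inv_mult_group m_assoc)
  qed (use h in \<open>auto simp: m_assoc[symmetric]\<close>)
  also have "\<dots> = (\<Sum>g\<in>carrier G. \<Sum>b<fst s. snd r g $$ (i, j) * (snd s (inv g) $$ (k, b) * snd s h $$ (b, l)))"
    using assms by (intro sum.cong refl) (simp add: rep_entry_mult[OF s] sum_distrib_left)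
  also have "\<dots> = (\<Sum>b<fst s. T i b * snd s h $$ (b, l))"
    by (subst sum.swap) (simp add: T_def sum_distrib_right mult.assoc)
  finally show ?thesis .
qed

lemma sum_coefficients_intertwines_act:
  assumes r: "is_rep G r" and s: "is_rep G s" and jk: "j < fst r" "k < fst s"
    and h: "h \<in> carrier G"
  defines "T \<equiv> \<lambda>i l. \<Sum>g\<in>carrier G. snd r g $$ (i, j) * snd s (inv\<^bsub>G\<^esub> g) $$ (k, l)"
  shows "act r h (mat_fun (fst r) (fst s) T v) = mat_fun (fst r) (fst s) T (act s h v)"
  unfolding act_def mat_fun_comp
  by (rule fun_cong[OF mat_fun_cong])
    (use sum_coefficients_intertwines[OF r s jk h] in \<open>simp add: T_def\<close>)

text \<open>By Schur's lemma the averaged elementary matrix is zero; its entry \<open>(i, l)\<close>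
  is read off on \<open>delta l\<close>.\<close>

lemma sum_coefficients_not_iso:
  assumes r: "irreducible_rep G r" and s: "irreducible_rep G s" and niso: "\<not> iso_rep G s r"
    and "j < fst r" "k < fst s" "i < fst r" "l < fst s"
  shows "(\<Sum>g\<in>carrier G. snd r g $$ (i, j) * snd s (inv\<^bsub>G\<^esub> g) $$ (k, l)) = 0"
proof -
  define T where "T = (\<lambda>i l. \<Sum>g\<in>carrier G. snd r g $$ (i, j) * snd s (inv\<^bsub>G\<^esub> g) $$ (k, l))"
  have "mat_fun (fst r) (fst s) T (delta l) = 0"
    using schur_zero_or_iso[OF r s, of T] niso
      sum_coefficients_intertwines_act[of r s j k, folded T_def] assms
    by (auto simp: irreducible_imp_rep delta_in_fvec)
  from fun_cong[OF this, of i] show ?thesis using assms by (simp add: mat_fun_delta T_def)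
qed

lemma sum_coefficients_same:
  assumes r: "irreducible_rep G r" and "j < fst r" "k < fst r" "i < fst r" "l < fst r"
  shows "(\<Sum>g\<in>carrier G. snd r g $$ (i, j) * snd r (inv\<^bsub>G\<^esub> g) $$ (k, l)) =
    (if i = l \<and> j = k then of_nat (card (carrier G)) / of_nat (fst r) else 0)"
proof -
  interpret group G by (rule G)
  define d where "d = fst r"
  define T where "T = (\<lambda>i l. \<Sum>g\<in>carrier G. snd r g $$ (i, j) * snd r (inv g) $$ (k, l))"
  have rep: "is_rep G r" using r by (rule irreducible_imp_rep)
  obtain c where c: "\<forall>v\<in>fvec d. mat_fun d d T v = cscale c v"
    using schur_scalar[OF r, of T] sum_coefficients_intertwines_act[of r r j k, folded T_def] assms rep
    unfolding d_def by metis
  have T: "T a b = (if a = b then c else 0)" if "a < d" "b < d" for a b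
  proof -
    have "mat_fun d d T (delta b) a = cscale c (delta b) a"
      using c that by (simp add: delta_in_fvec)
    then have "T a b = c * delta b a" using that by (simp add: mat_fun_delta cscale_def)
    then show ?thesis by (simp add: delta_def)
  qed
  \<comment> \<open>The scalar is found from the trace: summing over the diagonal merges the two
    factors into the matrix of \<open>inv g \<otimes> g\<close>, the identity.\<close>
  have "of_nat d * c = (\<Sum>a<d. T a a)" by (simp add: T)
  also have "\<dots> = (\<Sum>g\<in>carrier G. \<Sum>a<d. snd r (inv g) $$ (k, a) * snd r g $$ (a, j))"
    unfolding T_def by (subst sum.swap) (simp add: mult.commute)
  also have "\<dots> = (\<Sum>g\<in>carrier G. snd r (inv g \<otimes> g) $$ (k, j))"
    using assms by (intro sum.cong refl) (simp only: rep_entry_mult[OF rep] d_def inv_closed)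
  also have "\<dots> = (\<Sum>g\<in>carrier G. if j = k then 1 else 0)"
  proof (intro sum.cong refl)
    fix g assume "g \<in> carrier G"
    then show "snd r (inv g \<otimes> g) $$ (k, j) = (if j = k then 1 else 0)"
      using rep_one[of G "fst r" "snd r"] rep is_group assms(2,3) by simp
  qed
  finally have "of_nat d * c = (if j = k then of_nat (card (carrier G)) else 0)" by simp
  moreover have "d > 0" using assms by (simp add: d_def)
  ultimately have "c = (if j = k then of_nat (card (carrier G)) / of_nat d else 0)"
    by (auto simp: field_simps)
  then show ?thesis using T[of i l] assms by (auto simp: T_def d_def)
qed

text \<open>Multiplying the relation by one coefficient of \<open>r w\<close> at the inverse and
  summing over the group leaves a single term by orthogonality. The inner double sum is the trace of
  \<open>B i\<close> times the matrix of \<open>g\<close>, the form in which averaged characters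
  appear later.\<close>

lemma matrix_coefficients_independent:
  assumes "finite I" and irr: "\<And>i. i \<in> I \<Longrightarrow> irreducible_rep G (r i)"
    and niso: "\<And>i j. i \<in> I \<Longrightarrow> j \<in> I \<Longrightarrow> i \<noteq> j \<Longrightarrow> \<not> iso_rep G (r i) (r j)"
    and zero: "\<And>g. g \<in> carrier G \<Longrightarrow>
      (\<Sum>i\<in>I. \<alpha> i * (\<Sum>a<fst (r i). \<Sum>b<fst (r i). B i b a * snd (r i) g $$ (a, b))) = 0"
    and w: "w \<in> I" "k < fst (r w)" "l < fst (r w)"
  shows "\<alpha> w * B w k l = 0"
proof -
  let ?q = "\<lambda>g. snd (r w) (inv\<^bsub>G\<^esub> g) $$ (k, l)"
  define N where "N = (of_nat (card (carrier G)) / of_nat (fst (r w)) :: complex)"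
  have "carrier G \<noteq> {}" using group.is_monoid[OF G] monoid.one_closed by blast
  then have N: "N \<noteq> 0" using fin w by (auto simp: N_def)
  have inner: "(\<Sum>g\<in>carrier G. snd (r i) g $$ (a, b) * ?q g) = (if i = w \<and> a = l \<and> b = k then N else 0)"
    if "i \<in> I" "a < fst (r i)" "b < fst (r i)" for i a b
  proof (cases "i = w")
    case True
    then show ?thesis
      using sum_coefficients_same[of "r w" b k a l] irr that w by (simp add: N_def)
  next
    case False
    then show ?thesis
      using sum_coefficients_not_iso[of "r i" "r w" b k a l] irr niso that w by simp
  qed
  have "0 = (\<Sum>g\<in>carrier G. (\<Sum>i\<in>I. \<alpha> i * (\<Sum>a<fst (r i). \<Sum>b<fst (r i). B i b a * snd (r i) g $$ (a, b))) * ?q g)"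
    using zero by simp
  also have "\<dots> = (\<Sum>i\<in>I. \<alpha> i * (\<Sum>g\<in>carrier G. (\<Sum>a<fst (r i). \<Sum>b<fst (r i). B i b a * snd (r i) g $$ (a, b)) * ?q g))"
    by (simp add: sum_distrib_left sum_distrib_right mult.assoc) (rule sum.swap)
  also have "\<dots> = (\<Sum>i\<in>I. \<alpha> i * (\<Sum>a<fst (r i). \<Sum>b<fst (r i). B i b a * (\<Sum>g\<in>carrier G. snd (r i) g $$ (a, b) * ?q g)))"
  proof (intro sum.cong refl arg_cong[where f = "\<lambda>x. _ * x"])
    fix i
    show "(\<Sum>g\<in>carrier G. (\<Sum>a<fst (r i). \<Sum>b<fst (r i). B i b a * snd (r i) g $$ (a, b)) * ?q g) =
      (\<Sum>a<fst (r i). \<Sum>b<fst (r i). B i b a * (\<Sum>g\<in>carrier G. snd (r i) g $$ (a, b) * ?q g))"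
      unfolding sum_distrib_right sum_distrib_left mult.assoc
      by (subst sum.swap) (rule sum.cong[OF refl], rule sum.swap)
  qed
  also have "\<dots> = (\<Sum>i\<in>I. if i = w then \<alpha> w * (\<Sum>a<fst (r w). \<Sum>b<fst (r w). B w b a * (if a = l \<and> b = k then N else 0)) else 0)"
    by (intro sum.cong refl) (auto simp: inner)
  also have "\<dots> = \<alpha> w * (\<Sum>a<fst (r w). \<Sum>b<fst (r w). if a = l then if b = k then B w b a * N else 0 else 0)"
    using w(1) assms(1) by (auto intro!: arg_cong[where f = "\<lambda>x. _ * x"] sum.cong)
  also have "(\<Sum>a<fst (r w). \<Sum>b<fst (r w). if a = l then if b = k then B w b a * N else 0 else 0)
      = (\<Sum>a<fst (r w). if a = l then B w k a * N else 0)"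
    using w(2) by (intro sum.cong refl) auto
  also have "\<dots> = B w k l * N" using w(3) by simp
  finally show ?thesis using N by simp
qed

end

section \<open>Conjugacy classes of the symmetric group\<close>

text \<open>The complements of \<open>A\<close> and of its image in \<open>S\<close> have the same
  size, so any bijection between them completes \<open>f\<close>.\<close>

lemma extend_inj_on_to_permutes:
  assumes S: "finite S" and f: "inj_on f A" "A \<subseteq> S" "f ` A \<subseteq> S"
  obtains p where "p permutes S" "\<And>x. x \<in> A \<Longrightarrow> p x = f x"
proof -
  have "card (f ` A) = card A" by (rule card_image[OF f(1)])
  then have "card (S - A) = card (S - f ` A)"
    using S f by (simp add: card_Diff_subset finite_subset)
  then obtain h where h: "bij_betw h (S - A) (S - f ` A)"
    using S finite_same_card_bij[of "S - A" "S - f ` A"] by auto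
  define p where "p = (\<lambda>x. if x \<in> A then f x else if x \<in> S then h x else x)"
  have "bij_betw p A (f ` A)"
    using f(1) by (subst bij_betw_cong[of _ _ f]) (auto simp: p_def bij_betw_def)
  moreover have "bij_betw p (S - A) (S - f ` A)"
    using h by (subst bij_betw_cong[of _ _ h]) (auto simp: p_def)
  ultimately have "bij_betw p (A \<union> (S - A)) (f ` A \<union> (S - f ` A))"
    by (rule bij_betw_combine) auto
  moreover have "A \<union> (S - A) = S" "f ` A \<union> (S - f ` A) = S" using f by auto
  ultimately have "p permutes S"
    using f(2) by (intro bij_imp_permutes) (auto simp: p_def)
  then show ?thesis by (rule that) (simp add: p_def)
qed

text \<open>Two cycles of equal length are matched by sending the \<open>n\<close>-th iterate of
  \<open>x\<close> to the \<open>n\<close>-th iterate of \<open>y\<close>.\<close>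

lemma orbit_conjugation:
  assumes p: "x \<in> orbit p x" and q: "y \<in> orbit q y" and card: "card (orbit p x) = card (orbit q y)"
  obtains h where "bij_betw h (orbit p x) (orbit q y)" "\<And>z. z \<in> orbit p x \<Longrightarrow> h (p z) = q (h z)"
proof -
  \<comment> \<open>This is the cycle length: the iterates below \<open>N\<close> enumerate the
    orbit without repetition and the \<open>N\<close>-th one returns to \<open>x\<close>.\<close>
  define N where "N = funpow_dist1 p x x"
  let ?f = "\<lambda>n. (p ^^ n) x" and ?g = "\<lambda>n. (q ^^ n) y"
  have f: "inj_on ?f {0..<N}" "orbit p x = ?f ` {0..<N}" "?f N = x"
    using inj_on_funpow_dist1[OF p] orbit_conv_funpow_dist1[OF p] funpow_dist1_prop[OF p]
    by (auto simp: N_def)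
  have "card (orbit p x) = N" using card_image[OF f(1)] f(2) by simp
  moreover have "card (orbit q y) = funpow_dist1 q y y"
    using card_image[OF inj_on_funpow_dist1[OF q]] orbit_conv_funpow_dist1[OF q] by simp
  ultimately have N: "N = funpow_dist1 q y y" using card by simp
  have g: "inj_on ?g {0..<N}" "orbit q y = ?g ` {0..<N}" "?g N = y"
    using inj_on_funpow_dist1[OF q] orbit_conv_funpow_dist1[OF q] funpow_dist1_prop[OF q]
    by (auto simp: N)
  have "N > 0" by (simp add: N_def)
  define h where "h = (\<lambda>z. ?g (inv_into {0..<N} ?f z))"
  have h: "h (?f n) = ?g n" if "n < N" for n
    using inv_into_f_f[OF f(1), of n] that by (simp add: h_def)
  have "bij_betw h (orbit p x) (orbit q y)"
    unfolding f(2) g(2) bij_betw_def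
  proof
    show "inj_on h (?f ` {0..<N})"
      using g(1) h by (auto simp: inj_on_def)
    show "h ` ?f ` {0..<N} = ?g ` {0..<N}"
      unfolding image_image using h by (intro image_cong) auto
  qed
  moreover have "h (p z) = q (h z)" if z: "z \<in> orbit p x" for z
  proof -
    obtain n where n: "n < N" "z = ?f n" using z[unfolded f(2)] by auto
    show ?thesis
    proof (cases "Suc n < N")
      case True
      then show ?thesis using h[of "Suc n"] h[of n] n by simp
    next
      case False
      then have N: "N = Suc n" using n by simp
      have "p z = x" using f(3) n by (simp add: N)
      moreover have "q (h z) = y" using g(3) h[of n] n by (simp add: N)
      ultimately show ?thesis using h[of 0] \<open>N > 0\<close> by simp
    qed
  qed
  ultimately show ?thesis by (rule that)
qed

text \<open>For a permutation of a finite \<open>S\<close> this is \<open>i\<close> times the number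
  of its cycles of length \<open>i\<close>, fixed points being cycles of length one.\<close>

definition orbit_count :: "('a \<Rightarrow> 'a) \<Rightarrow> 'a set \<Rightarrow> nat \<Rightarrow> nat" where
  "orbit_count p S i = card {x \<in> S. card (orbit p x) = i}"

text \<open>Deleting one cycle leaves all other orbits unchanged. The subtraction is not truncated,
  because the deleted orbit lies inside the set counted for its own length.\<close>

lemma orbit_count_remove_orbit:
  assumes S: "finite S" and p: "p permutes S" and x: "x \<in> S"
  defines "T \<equiv> S - orbit p x"
  shows "orbit_count (perm_restrict p T) T i =
    orbit_count p S i - (if i = card (orbit p x) then i else 0)"
proof -
  have cyc: "cyclic_on p (orbit p x)" using cyclic_on_orbit[OF p S] .
  have perm: "perm_restrict p T permutes T"
    unfolding T_def by (rule perm_restrict_diff_cyclic[OF p cyc])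
  have sub: "orbit p x \<subseteq> S" by (rule permutes_orbit_subset[OF p x])
  have fin: "finite (orbit p x)" using S sub finite_subset by blast
  have "orbit (perm_restrict p T) z = orbit p z" if "z \<in> T" for z
  proof (rule orbit_cong0[OF that])
    show "perm_restrict p T \<in> T \<rightarrow> T" using perm by (simp add: permutes_in_image)
  qed (simp add: perm_restrict_simps)
  then have "{z \<in> T. card (orbit (perm_restrict p T) z) = i} = {z \<in> T. card (orbit p z) = i}"
    by auto
  also have "\<dots> = {z \<in> S. card (orbit p z) = i} - (if i = card (orbit p x) then orbit p x else {})"
    using orbit_cyclic_eq3[OF cyc] by (auto simp: T_def)
  finally have "{z \<in> T. card (orbit (perm_restrict p T) z) = i} =
      {z \<in> S. card (orbit p z) = i} - (if i = card (orbit p x) then orbit p x else {})" .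
  moreover have "(if i = card (orbit p x) then orbit p x else {}) \<subseteq> {z \<in> S. card (orbit p z) = i}"
    using sub orbit_cyclic_eq3[OF cyc] by auto
  ultimately show ?thesis
    using fin S by (auto simp: orbit_count_def card_Diff_subset)
qed

text \<open>Equal counts provide, for any cycle of \<open>p\<close>, a cycle of \<open>q\<close> of
  the same length. Both are removed, the remainders are matched by induction, and the two bijections
  are glued.\<close>

lemma conjugation_of_orbit_count_eq:
  assumes "finite S" "finite S'" "p permutes S" "q permutes S'"
    and "\<And>i. orbit_count p S i = orbit_count q S' i"
  shows "\<exists>h. bij_betw h S S' \<and> (\<forall>x\<in>S. h (p x) = q (h x))"
  using assms
proof (induction "card S" arbitrary: S S' p q rule: less_induct)
  case less
  note p = \<open>p permutes S\<close> and q = \<open>q permutes S'\<close> and fin = \<open>finite S\<close> \<open>finite S'\<close>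
    and count = \<open>\<And>i. orbit_count p S i = orbit_count q S' i\<close>
  show ?case
  proof (cases "S = {}")
    case True
    have "S' = {}"
    proof (rule ccontr)
      assume "S' \<noteq> {}"
      then obtain y where "y \<in> S'" by blast
      then have "orbit_count q S' (card (orbit q y)) > 0"
        using fin by (auto simp: orbit_count_def card_gt_0_iff)
      then show False using count[of "card (orbit q y)"] True by (simp add: orbit_count_def)
    qed
    then show ?thesis using True by (auto simp: bij_betw_def)
  next
    case False
    then obtain x where x: "x \<in> S" by blast
    then have "orbit_count p S (card (orbit p x)) > 0"
      using fin by (auto simp: orbit_count_def card_gt_0_iff)
    then have "{y \<in> S'. card (orbit q y) = card (orbit p x)} \<noteq> {}"
      unfolding count by (auto simp: orbit_count_def card_gt_0_iff)
    then obtain y where y: "y \<in> S'" "card (orbit q y) = card (orbit p x)" by blast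
    have px: "x \<in> orbit p x" and qy: "y \<in> orbit q y"
      using permutation_self_in_orbit permutation_permutes p q fin by metis+
    obtain h where h: "bij_betw h (orbit p x) (orbit q y)"
        "\<And>z. z \<in> orbit p x \<Longrightarrow> h (p z) = q (h z)"
      using orbit_conjugation[OF px qy y(2)[symmetric]] by blast
    have sub: "orbit p x \<subseteq> S" "orbit q y \<subseteq> S'"
      using permutes_orbit_subset p q x y by metis+
    define T where "T = S - orbit p x"
    define T' where "T' = S' - orbit q y"
    have "card T < card S"
      using fin sub px x by (intro psubset_card_mono) (auto simp: T_def)
    moreover have perm: "perm_restrict p T permutes T" "perm_restrict q T' permutes T'"
      unfolding T_def T'_def using p q fin
      by (auto intro: perm_restrict_diff_cyclic cyclic_on_orbit)
    moreover have "orbit_count (perm_restrict p T) T i = orbit_count (perm_restrict q T') T' i" for i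
      unfolding T_def T'_def orbit_count_remove_orbit[OF fin(1) p x]
        orbit_count_remove_orbit[OF fin(2) q y(1)] count y(2) ..
    ultimately obtain h' where h': "bij_betw h' T T'"
        "\<forall>z\<in>T. h' (perm_restrict p T z) = perm_restrict q T' (h' z)"
      using less.hyps[of T T' "perm_restrict p T" "perm_restrict q T'"] fin
      by (auto simp: T_def T'_def)
    define k where "k = (\<lambda>z. if z \<in> orbit p x then h z else h' z)"
    have "bij_betw k (orbit p x \<union> T) (orbit q y \<union> T')"
    proof (rule bij_betw_combine)
      show "bij_betw k (orbit p x) (orbit q y)"
        using h(1) by (subst bij_betw_cong[of _ _ h]) (auto simp: k_def)
      show "bij_betw k T T'"
        using h'(1) by (subst bij_betw_cong[of _ _ h']) (auto simp: k_def T_def)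
    qed (auto simp: T'_def)
    moreover have "orbit p x \<union> T = S" "orbit q y \<union> T' = S'" using sub by (auto simp: T_def T'_def)
    ultimately have "bij_betw k S S'" by simp
    moreover have "k (p z) = q (k z)" if "z \<in> S" for z
    proof (cases "z \<in> orbit p x")
      case True
      then show ?thesis using h(2) by (simp add: k_def orbit.step)
    next
      case False
      then have z: "z \<in> T" using that by (simp add: T_def)
      then have "p z \<in> T" using permutes_in_image[OF perm(1), of z] by (simp add: perm_restrict_simps)
      moreover have "h' z \<in> T'" using h'(1) z by (auto simp: bij_betw_def)
      ultimately show ?thesis using h'(2) z False by (auto simp: k_def T_def perm_restrict_simps)
    qed
    ultimately show ?thesis by blast
  qed
qed

text \<open>
  Recording only the lengths \<open>i\<close> that occur keeps this set of size \<open>O(\<surd>k)\<close>, which is what makes the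
  number of cycle types subexponential.
\<close>

definition cycle_type :: "nat \<Rightarrow> (nat \<Rightarrow> nat) \<Rightarrow> (nat \<times> nat) set" where
  "cycle_type k p = {(i, c). i \<in> {1..k} \<and> c \<noteq> 0 \<and> c = orbit_count p {1..k} i}"

section \<open>The number of cycle types\<close>

lemma card_orbit_bounds:
  assumes "p permutes {1..k}" "x \<in> {1..k}"
  shows "card (orbit p x) \<in> {1..k}"
proof -
  have "orbit p x \<subseteq> {1..k}" using permutes_orbit_subset assms by metis
  moreover from this have "card (orbit p x) \<noteq> 0"
    using orbit_nonempty[of p x] finite_subset by (metis card_0_eq finite_atLeastAtMost)
  ultimately show ?thesis using card_mono[of "{1..k}" "orbit p x"] by simp
qed

text \<open>A length missing from the cycle type has count zero, so the cycle type determines every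
  \<open>orbit_count\<close>.\<close>

lemma conjugate_of_cycle_type_eq:
  assumes p: "p permutes {1..k}" and q: "q permutes {1..k}" and eq: "cycle_type k p = cycle_type k q"
  obtains h where "h permutes {1..k}" "q = h \<circ> p \<circ> inv' h"
proof -
  have "orbit_count p {1..k} i = orbit_count q {1..k} i" for i
  proof (cases "i \<in> {1..k}")
    case True
    have "(i, c) \<in> cycle_type k p \<longleftrightarrow> c \<noteq> 0 \<and> c = orbit_count p {1..k} i" for c p
      using True by (auto simp: cycle_type_def)
    then show ?thesis using eq by metis
  next
    case False
    then have "{x \<in> {1..k}. card (orbit p x) = i} = {}" "{x \<in> {1..k}. card (orbit q x) = i} = {}"
      using card_orbit_bounds p q by blast+
    then show ?thesis by (simp only: orbit_count_def)
  qed
  then obtain h where h: "bij_betw h {1..k} {1..k}" "\<forall>x\<in>{1..k}. h (p x) = q (h x)"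
    using conjugation_of_orbit_count_eq[of "{1..k}" "{1..k}" p q] p q by auto
  define h' where "h' = (\<lambda>x. if x \<in> {1..k} then h x else x)"
  have "bij_betw h' {1..k} {1..k}"
    using h(1) by (subst bij_betw_cong[of _ _ h]) (auto simp: h'_def)
  then have h': "h' permutes {1..k}" by (rule bij_imp_permutes) (auto simp: h'_def)
  have "h' (p x) = q (h' x)" for x
  proof (cases "x \<in> {1..k}")
    case True
    then have "p x \<in> {1..k}" using p permutes_in_image by metis
    then show ?thesis using True h by (auto simp: h'_def)
  next
    case False
    then show ?thesis using p q permutes_not_in by (metis h'_def)
  qed
  then have "h' \<circ> p = q \<circ> h'" by auto
  then have "h' \<circ> p \<circ> inv' h' = q"
    using permutes_inv_o(1)[OF h'] by (metis comp_assoc comp_id)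
  then show ?thesis using that h' by metis
qed

text \<open>A length \<open>i\<close> that occurs accounts for at least \<open>i\<close> points. If
  \<open>D\<close> is the set of occurring lengths, then \<open>0 + 1 + ... + (card D - 1)\<close>
  is at most \<open>k\<close>, which makes \<open>card D\<close> of order
  \<open>sqrt k\<close>.\<close>

lemma card_cycle_type:
  assumes p: "p permutes {1..k}"
  shows "cycle_type k p \<subseteq> {1..k} \<times> {1..k}"
    and "card (cycle_type k p) \<le> nat \<lfloor>sqrt (2 * real k)\<rfloor> + 1"
proof -
  let ?N = "orbit_count p {1..k}"
  define D where "D = {i \<in> {1..k}. ?N i \<noteq> 0}"
  have D: "cycle_type k p = (\<lambda>i. (i, ?N i)) ` D" by (auto simp: cycle_type_def D_def)
  have le: "?N i \<le> k" for i
    unfolding orbit_count_def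
    using card_mono[of "{1..k}" "{x \<in> {1..k}. card (orbit p x) = i}", OF _ Collect_restrict]
    by simp
  then show "cycle_type k p \<subseteq> {1..k} \<times> {1..k}" by (auto simp: cycle_type_def)
  have ge: "i \<le> ?N i" if "i \<in> D" for i
  proof -
    have "{x \<in> {1..k}. card (orbit p x) = i} \<noteq> {}"
      using that unfolding D_def orbit_count_def by (metis (mono_tags, lifting) card.empty mem_Collect_eq)
    then obtain x where x: "x \<in> {1..k}" "card (orbit p x) = i" by blast
    have cyc: "cyclic_on p (orbit p x)" using cyclic_on_orbit[OF p] by simp
    have "orbit p x \<subseteq> {z \<in> {1..k}. card (orbit p z) = i}"
      using orbit_cyclic_eq3[OF cyc] x permutes_orbit_subset[OF p x(1)] by auto
    then have "card (orbit p x) \<le> ?N i" unfolding orbit_count_def by (intro card_mono) auto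
    then show ?thesis using x by simp
  qed
  have "(\<Sum>{0..<card D}) \<le> \<Sum>D" by (rule card_sum_le_nat_sum)
  also have "\<dots> \<le> (\<Sum>i\<in>D. ?N i)" using ge by (rule sum_mono)
  also have "\<dots> = card (\<Union>i\<in>D. {x \<in> {1..k}. card (orbit p x) = i})"
    unfolding orbit_count_def by (rule card_UN_disjoint[symmetric]) (auto simp: D_def)
  also have "\<dots> \<le> card {1..k}" by (rule card_mono) auto
  finally have "2 * (\<Sum>{0..<card D}) \<le> 2 * k" by simp
  moreover have "2 * (\<Sum>{0..<m}) = m * (m - 1)" for m :: nat
    by (induction m) (auto simp: algebra_simps sum.atLeast0_lessThan_Suc split: nat_diff_split)
  ultimately have "card D * (card D - 1) \<le> 2 * k" by simp
  then have "(card D - 1)\<^sup>2 \<le> 2 * k"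
    unfolding power2_eq_square by (meson diff_le_self le_trans mult_le_mono1)
  then have "real (card D - 1) \<le> sqrt (2 * real k)"
    by (intro real_le_rsqrt) (metis of_nat_le_iff of_nat_mult of_nat_numeral of_nat_power)
  then have "card D - 1 \<le> nat \<lfloor>sqrt (2 * real k)\<rfloor>" by linarith
  moreover have "card (cycle_type k p) = card D"
    unfolding D by (rule card_image) (auto simp: inj_on_def)
  ultimately show "card (cycle_type k p) \<le> nat \<lfloor>sqrt (2 * real k)\<rfloor> + 1" by simp
qed

lemma sum_powers_le_power_Suc: "(\<Sum>i\<le>r. M ^ i) \<le> (M + 1 :: nat) ^ r"
proof (induction r)
  case (Suc r)
  have "M ^ Suc r \<le> (M + 1) ^ r * M"
    unfolding power_Suc2 by (intro mult_le_mono1 power_mono) auto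
  moreover have "(M + 1) ^ Suc r = (M + 1) ^ r * M + (M + 1) ^ r" by simp
  ultimately show ?case using Suc by (simp only: sum.atMost_Suc)
qed simp

lemma card_small_subsets_le:
  assumes "finite M"
  shows "card {A. A \<subseteq> M \<and> card A \<le> r} \<le> (card M + 1) ^ r"
proof -
  have "{A. A \<subseteq> M \<and> card A \<le> r} \<subseteq> set ` {xs. set xs \<subseteq> M \<and> length xs \<le> r}"
  proof
    fix A assume A: "A \<in> {A. A \<subseteq> M \<and> card A \<le> r}"
    then obtain xs where "set xs = A" "distinct xs"
      using assms finite_distinct_list finite_subset by (metis mem_Collect_eq)
    then show "A \<in> set ` {xs. set xs \<subseteq> M \<and> length xs \<le> r}"
      using A distinct_card[of xs] by (intro image_eqI[of _ _ xs]) auto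
  qed
  then have "card {A. A \<subseteq> M \<and> card A \<le> r} \<le> card {xs. set xs \<subseteq> M \<and> length xs \<le> r}"
    using assms by (intro surj_card_le) (auto intro: finite_lists_length_le)
  also have "\<dots> \<le> (card M + 1) ^ r"
    unfolding card_lists_length_le[OF assms] by (rule sum_powers_le_power_Suc)
  finally show ?thesis .
qed

text \<open>A bound for the number of subsets of \<open>{1..k} \<times> {1..k}\<close> with at most
  as many elements as a cycle type can have. The exponent of order \<open>sqrt k\<close> makes it
  subexponential.\<close>

definition class_bound :: "nat \<Rightarrow> nat" where
  "class_bound k = (k\<^sup>2 + 1) ^ (nat \<lfloor>sqrt (2 * real k)\<rfloor> + 1)"

lemma card_cycle_types_le: "card (cycle_type k ` {p. p permutes {1..k}}) \<le> class_bound k"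
proof -
  let ?r = "nat \<lfloor>sqrt (2 * real k)\<rfloor> + 1"
  have "card (cycle_type k ` {p. p permutes {1..k}}) \<le>
      card {A. A \<subseteq> {1..k} \<times> {1..k} \<and> card A \<le> ?r}"
    using card_cycle_type[of _ k] by (intro card_mono) (auto intro: finite_subset[of _ "Pow ({1..k} \<times> {1..k})"])
  also have "\<dots> \<le> (card ({1..k} \<times> {1..k}) + 1) ^ ?r" by (rule card_small_subsets_le) simp
  finally show ?thesis by (simp add: class_bound_def power2_eq_square)
qed

section \<open>Irreducible representations with vectors fixed by many permutations\<close>

definition has_fixed :: "('a \<Rightarrow> 'a) mat_rep \<Rightarrow> 'a set \<Rightarrow> bool" where
  "has_fixed r A \<longleftrightarrow> (\<exists>v\<in>fvec (fst r). v \<noteq> 0 \<and> (\<forall>p. p permutes A \<longrightarrow> act r p v = v))"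

definition rchar :: "'g mat_rep \<Rightarrow> 'g \<Rightarrow> complex" where
  "rchar r g = (\<Sum>i<fst r. snd r g $$ (i, i))"

lemma delta_nonzero: "delta i \<noteq> 0"
proof
  assume "delta i = 0"
  then have "delta i i = 0" by simp
  then show False by (simp add: delta_def)
qed

section \<open>Fixed vectors and characters under permutations\<close>

lemma act_comp:
  assumes "is_rep (sym_group n) r" "p permutes {1..n}" "q permutes {1..n}"
  shows "act r (p \<circ> q) v = act r p (act r q v)"
  using act_mult[OF assms(1), of p q v] assms(2,3) by (simp add: sym_group_carrier sym_group_mult)

lemma act_id: "is_rep (sym_group n) r \<Longrightarrow> v \<in> fvec (fst r) \<Longrightarrow> act r id v = v"
  using act_one[of "sym_group n" r v] by (simp add: sym_group_is_group sym_group_one)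

lemma act_inv:
  assumes "is_rep (sym_group n) r" "p permutes {1..n}" "v \<in> fvec (fst r)"
  shows "act r (inv' p) (act r p v) = v" "act r p (act r (inv' p) v) = v"
  using assms
  by (simp_all add: act_comp[symmetric, OF assms(1)] permutes_inv permutes_inv_o act_id)

lemma act_eq_0_iff:
  assumes "is_rep (sym_group n) r" "p permutes {1..n}" "v \<in> fvec (fst r)"
  shows "act r p v = 0 \<longleftrightarrow> v = 0"
  using act_inv(1)[OF assms] by (metis act_simps(3))

lemma rchar_comp:
  assumes "is_rep (sym_group n) r" "p permutes {1..n}" "q permutes {1..n}"
  shows "rchar r (p \<circ> q) = (\<Sum>i<fst r. \<Sum>j<fst r. snd r p $$ (i, j) * snd r q $$ (j, i))"
  using rep_entry_mult[OF assms(1), of p q] assms(2,3)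
  by (simp add: rchar_def sym_group_carrier sym_group_mult)

lemma rchar_comp_commute:
  assumes "is_rep (sym_group n) r" "p permutes {1..n}" "q permutes {1..n}"
  shows "rchar r (p \<circ> q) = rchar r (q \<circ> p)"
  unfolding rchar_comp[OF assms] rchar_comp[OF assms(1,3,2)]
  by (subst sum.swap) (simp add: mult.commute)

text \<open>If \<open>v\<close> is fixed by the permutations of \<open>A\<close>, then
  \<open>act r g v\<close> is fixed by their conjugates under \<open>g\<close>, which are the
  permutations of the image of \<open>A\<close>.\<close>

lemma has_fixed_image:
  assumes r: "is_rep (sym_group n) r" and g: "g permutes {1..n}" and A: "A \<subseteq> {1..n}"
    and fixed: "has_fixed r A"
  shows "has_fixed r (g ` A)"
proof -
  obtain v where v: "v \<in> fvec (fst r)" "v \<noteq> 0" "\<And>p. p permutes A \<Longrightarrow> act r p v = v"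
    using fixed by (auto simp: has_fixed_def)
  have "act r p (act r g v) = act r g v" if p: "p permutes g ` A" for p
  proof -
    define q where "q = inv' g \<circ> p \<circ> g"
    have "g ` A \<subseteq> {1..n}" using A g permutes_image by blast
    then have pn: "p permutes {1..n}" using p permutes_subset by blast
    then have qn: "q permutes {1..n}"
      unfolding q_def by (intro permutes_compose g permutes_inv)
    have "q permutes A"
    proof (rule permutes_superset[OF qn])
      fix x assume "x \<in> {1..n} - A"
      then have "g x \<notin> g ` A" using permutes_inj[OF g] by (auto simp: inj_def)
      then have "p (g x) = g x" using p by (rule permutes_not_in[rotated])
      then show "q x = x" using permutes_inverses[OF g] by (simp add: q_def)
    qed
    then have "act r g (act r q v) = act r g v" using v by simp
    moreover have "g \<circ> q = p \<circ> g" using permutes_inv_o[OF g] by (auto simp: q_def fun_eq_iff)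
    ultimately show ?thesis using act_comp[OF r g qn] act_comp[OF r pn g] by metis
  qed
  then show ?thesis
    unfolding has_fixed_def using v act_eq_0_iff[OF r g] by (intro bexI[of _ "act r g v"]) auto
qed

lemma has_fixed_card_eq:
  assumes "is_rep (sym_group n) r" "A \<subseteq> {1..n}" "B \<subseteq> {1..n}" "card A = card B" "has_fixed r A"
  shows "has_fixed r B"
proof -
  obtain f where f: "bij_betw f A B"
    using finite_same_card_bij[of A B] assms finite_subset by blast
  then obtain g where "g permutes {1..n}" "\<And>x. x \<in> A \<Longrightarrow> g x = f x"
    using extend_inj_on_to_permutes[of "{1..n}" f A] assms by (auto simp: bij_betw_def)
  moreover from this have "g ` A = B" using f by (auto simp: bij_betw_def)
  ultimately show ?thesis using has_fixed_image assms by metis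
qed

section \<open>Averages over the permutations of a subset\<close>

lemma sum_permutations_compose_left:
  assumes "q permutes S"
  shows "(\<Sum>p | p permutes S. f (q \<circ> p)) = (\<Sum>p | p permutes S. f p)"
  by (rule sum.reindex_bij_witness[of _ "\<lambda>p. inv' q \<circ> p" "\<lambda>p. q \<circ> p"])
    (auto simp: o_assoc permutes_inv_o[OF assms] intro: permutes_compose permutes_inv assms)

text \<open>Summing the action over the permutations of \<open>B\<close> sends every vector to a
  fixed one; if only zero is fixed, the summed matrix is zero.\<close>

lemma sum_entries_zero_of_not_has_fixed:
  assumes r: "is_rep (sym_group n) r" and B: "B \<subseteq> {1..n}" and nf: "\<not> has_fixed r B"
    and "i < fst r" "j < fst r"
  shows "(\<Sum>p | p permutes B. snd r p $$ (i, j)) = 0"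
proof -
  define v where "v = (\<Sum>p | p permutes B. act r p (delta j))"
  have perm: "p permutes {1..n}" if "p permutes B" for p using that B permutes_subset by blast
  have "act r q v = v" if q: "q permutes B" for q
  proof -
    have "act r q v = (\<Sum>p | p permutes B. act r (q \<circ> p) (delta j))"
      unfolding v_def act_simps
      by (rule sum.cong) (auto simp: act_comp[OF r perm[OF q] perm])
    also have "\<dots> = v" unfolding v_def by (rule sum_permutations_compose_left[OF q])
    finally show ?thesis .
  qed
  moreover have "v \<in> fvec (fst r)"
    unfolding v_def by (intro fun_subspace_sum[OF fun_subspace_fvec]) simp
  ultimately have "v = 0" using nf unfolding has_fixed_def by blast
  then have "(\<Sum>p | p permutes B. act r p (delta j) i) = 0"
    unfolding v_def using sum_fun_apply[of "\<lambda>p. act r p (delta j)" "{p. p permutes B}" i] by simp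
  then show ?thesis using assms by (simp add: act_def mat_fun_delta)
qed

text \<open>On a fixed vector the summed matrix acts as multiplication by
  \<open>fact (card A)\<close>, so it has a nonzero entry.\<close>

lemma sum_entries_nonzero_of_has_fixed:
  assumes A: "finite A" and fixed: "has_fixed r A"
  obtains i j where "i < fst r" "j < fst r" "(\<Sum>p | p permutes A. snd r p $$ (i, j)) \<noteq> 0"
proof -
  obtain v where v: "v \<in> fvec (fst r)" "v \<noteq> 0" "\<And>p. p permutes A \<Longrightarrow> act r p v = v"
    using fixed by (auto simp: has_fixed_def)
  obtain i where i: "v i \<noteq> 0" using v(2) by (auto simp: fun_eq_iff)
  then have id: "i < fst r" using v(1) unfolding fvec_def by (metis (mono_tags, lifting) mem_Collect_eq not_le)
  have "(\<Sum>p | p permutes A. act r p v i) = fact (card A) * v i"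
    using v(3) A by (simp add: card_permutations)
  moreover have "(\<Sum>p | p permutes A. act r p v i) =
      (\<Sum>j<fst r. (\<Sum>p | p permutes A. snd r p $$ (i, j)) * v j)"
    unfolding sum_distrib_right using id by (subst sum.swap) (simp add: act_def mat_fun_def)
  ultimately have "(\<Sum>j<fst r. (\<Sum>p | p permutes A. snd r p $$ (i, j)) * v j) \<noteq> 0" using i by simp
  then obtain j where "j < fst r" "(\<Sum>p | p permutes A. snd r p $$ (i, j)) * v j \<noteq> 0"
    by (metis (no_types, lifting) lessThan_iff sum.neutral)
  then show ?thesis using that id by auto
qed

lemma comp_transpose:
  assumes "inj g"
  shows "g \<circ> transpose a b = transpose (g a) (g b) \<circ> g"
  using assms by (auto simp: fun_eq_iff transpose_def inj_eq)

text \<open>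
  With \<open>F g\<close> the sum over \<open>a\<close>, the hypothesis \<open>zero\<close> reads \<open>F g + (\<Sum>x>k. F (g \<circ> transpose z x)) = 0\<close>
  for \<open>z \<le> k\<close>. If \<open>g z > k\<close>, every summand equals \<open>F g\<close> or is evaluated at a permutation
  moving fewer points of \<open>{1..k}\<close> out of \<open>{1..k}\<close>.
\<close>

lemma class_sum_zero_of_zero_on_complement:
  fixes X :: "(nat \<Rightarrow> nat) \<Rightarrow> complex"
  assumes kn: "k \<le> n"
    and X: "\<And>p q. p permutes {1..n} \<Longrightarrow> q permutes {1..n} \<Longrightarrow> X (p \<circ> q) = X (q \<circ> p)"
    and zero: "\<And>z g. z \<in> {1..k} \<Longrightarrow> g permutes {1..n} \<Longrightarrow>
      (\<Sum>b | b permutes insert z {k+1..n}. X (b \<circ> g)) = 0"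
    and base: "\<And>g. g permutes {1..k} \<Longrightarrow> (\<Sum>a | a permutes {k+1..n}. X (a \<circ> g)) = 0"
    and g: "g permutes {1..n}"
  shows "(\<Sum>a | a permutes {k+1..n}. X (a \<circ> g)) = 0"
proof -
  define A where "A = {k+1..n}"
  define F where "F = (\<lambda>g. \<Sum>a | a permutes A. X (a \<circ> g))"
  have A: "A \<subseteq> {1..n}" "finite A" and disj: "A \<inter> {1..k} = {}" and un: "A \<union> {1..k} = {1..n}"
    using kn by (auto simp: A_def)
  have perm: "a permutes {1..n}" if "a permutes A" for a using that A permutes_subset by blast
  have F_right: "F (g \<circ> a) = F g" if "a permutes A" "g permutes {1..n}" for a g
  proof -
    have "F (g \<circ> a) = (\<Sum>b | b permutes A. X ((a \<circ> b) \<circ> g))"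
      unfolding F_def
    proof (rule sum.cong[OF refl])
      fix b assume "b \<in> {b. b permutes A}"
      then show "X (b \<circ> (g \<circ> a)) = X ((a \<circ> b) \<circ> g)"
        using X[of "b \<circ> g" a] that perm by (simp add: o_assoc permutes_compose)
    qed
    also have "\<dots> = F g"
      unfolding F_def using sum_permutations_compose_left[OF that(1), of "\<lambda>b. X (b \<circ> g)"] by simp
    finally show ?thesis .
  qed
  have F_left: "F (a \<circ> g) = F g" if "a permutes A" "g permutes {1..n}" for a g
  proof -
    have "F (a \<circ> g) = (\<Sum>b | b permutes A. X ((b \<circ> a) \<circ> g))"
      unfolding F_def by (simp add: o_assoc)
    also have "\<dots> = F g"
      unfolding F_def using sum_permutations_compose_right[OF that(1), of "\<lambda>b. X (b \<circ> g)"] by simp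
    finally show ?thesis .
  qed
  have F_sum: "F g + (\<Sum>x\<in>A. F (g \<circ> transpose z x)) = 0" if z: "z \<in> {1..k}" and g: "g permutes {1..n}" for z g
  proof -
    have zA: "z \<notin> A" and zn: "z \<in> {1..n}" using z disj kn by auto
    have "0 = (\<Sum>b | b permutes insert z A. X (b \<circ> g))"
      using zero[OF z g] by (simp add: A_def)
    also have "\<dots> = (\<Sum>x\<in>insert z A. \<Sum>a | a permutes A. X ((transpose z x \<circ> a) \<circ> g))"
      by (rule sum_over_permutations_insert[OF A(2) zA])
    also have "\<dots> = (\<Sum>x\<in>insert z A. F (g \<circ> transpose z x))"
      unfolding F_def
    proof (intro sum.cong refl)
      fix x a assume "x \<in> insert z A" "a \<in> {a. a permutes A}"
      then show "X ((transpose z x \<circ> a) \<circ> g) = X (a \<circ> (g \<circ> transpose z x))"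
        using X[of "transpose z x" "a \<circ> g"] zn A(1) g perm
        by (auto simp: o_assoc permutes_compose permutes_swap_id)
    qed
    also have "\<dots> = F g + (\<Sum>x\<in>A. F (g \<circ> transpose z x))" using A(2) zA by simp
    finally show ?thesis by simp
  qed
  have "F g = 0"
    using g
  proof (induction "card {i \<in> {1..k}. g i \<in> A}" arbitrary: g rule: less_induct)
    case less
    note g = \<open>g permutes {1..n}\<close>
    have inj: "inj g" using permutes_inj[OF g] .
    have g_in: "g x \<in> {1..n}" if "x \<in> {1..n}" for x using permutes_in_image[OF g] that by metis
    show ?case
    proof (cases "\<exists>z\<in>{1..k}. g z \<in> A")
      case False
      \<comment> \<open>No point of \<open>{1..k}\<close> is moved out, so \<open>g\<close> is a
        permutation \<open>s\<close> of \<open>{1..k}\<close> composed with one of \<open>A\<close>,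
        and right invariance reduces the claim to \<open>base\<close>.\<close>
      define s where "s = (\<lambda>x. if x \<in> {1..k} then g x else x)"
      have "g ` {1..k} \<subseteq> {1..k}" using False g_in kn un by fastforce
      then have "g ` {1..k} = {1..k}"
        using inj by (intro endo_inj_surj) (auto intro: inj_on_subset)
      then have "bij_betw s {1..k} {1..k}"
        using inj by (subst bij_betw_cong[of _ _ g]) (auto simp: s_def bij_betw_def intro: inj_on_subset)
      then have s: "s permutes {1..k}" by (rule bij_imp_permutes) (auto simp: s_def)
      then have sn: "s permutes {1..n}" using kn by (intro permutes_subset[OF s]) auto
      define a where "a = inv' s \<circ> g"
      have an: "a permutes {1..n}" unfolding a_def by (intro permutes_compose g permutes_inv sn)
      have "a permutes A"
      proof (rule permutes_superset[OF an])
        fix x assume "x \<in> {1..n} - A"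
        then have "x \<in> {1..k}" using un by auto
        then have "g x = s x" by (simp add: s_def)
        then show "a x = x" using permutes_inverses[OF s] by (simp add: a_def)
      qed
      moreover have "g = s \<circ> a" using permutes_inv_o(1)[OF s] by (simp add: a_def o_assoc)
      ultimately show ?thesis using F_right[OF _ sn] base[OF s] by (simp add: F_def A_def)
    next
      case True
      then obtain z where z: "z \<in> {1..k}" "g z \<in> A" by blast
      define R where "R = {x \<in> A. g x \<in> A}"
      \<comment> \<open>The swap can be pulled to the left of \<open>g\<close>, where it exchanges
        \<open>g z\<close> and \<open>g x\<close>, both in \<open>A\<close>; left invariance removes
        it.\<close>
      have same: "F (g \<circ> transpose z x) = F g" if "x \<in> R" for x
        using F_left[OF _ g, of "transpose (g z) (g x)"] that z
        by (simp add: comp_transpose[OF inj] permutes_swap_id R_def)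
      \<comment> \<open>After the swap \<open>z\<close> goes to \<open>g x\<close>, outside
        \<open>A\<close>, and no other point of \<open>{1..k}\<close> is affected, so the measure
        drops.\<close>
      have vanish: "F (g \<circ> transpose z x) = 0" if x: "x \<in> A - R" for x
      proof (rule less.hyps)
        have xz: "x \<noteq> z" "x \<in> {1..n}" "z \<in> {1..n}" using x z disj A kn by auto
        show "g \<circ> transpose z x permutes {1..n}"
          using xz by (intro permutes_compose permutes_swap_id g) auto
        have "{i \<in> {1..k}. (g \<circ> transpose z x) i \<in> A} \<subseteq> {i \<in> {1..k}. g i \<in> A} - {z}"
          using x z disj by (auto simp: transpose_def R_def)
        then have "{i \<in> {1..k}. (g \<circ> transpose z x) i \<in> A} \<subset> {i \<in> {1..k}. g i \<in> A}"
          using z by blast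
        then show "card {i \<in> {1..k}. (g \<circ> transpose z x) i \<in> A} < card {i \<in> {1..k}. g i \<in> A}"
          by (intro psubset_card_mono) auto
      qed
      have "(\<Sum>x\<in>A. F (g \<circ> transpose z x)) =
          (\<Sum>x\<in>R. F (g \<circ> transpose z x)) + (\<Sum>x\<in>A - R. F (g \<circ> transpose z x))"
        using A(2) by (subst sum.subset_diff[of R A]) (auto simp: R_def)
      also have "\<dots> = of_nat (card R) * F g" using same vanish by simp
      \<comment> \<open>The terms equal to \<open>F g\<close> add up with the same sign, so they
        cannot cancel in characteristic zero.\<close>
      finally have "(1 + of_nat (card R)) * F g = 0" using F_sum[OF z(1) g] by (simp add: algebra_simps)
      moreover have "(1 + of_nat (card R) :: complex) \<noteq> 0"
        using of_nat_neq_0[of "card R", where 'a = complex] by (simp add: add.commute)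
      ultimately show ?thesis by simp
    qed
  qed
  then show ?thesis by (simp add: F_def A_def)
qed

text \<open>With more representations than cycle types, a nontrivial combination of the averaged
  characters \<open>F i\<close> vanishes on one permutation per cycle type, hence on all
  permutations of \<open>{1..k}\<close>. By \<open>not_fixed\<close> the averages over the larger
  sets vanish too, so the combination is zero everywhere. This contradicts the independence of
  matrix coefficients, since by \<open>fixed\<close> the averaging matrices are nonzero.\<close>

lemma card_exact_depth_le:
  assumes "finite I" and irr: "\<And>i. i \<in> I \<Longrightarrow> irreducible_rep (sym_group n) (r i)"
    and niso: "\<And>i j. i \<in> I \<Longrightarrow> j \<in> I \<Longrightarrow> i \<noteq> j \<Longrightarrow> \<not> iso_rep (sym_group n) (r i) (r j)"
    and kn: "k \<le> n"
    and fixed: "\<And>i. i \<in> I \<Longrightarrow> has_fixed (r i) {k+1..n}"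
    and not_fixed: "\<And>i z. i \<in> I \<Longrightarrow> z \<in> {1..k} \<Longrightarrow> \<not> has_fixed (r i) (insert z {k+1..n})"
  shows "card I \<le> class_bound k"
proof -
  define A where "A = {k+1..n}"
  define C where "C = cycle_type k ` {p. p permutes {1..k}}"
  define F where "F = (\<lambda>i g. \<Sum>a | a permutes A. rchar (r i) (a \<circ> g))"
  have A: "A \<subseteq> {1..n}" "finite A" using kn by (auto simp: A_def)
  have rep: "is_rep (sym_group n) (r i)" if "i \<in> I" for i
    using irr[OF that] by (rule irreducible_imp_rep)
  have perm: "a permutes {1..n}" if "a permutes A" for a using that A permutes_subset by blast
  have permk: "a permutes {1..n}" if "a permutes {1..k}" for a
    using that kn by (intro permutes_subset[OF that]) auto
  have F_expand: "F i g = (\<Sum>x<fst (r i). \<Sum>y<fst (r i).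
      (\<Sum>a | a permutes A. snd (r i) a $$ (y, x)) * snd (r i) g $$ (x, y))"
    if "i \<in> I" "g permutes {1..n}" for i g
  proof -
    have "F i g = (\<Sum>a | a permutes A. \<Sum>y<fst (r i). \<Sum>x<fst (r i). snd (r i) a $$ (y, x) * snd (r i) g $$ (x, y))"
      unfolding F_def using rchar_comp[OF rep[OF that(1)] perm that(2)] by simp
    also have "\<dots> = (\<Sum>y<fst (r i). \<Sum>x<fst (r i). \<Sum>a | a permutes A. snd (r i) a $$ (y, x) * snd (r i) g $$ (x, y))"
      by (subst sum.swap) (rule sum.cong[OF refl], rule sum.swap)
    finally show ?thesis by (subst sum.swap) (simp add: sum_distrib_right)
  qed
  \<comment> \<open>Permutations of \<open>{1..k}\<close> commute with those of \<open>A\<close>, so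
    conjugation passes through the average and disappears in the trace.\<close>
  have F_conj: "F i (h \<circ> s \<circ> inv' h) = F i s" if i: "i \<in> I" and h: "h permutes {1..k}" and s: "s permutes {1..k}" for i h s
    unfolding F_def
  proof (rule sum.cong[OF refl])
    fix a assume "a \<in> {a. a permutes A}"
    then have a: "a permutes A" by simp
    have "a \<circ> h = h \<circ> a"
    proof
      fix x
      consider "x \<in> A" "a x \<in> A" | "x \<notin> A" "h x \<notin> A"
        using permutes_in_image[OF a] permutes_in_image[OF h, of x] permutes_not_in[OF h, of x]
        by (cases "x \<in> {1..k}") (force simp: A_def)+
      then show "(a \<circ> h) x = (h \<circ> a) x"
        by cases (use permutes_not_in[OF a] permutes_not_in[OF h] in \<open>auto simp: A_def\<close>)
    qed
    then have "a \<circ> (h \<circ> s \<circ> inv' h) = h \<circ> (a \<circ> s \<circ> inv' h)" by (metis comp_assoc)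
    then have "rchar (r i) (a \<circ> (h \<circ> s \<circ> inv' h)) = rchar (r i) (a \<circ> s \<circ> inv' h \<circ> h)"
      using rchar_comp_commute[OF rep[OF i] permk[OF h]
          permutes_compose[OF permutes_inv[OF permk[OF h]] permutes_compose[OF permk[OF s] perm[OF a]]]]
      by (simp add: comp_assoc)
    also have "a \<circ> s \<circ> inv' h \<circ> h = a \<circ> s" using permutes_inv_o(2)[OF h] by (simp add: comp_assoc)
    finally show "rchar (r i) (a \<circ> (h \<circ> s \<circ> inv' h)) = rchar (r i) (a \<circ> s)" .
  qed
  have "card I \<le> card C"
  proof (rule ccontr)
    assume "\<not> card I \<le> card C"
    define s where "s = (\<lambda>c. SOME p. p permutes {1..k} \<and> cycle_type k p = c)"
    have s: "s c permutes {1..k} \<and> cycle_type k (s c) = c" if "c \<in> C" for c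
    proof -
      have "\<exists>p. p permutes {1..k} \<and> cycle_type k p = c" using that unfolding C_def by blast
      then show ?thesis unfolding s_def by (rule someI_ex)
    qed
    have "finite C" by (simp add: C_def finite_permutations)
    then obtain \<alpha> where nz: "\<exists>i\<in>I. \<alpha> i \<noteq> 0" and \<alpha>: "\<forall>c\<in>C. (\<Sum>i\<in>I. \<alpha> i * F i (s c)) = 0"
      using homogeneous_system_nontrivial_solution[of C I "\<lambda>i c. F i (s c)"]
        \<open>\<not> card I \<le> card C\<close> assms(1) unfolding not_le by blast
    define X where "X = (\<lambda>g. \<Sum>i\<in>I. \<alpha> i * rchar (r i) g)"
    have FX: "(\<Sum>a | a permutes B. X (a \<circ> g)) =
        (\<Sum>i\<in>I. \<alpha> i * (\<Sum>a | a permutes B. rchar (r i) (a \<circ> g)))" for B g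
      unfolding X_def sum_distrib_left by (rule sum.swap)
    have "(\<Sum>i\<in>I. \<alpha> i * F i g) = 0" if g: "g permutes {1..n}" for g
      unfolding F_def FX[symmetric] A_def
    proof (rule class_sum_zero_of_zero_on_complement[OF kn _ _ _ g])
      show "X (p \<circ> q) = X (q \<circ> p)" if "p permutes {1..n}" "q permutes {1..n}" for p q
        unfolding X_def by (intro sum.cong refl) (simp add: rchar_comp_commute[OF rep that])
    next
      fix z g assume z: "z \<in> {1..k}" and g: "g permutes {1..n}"
      have B: "insert z {k+1..n} \<subseteq> {1..n}" using z kn by auto
      have "(\<Sum>a | a permutes insert z {k+1..n}. rchar (r i) (a \<circ> g)) = 0" if i: "i \<in> I" for i
      proof -
        have "(\<Sum>a | a permutes insert z {k+1..n}. rchar (r i) (a \<circ> g)) =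
            (\<Sum>a | a permutes insert z {k+1..n}. \<Sum>x<fst (r i). \<Sum>y<fst (r i). snd (r i) a $$ (x, y) * snd (r i) g $$ (y, x))"
          using rchar_comp[OF rep[OF i] permutes_subset[OF _ B] g] by simp
        also have "\<dots> = (\<Sum>x<fst (r i). \<Sum>y<fst (r i). \<Sum>a | a permutes insert z {k+1..n}. snd (r i) a $$ (x, y) * snd (r i) g $$ (y, x))"
          by (subst sum.swap) (rule sum.cong[OF refl], rule sum.swap)
        also have "\<dots> = 0"
          using sum_entries_zero_of_not_has_fixed[OF rep[OF i] B not_fixed[OF i z]]
          by (simp flip: sum_distrib_right)
        finally show ?thesis .
      qed
      then show "(\<Sum>b | b permutes insert z {k+1..n}. X (b \<circ> g)) = 0" unfolding FX by simp
    next
      fix p assume p: "p permutes {1..k}"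
      define c where "c = cycle_type k p"
      have c: "c \<in> C" using p by (auto simp: c_def C_def)
      then obtain h where h: "h permutes {1..k}" "p = h \<circ> s c \<circ> inv' h"
        using conjugate_of_cycle_type_eq[of "s c" k p] p s c_def by metis
      have "(\<Sum>i\<in>I. \<alpha> i * F i p) = (\<Sum>i\<in>I. \<alpha> i * F i (s c))"
        unfolding h(2) using F_conj h(1) s[OF c] by (intro sum.cong refl) simp
      then show "(\<Sum>a | a permutes {k+1..n}. X (a \<circ> p)) = 0"
        using \<alpha> c unfolding FX F_def A_def by simp
    qed
    then have F_zero: "(\<Sum>i\<in>I. \<alpha> i * F i g) = 0" if "g permutes {1..n}" for g using that by blast
    have zero: "(\<Sum>i\<in>I. \<alpha> i * (\<Sum>x<fst (r i). \<Sum>y<fst (r i).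
        (\<Sum>a | a permutes A. snd (r i) a $$ (y, x)) * snd (r i) g $$ (x, y))) = 0"
      if "g \<in> carrier (sym_group n)" for g
    proof -
      have g: "g permutes {1..n}" using that by (simp add: sym_group_carrier)
      have "(\<Sum>i\<in>I. \<alpha> i * F i g) = (\<Sum>i\<in>I. \<alpha> i * (\<Sum>x<fst (r i). \<Sum>y<fst (r i).
          (\<Sum>a | a permutes A. snd (r i) a $$ (y, x)) * snd (r i) g $$ (x, y)))"
        by (rule sum.cong[OF refl]) (simp only: F_expand[OF _ g])
      then show ?thesis using F_zero[OF g] by simp
    qed
    obtain w where w: "w \<in> I" "\<alpha> w \<noteq> 0" using nz by blast
    obtain x y where xy: "x < fst (r w)" "y < fst (r w)" "(\<Sum>a | a permutes A. snd (r w) a $$ (x, y)) \<noteq> 0"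
      using sum_entries_nonzero_of_has_fixed[OF A(2), of "r w"] fixed[OF w(1)] unfolding A_def by metis
    have "finite (carrier (sym_group n))" by (simp add: sym_group_def finite_permutations)
    \<comment> \<open>The matrix \<open>B i\<close> is the sum of the matrices of \<open>r i\<close>
      over the permutations of \<open>A\<close>.\<close>
    then have "\<alpha> w * (\<Sum>a | a permutes A. snd (r w) a $$ (x, y)) = 0"
      using matrix_coefficients_independent[where B = "\<lambda>i y x. \<Sum>a | a permutes A. snd (r i) a $$ (y, x)",
          OF sym_group_is_group _ assms(1) irr niso zero w(1) xy(1,2)] by simp
    then show False using w xy by simp
  qed
  also have "\<dots> \<le> class_bound k" unfolding C_def by (rule card_cycle_types_le)
  finally show ?thesis .
qed

section \<open>Counting representations by depth\<close>

lemma class_bound_mono: "k \<le> l \<Longrightarrow> class_bound k \<le> class_bound l"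
proof -
  assume kl: "k \<le> l"
  have "sqrt (2 * real k) \<le> sqrt (2 * real l)" using kl by simp
  then have "nat \<lfloor>sqrt (2 * real k)\<rfloor> \<le> nat \<lfloor>sqrt (2 * real l)\<rfloor>" by (intro nat_mono floor_mono)
  then have "class_bound k \<le> (k\<^sup>2 + 1) ^ (nat \<lfloor>sqrt (2 * real l)\<rfloor> + 1)"
    unfolding class_bound_def by (intro power_increasing) auto
  also have "\<dots> \<le> class_bound l"
    unfolding class_bound_def using kl by (intro power_mono) (auto intro: power_mono)
  finally show ?thesis .
qed

text \<open>The depth is the least number of points to leave out so that the permutations of the
  others fix a nonzero vector. Each of the \<open>K + 1\<close> possible depths is counted by
  \<open>card_exact_depth_le\<close>.\<close>

lemma card_depth_le:
  assumes "finite I" and irr: "\<And>i. i \<in> I \<Longrightarrow> irreducible_rep (sym_group n) (r i)"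
    and niso: "\<And>i j. i \<in> I \<Longrightarrow> j \<in> I \<Longrightarrow> i \<noteq> j \<Longrightarrow> \<not> iso_rep (sym_group n) (r i) (r j)"
    and K: "K \<le> n"
    and fixed: "\<And>i. i \<in> I \<Longrightarrow> \<exists>A\<subseteq>{1..n}. card A = n - K \<and> has_fixed (r i) A"
  shows "card I \<le> (K + 1) * class_bound K"
proof -
  define P where "P = (\<lambda>i k. \<exists>A\<subseteq>{1..n}. card A = n - k \<and> has_fixed (r i) A)"
  define depth where "depth = (\<lambda>i. LEAST k. P i k)"
  have rep: "is_rep (sym_group n) (r i)" if "i \<in> I" for i
    using irr[OF that] by (rule irreducible_imp_rep)
  have depth: "P i (depth i)" "depth i \<le> K" if "i \<in> I" for i
    using fixed[OF that] LeastI[of "P i" K] Least_le[of "P i" K] by (auto simp: P_def depth_def)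
  have "card {i \<in> I. depth i = k} \<le> class_bound k" if "k \<le> K" for k
  proof (rule card_exact_depth_le[where n = n and r = r])
    fix i assume "i \<in> {i \<in> I. depth i = k}"
    then have i: "i \<in> I" "depth i = k" by auto
    show "has_fixed (r i) {k+1..n}"
      using depth(1)[OF i(1)] has_fixed_card_eq[OF rep[OF i(1)], of _ "{k+1..n}"] i(2)
      by (auto simp: P_def)
    fix z assume z: "z \<in> {1..k}"
    show "\<not> has_fixed (r i) (insert z {k+1..n})"
    proof
      assume "has_fixed (r i) (insert z {k+1..n})"
      \<comment> \<open>Here \<open>k\<close> is positive because \<open>z\<close> exists, so one
        point fewer is left out and minimality of the depth is violated.\<close>
      moreover have "card (insert z {k+1..n}) = n - (k - 1)" using z that K by auto
      moreover have "insert z {k+1..n} \<subseteq> {1..n}" using z that K by auto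
      ultimately have "P i (k - 1)" unfolding P_def by blast
      then have "depth i \<le> k - 1" unfolding depth_def by (rule Least_le)
      then show False using i z by auto
    qed
  qed (use assms that in auto)
  then have "(\<Sum>k\<le>K. card {i \<in> I. depth i = k}) \<le> (\<Sum>k\<le>K. class_bound K)"
    using class_bound_mono[of _ K] by (intro sum_mono) (meson atMost_iff order_trans)
  moreover have "I = (\<Union>k\<le>K. {i \<in> I. depth i = k})" using depth(2) by auto
  then have "card I \<le> (\<Sum>k\<le>K. card {i \<in> I. depth i = k})"
    using card_UN_le[of "{..K}" "\<lambda>k. {i \<in> I. depth i = k}"] by simp
  ultimately show ?thesis by simp
qed

text \<open>The empty set has only the identity permutation, which fixes everything, so
  \<open>K = n\<close> always applies. This crude count is what bounds all irreducible
  representations together.\<close>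

lemma card_pairwise_not_iso_le:
  assumes "finite I" and irr: "\<And>i. i \<in> I \<Longrightarrow> irreducible_rep (sym_group n) (r i)"
    and niso: "\<And>i j. i \<in> I \<Longrightarrow> j \<in> I \<Longrightarrow> i \<noteq> j \<Longrightarrow> \<not> iso_rep (sym_group n) (r i) (r j)"
  shows "card I \<le> (n + 1) * class_bound n"
proof (rule card_depth_le[OF assms order.refl])
  fix i assume i: "i \<in> I"
  have "fst (r i) \<noteq> 0" using irr[OF i] by (cases "r i") (simp add: irreducible_rep_def)
  then have "delta 0 \<in> fvec (fst (r i))" by (simp add: delta_in_fvec)
  then have "has_fixed (r i) {}"
    using act_id[OF irreducible_imp_rep[OF irr[OF i]]] delta_nonzero[of 0]
    unfolding has_fixed_def by auto
  then show "\<exists>A\<subseteq>{1..n}. card A = n - n \<and> has_fixed (r i) A" by (intro exI[of _ "{}"]) auto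
qed auto

section \<open>Weights for disjoint transpositions\<close>

definition weight_sign :: "nat set \<Rightarrow> nat \<Rightarrow> complex" where
  "weight_sign S i = (if i \<in> S then -1 else 1)"

text \<open>The product over \<open>i < m\<close> of the projections
  \<open>(1 + weight_sign S i * t i) / 2\<close>, that is, the projection onto the simultaneous
  eigenspace with signs given by \<open>S\<close>.\<close>

primrec weight_proj :: "(nat \<Rightarrow> (nat \<Rightarrow> complex) \<Rightarrow> nat \<Rightarrow> complex) \<Rightarrow> nat \<Rightarrow> nat set \<Rightarrow>
    (nat \<Rightarrow> complex) \<Rightarrow> nat \<Rightarrow> complex" where
  "weight_proj t 0 S v = v"
| "weight_proj t (Suc m) S v =
    cscale (1 / 2) (weight_proj t m S v + cscale (weight_sign S m) (t m (weight_proj t m S v)))"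

lemma weight_sign_simps [simp]:
  "weight_sign S i * weight_sign S i = 1"
  "weight_sign S i \<noteq> 0"
  by (auto simp: weight_sign_def)

lemma weight_sign_opposite: "(i \<in> S) \<noteq> (i \<in> T) \<Longrightarrow> weight_sign S i * weight_sign T i = -1"
  by (auto simp: weight_sign_def)

lemma weight_proj_cong:
  "(\<And>i. i < m \<Longrightarrow> i \<in> S \<longleftrightarrow> i \<in> T) \<Longrightarrow> weight_proj t m S v = weight_proj t m T v"
  by (induction m) (auto simp: weight_sign_def)

lemma cscale_half: "cscale (1 / 2) (v + v) = v"
  by (auto simp: cscale_def fun_eq_iff)

text \<open>Involutivity is asked on \<open>V\<close> only: in the application \<open>act\<close>
  truncates vectors at the degree and is not an involution on all functions.\<close>

locale commuting_involutions =
  fixes t :: "nat \<Rightarrow> (nat \<Rightarrow> complex) \<Rightarrow> nat \<Rightarrow> complex" and m :: nat and V :: "(nat \<Rightarrow> complex) set"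
  assumes lin: "fun_linear (t i)"
    and commute: "i < m \<Longrightarrow> j < m \<Longrightarrow> t i (t j v) = t j (t i v)"
    and involution: "i < m \<Longrightarrow> v \<in> V \<Longrightarrow> t i (t i v) = v"
    and closed: "v \<in> V \<Longrightarrow> t i v \<in> V"
    and subspace: "fun_subspace V"
begin

lemma linear_weight_proj: "fun_linear (weight_proj t k S)"
proof (induction k)
  case (Suc k)
  then show ?case
    unfolding fun_linear_def weight_proj.simps
    by (simp add: fun_linear_add[OF lin] fun_linear_scale[OF lin] cscale_add add_ac mult_ac
        del: One_nat_def)
qed (simp add: fun_linear_def)

lemma weight_proj_in: "v \<in> V \<Longrightarrow> weight_proj t k S v \<in> V"
  by (induction k)
    (auto intro!: fun_subspace_add[OF subspace] fun_subspace_scale[OF subspace] closed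
      simp del: plus_fun_def)

lemma weight_proj_commute:
  "j < m \<Longrightarrow> k \<le> m \<Longrightarrow> t j (weight_proj t k S v) = weight_proj t k S (t j v)"
proof (induction k)
  case (Suc k)
  then have "t j (weight_proj t k S v) = weight_proj t k S (t j v)" by simp
  then show ?case
    using Suc.prems commute[of j k]
    by (simp only: weight_proj.simps fun_linear_add[OF lin] fun_linear_scale[OF lin])
qed simp

lemma weight_proj_eigen:
  "v \<in> V \<Longrightarrow> k \<le> m \<Longrightarrow> i < k \<Longrightarrow>
    t i (weight_proj t k S v) = cscale (weight_sign S i) (weight_proj t k S v)"
proof (induction k)
  case (Suc k)
  let ?w = "weight_proj t k S v"
  have k: "k < m" using Suc.prems by simp
  have w: "?w \<in> V" using Suc.prems by (intro weight_proj_in)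
  show ?case
  proof (cases "i = k")
    case True
    have "weight_sign S k * (1 / 2 * weight_sign S k) = 1 / 2" by (simp add: weight_sign_def)
    with True show ?thesis
      using involution[OF k w]
      by (simp only: weight_proj.simps fun_linear_add[OF lin] fun_linear_scale[OF lin] cscale_add
          cscale_simps mult.assoc mult.commute[of "weight_sign S k" "1/2"] weight_sign_simps mult_1_right add.commute)
  next
    case False
    then have "i < k" "i < m" using Suc.prems by auto
    then have "t i ?w = cscale (weight_sign S i) ?w" using Suc by simp
    then show ?thesis
      using commute[OF \<open>i < m\<close> k, of ?w]
      by (simp only: weight_proj.simps fun_linear_add[OF lin] fun_linear_scale[OF lin] cscale_add
          cscale_simps mult_ac)
  qed
qed simp

text \<open>For each index the two possible factors \<open>(1 + t k) / 2\<close> and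
  \<open>(1 - t k) / 2\<close> add up to the identity; the subsets are split by whether they contain
  \<open>k\<close>.\<close>

lemma sum_weight_proj: "k \<le> m \<Longrightarrow> (\<Sum>S\<in>Pow {..<k}. weight_proj t k S v) = v"
proof (induction k)
  case (Suc k)
  let ?w = "\<lambda>S. weight_proj t k S v"
  have "(\<Sum>S\<in>Pow {..<Suc k}. weight_proj t (Suc k) S v) =
      (\<Sum>S\<in>Pow {..<k}. weight_proj t (Suc k) S v) +
      (\<Sum>S\<in>insert k ` Pow {..<k}. weight_proj t (Suc k) S v)"
    unfolding lessThan_Suc Pow_insert by (rule sum.union_disjoint) auto
  also have "(\<Sum>S\<in>insert k ` Pow {..<k}. weight_proj t (Suc k) S v) =
      (\<Sum>S\<in>Pow {..<k}. weight_proj t (Suc k) (insert k S) v)"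
    by (rule sum.reindex[unfolded o_def]) (auto simp: inj_on_def)
  also have "(\<Sum>S\<in>Pow {..<k}. weight_proj t (Suc k) S v) + \<dots> = (\<Sum>S\<in>Pow {..<k}. ?w S)"
    unfolding sum.distrib[symmetric]
  proof (rule sum.cong[OF refl])
    fix S assume "S \<in> Pow {..<k}"
    then have "weight_sign S k = 1" "weight_sign (insert k S) k = -1" by (auto simp: weight_sign_def)
    moreover have "weight_proj t k (insert k S) v = ?w S" by (rule weight_proj_cong) auto
    ultimately have "weight_proj t (Suc k) S v + weight_proj t (Suc k) (insert k S) v =
        cscale (1 / 2) (?w S + t k (?w S)) + cscale (1 / 2) (?w S - t k (?w S))"
      by (simp only: weight_proj.simps cscale_simps diff_conv_add_uminus)
    also have "\<dots> = ?w S" by (auto simp: fun_eq_iff cscale_def field_simps)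
    finally show "weight_proj t (Suc k) S v + weight_proj t (Suc k) (insert k S) v = ?w S" .
  qed
  finally show ?case using Suc by simp
qed simp

lemma weight_proj_eq_self:
  "v \<in> V \<Longrightarrow> k \<le> m \<Longrightarrow> (\<And>i. i < k \<Longrightarrow> t i v = cscale (weight_sign S i) v) \<Longrightarrow> weight_proj t k S v = v"
proof (induction k)
  case (Suc k)
  then have "weight_proj t k S v = v" "t k v = cscale (weight_sign S k) v" by simp_all
  then show ?case by (simp only: weight_proj.simps cscale_simps weight_sign_simps cscale_half)
qed simp

text \<open>The factor with index \<open>i\<close> annihilates a vector whose \<open>i\<close>-th
  sign is the opposite one; the other signs of the vector may be arbitrary.\<close>

lemma weight_proj_eq_0:
  "v \<in> V \<Longrightarrow> k \<le> m \<Longrightarrow> i < k \<Longrightarrow> t i v = cscale (weight_sign T i) v \<Longrightarrow> (i \<in> S) \<noteq> (i \<in> T) \<Longrightarrow>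
    weight_proj t k S v = 0"
proof (induction k)
  case (Suc k)
  show ?case
  proof (cases "i = k")
    case True
    then have "t k (weight_proj t k S v) = cscale (weight_sign T k) (weight_proj t k S v)"
      using weight_proj_commute[of k k S v] Suc.prems
      by (simp add: fun_linear_scale[OF linear_weight_proj])
    then show ?thesis
      using weight_sign_opposite[OF Suc.prems(5)] True by simp
  next
    case False
    then have w: "weight_proj t k S v = 0" using Suc by (simp add: func_zero)
    have "weight_proj t (Suc k) S v = 0"
      unfolding weight_proj.simps w fun_linear_0[OF lin] cscale_simps by simp
    then show ?thesis by (simp only: func_zero)
  qed
qed simp

end

section \<open>Weights of a representation of the symmetric group\<close>

definition pair_swap :: "nat \<Rightarrow> nat \<Rightarrow> nat" where
  "pair_swap i = transpose (2 * i + 1) (2 * i + 2)"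

definition has_weight :: "(nat \<Rightarrow> nat) mat_rep \<Rightarrow> nat \<Rightarrow> nat set \<Rightarrow> bool" where
  "has_weight r m S \<longleftrightarrow> (\<exists>v\<in>fvec (fst r). v \<noteq> 0 \<and>
    (\<forall>i<m. act r (pair_swap i) v = cscale (weight_sign S i) v))"

lemma pair_swap_permutes: "2 * i + 2 \<le> n \<Longrightarrow> pair_swap i permutes {1..n}"
  unfolding pair_swap_def by (intro permutes_swap_id) auto

lemma transpose_commute_disjoint:
  assumes "a \<noteq> c" "a \<noteq> d" "b \<noteq> c" "b \<noteq> d"
  shows "transpose a b \<circ> transpose c d = transpose c d \<circ> transpose a b"
  using assms by (auto simp: fun_eq_iff transpose_def)

locale sym_rep =
  fixes n m :: nat and r :: "(nat \<Rightarrow> nat) mat_rep"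
  assumes rep: "is_rep (sym_group n) r" and m: "2 * m \<le> n"
begin

lemma pair_swap_in: "i < m \<Longrightarrow> pair_swap i permutes {1..n}"
  using m by (intro pair_swap_permutes) auto

sublocale commuting_involutions "\<lambda>i. act r (pair_swap i)" m "fvec (fst r)"
proof
  fix i j v assume ij: "i < m" "j < m"
  have "pair_swap i \<circ> pair_swap j = pair_swap j \<circ> pair_swap i"
  proof (cases "i = j")
    case False
    then have "2 * i + 1 \<noteq> 2 * j + 2" "2 * i + 2 \<noteq> 2 * j + 1" by presburger+
    then show ?thesis
      unfolding pair_swap_def using False by (intro transpose_commute_disjoint) auto
  qed simp
  then show "act r (pair_swap i) (act r (pair_swap j) v) = act r (pair_swap j) (act r (pair_swap i) v)"
    using ij by (metis act_comp[OF rep] pair_swap_in)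
next
  fix i v assume "i < m" "v \<in> fvec (fst r)"
  moreover have "pair_swap i \<circ> pair_swap i = id" by (simp add: pair_swap_def)
  ultimately show "act r (pair_swap i) (act r (pair_swap i) v) = v"
    using act_comp[OF rep pair_swap_in pair_swap_in, of i i v] act_id[OF rep] by simp
qed (auto simp: act_linear fun_subspace_fvec)

abbreviation wproj :: "nat set \<Rightarrow> (nat \<Rightarrow> complex) \<Rightarrow> nat \<Rightarrow> complex" where
  "wproj \<equiv> weight_proj (\<lambda>i. act r (pair_swap i)) m"

lemma has_weight_of_wproj_nonzero: "v \<in> fvec (fst r) \<Longrightarrow> wproj S v \<noteq> 0 \<Longrightarrow> has_weight r m S"
  unfolding has_weight_def
  using weight_proj_in[of v m S] weight_proj_eigen[of v m _ S] by (intro bexI[of _ "wproj S v"]) auto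

lemma exists_wproj_nonzero:
  assumes "v \<noteq> 0"
  obtains S where "S \<subseteq> {..<m}" "wproj S v \<noteq> 0"
proof -
  have "\<exists>S\<in>Pow {..<m}. wproj S v \<noteq> 0"
  proof (rule ccontr)
    assume "\<not> ?thesis"
    then have "(\<Sum>S\<in>Pow {..<m}. wproj S v) = 0" by (intro sum.neutral) blast
    then show False using sum_weight_proj[of m v] assms by simp
  qed
  then show ?thesis using that by blast
qed

text \<open>Weight vectors for different weights are independent: \<open>wproj T\<close> annihilates
  all of them except the one for \<open>T\<close>.\<close>

lemma card_weights_le: "card {S. S \<subseteq> {..<m} \<and> has_weight r m S} \<le> fst r"
proof -
  define I where "I = {S. S \<subseteq> {..<m} \<and> has_weight r m S}"
  have "\<forall>S\<in>I. \<exists>v. v \<in> fvec (fst r) \<and> v \<noteq> 0 \<and>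
      (\<forall>i<m. act r (pair_swap i) v = cscale (weight_sign S i) v)"
    unfolding I_def has_weight_def by blast
  then obtain v where v: "\<forall>S\<in>I. v S \<in> fvec (fst r) \<and> v S \<noteq> 0 \<and>
      (\<forall>i<m. act r (pair_swap i) (v S) = cscale (weight_sign S i) (v S))"
    by (rule bchoice[THEN exE])
  have fin: "finite I" unfolding I_def by (rule finite_subset[of _ "Pow {..<m}"]) auto
  have "card I \<le> fst r"
  proof (rule card_independent_le[OF fin])
    show "v S \<in> fvec (fst r)" if "S \<in> I" for S using v that by blast
    fix \<alpha> assume 0: "(\<Sum>S\<in>I. cscale (\<alpha> S) (v S)) = 0"
    show "\<forall>S\<in>I. \<alpha> S = 0"
    proof
      fix T assume T: "T \<in> I"
      have "wproj T (v S) = (if S = T then v T else 0)" if S: "S \<in> I" for S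
      proof (cases "S = T")
        case False
        then obtain i where "(i \<in> T) \<noteq> (i \<in> S)" by blast
        moreover from this have "i < m" using S T unfolding I_def by blast
        ultimately show ?thesis using weight_proj_eq_0[of "v S" m i S T] v S False by simp
      qed (use weight_proj_eq_self[of "v T" m T] v T in auto)
      then have "wproj T (\<Sum>S\<in>I. cscale (\<alpha> S) (v S)) = (\<Sum>S\<in>I. cscale (\<alpha> S) (if S = T then v T else 0))"
        unfolding fun_linear_sum[OF linear_weight_proj] fun_linear_scale[OF linear_weight_proj]
        by (intro sum.cong refl) simp
      also have "\<dots> = (\<Sum>S\<in>I. if S = T then cscale (\<alpha> T) (v T) else 0)"
        by (intro sum.cong refl) auto
      also have "\<dots> = cscale (\<alpha> T) (v T)" using fin T by simp
      finally have "cscale (\<alpha> T) (v T) = 0" unfolding 0 fun_linear_0[OF linear_weight_proj] by simp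
      then show "\<alpha> T = 0" using v T by (simp add: cscale_eq_0_iff)
    qed
  qed
  then show ?thesis by (simp add: I_def)
qed

text \<open>Disjoint transpositions, given by their endpoints \<open>a i False\<close> and
  \<open>a i True\<close>, are conjugate to the first \<open>k\<close> standard ones. The element
  \<open>g\<close> carries eigenvectors of the former to eigenvectors of the latter.\<close>

lemma conjugate_to_pair_swaps:
  assumes inj: "inj_on (\<lambda>(i, c). a i c) ({..<k} \<times> UNIV)"
    and a: "\<And>i c. i < k \<Longrightarrow> a i c \<in> {1..n}" and k: "k \<le> m"
  obtains g where "g permutes {1..n}"
    "\<And>i v. i < k \<Longrightarrow> act r (pair_swap i) (act r g v) = act r g (act r (transpose (a i False) (a i True)) v)"
proof -
  \<comment> \<open>The odd point \<open>2 * i + 1\<close> is sent to \<open>a i False\<close> and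
    the even point \<open>2 * i + 2\<close> to \<open>a i True\<close>; \<open>g\<close> is the
    inverse of a permutation extending \<open>f\<close>.\<close>
  define f where "f = (\<lambda>x. a ((x - 1) div 2) (even x))"
  have "inj_on f {1..2 * k}"
  proof (rule inj_onI)
    fix x y assume xy: "x \<in> {1..2 * k}" "y \<in> {1..2 * k}" "f x = f y"
    then have "((x - 1) div 2, even x) = ((y - 1) div 2, even y)"
      using inj_onD[OF inj, of "((x - 1) div 2, even x)" "((y - 1) div 2, even y)"]
      by (auto simp: f_def)
    then have "(x - 1) div 2 = (y - 1) div 2" "even x = even y" by auto
    then show "x = y" using xy(1,2) by (auto elim!: evenE oddE)
  qed
  moreover have "f ` {1..2 * k} \<subseteq> {1..n}" using a by (auto simp: f_def)
  moreover have "{1..2 * k} \<subseteq> {1..n}" using k m by auto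
  ultimately obtain h where h: "h permutes {1..n}" "\<And>x. x \<in> {1..2 * k} \<Longrightarrow> h x = f x"
    using extend_inj_on_to_permutes[of "{1..n}" f "{1..2 * k}"] by (metis finite_atLeastAtMost)
  define g where "g = inv' h"
  have g: "g permutes {1..n}" unfolding g_def by (rule permutes_inv[OF h(1)])
  have "act r (pair_swap i) (act r g v) = act r g (act r (transpose (a i False) (a i True)) v)"
    if i: "i < k" for i v
  proof -
    have "h (2 * i + 1) = a i False" "h (2 * i + 2) = a i True"
      using h(2)[of "2 * i + 1"] h(2)[of "2 * i + 2"] i by (auto simp: f_def)
    then have "g (a i False) = 2 * i + 1" "g (a i True) = 2 * i + 2"
      unfolding g_def using permutes_inverses(2)[OF h(1)] by metis+
    then have "g \<circ> transpose (a i False) (a i True) = pair_swap i \<circ> g"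
      unfolding comp_transpose[OF permutes_inj[OF g]] pair_swap_def by simp
    moreover have "transpose (a i False) (a i True) permutes {1..n}"
      using a[OF i] by (intro permutes_swap_id)
    ultimately show ?thesis
      using act_comp[OF rep] g pair_swap_in[of i] i k by (metis less_le_trans)
  qed
  then show ?thesis using that g by blast
qed

text \<open>A permutation of the pair indices taking \<open>T\<close> to \<open>S\<close> is
  realised by permuting the pairs of points, which moves a weight vector for \<open>S\<close> to one
  for \<open>T\<close>.\<close>

lemma has_weight_card_eq:
  assumes S: "S \<subseteq> {..<m}" and T: "T \<subseteq> {..<m}" and card: "card S = card T" and hw: "has_weight r m S"
  shows "has_weight r m T"
proof -
  obtain v where v: "v \<in> fvec (fst r)" "v \<noteq> 0"
    "\<And>i. i < m \<Longrightarrow> act r (pair_swap i) v = cscale (weight_sign S i) v"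
    using hw unfolding has_weight_def by blast
  obtain f where "bij_betw f T S"
    using finite_same_card_bij[of T S] S T card finite_subset by (metis finite_lessThan)
  then obtain p where p: "p permutes {..<m}" "\<And>i. i \<in> T \<Longrightarrow> p i = f i"
    using extend_inj_on_to_permutes[of "{..<m}" f T] S T by (auto simp: bij_betw_def)
  then have "p ` T = S" using \<open>bij_betw f T S\<close> by (auto simp: bij_betw_def)
  then have sgn: "weight_sign S (p i) = weight_sign T i" for i
    using permutes_inj[OF p(1)] by (auto simp: weight_sign_def inj_eq)
  have pm: "p i < m" if "i < m" for i using permutes_in_image[OF p(1), of i] that by simp
  define a where "a = (\<lambda>i c. if c then 2 * p i + 2 else 2 * p i + 1)"
  have "inj_on (\<lambda>(i, c). a i c) ({..<m} \<times> UNIV)"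
  proof (rule inj_onI, clarify)
    fix i j c d assume "a i c = a j d"
    then have "p i = p j \<and> c = d" unfolding a_def by (cases c; cases d) presburger+
    then show "i = j \<and> c = d" using permutes_inj[OF p(1)] by (simp add: inj_eq)
  qed
  moreover have "a i c \<in> {1..n}" if "i < m" for i c using pm[OF that] m by (auto simp: a_def)
  ultimately obtain g where g: "g permutes {1..n}"
    "\<And>i v. i < m \<Longrightarrow> act r (pair_swap i) (act r g v) = act r g (act r (transpose (a i False) (a i True)) v)"
    using conjugate_to_pair_swaps[of a m] by blast
  have "act r (pair_swap i) (act r g v) = cscale (weight_sign T i) (act r g v)" if i: "i < m" for i
    using g(2)[OF i, of v] v(3)[OF pm[OF i]] by (simp add: a_def pair_swap_def act_simps sgn)
  moreover have "act r g v \<noteq> 0" using act_eq_0_iff[OF rep g(1) v(1)] v(2) by simp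
  ultimately show ?thesis unfolding has_weight_def by (intro bexI[of _ "act r g v"]) auto
qed

text \<open>Once one weight of a given size occurs, all subsets of that size occur, and each
  contributes a dimension.\<close>

lemma binomial_le_dim:
  assumes "S \<subseteq> {..<m}" "has_weight r m S"
  shows "m choose card S \<le> fst r"
proof -
  have "m choose card S = card {T. T \<subseteq> {..<m} \<and> card T = card S}"
    using n_subsets[of "{..<m}" "card S"] by simp
  also have "\<dots> \<le> card {T. T \<subseteq> {..<m} \<and> has_weight r m T}"
    using has_weight_card_eq[OF assms(1) _ _ assms(2)]
    by (intro card_mono) (auto intro: finite_subset[of _ "Pow {..<m}"])
  also have "\<dots> \<le> fst r" by (rule card_weights_le)
  finally show ?thesis .
qed

text \<open>If two points outside the pairs of \<open>S\<close> could be swapped with an effect on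
  the weight vector, the antisymmetrised vector would be negated by one more disjoint transposition,
  and conjugation would give a larger weight.\<close>

lemma has_fixed_of_maximal_weight:
  assumes S: "S \<subseteq> {..<m}" "has_weight r m S"
    and max: "\<And>T. T \<subseteq> {..<m} \<Longrightarrow> has_weight r m T \<Longrightarrow> card T \<le> card S"
    and n: "n \<le> 2 * m + 1"
  obtains A where "A \<subseteq> {1..n}" "card A = n - 2 * card S" "has_fixed r A"
proof -
  define j where "j = card S"
  define P where "P = (\<lambda>(i, c). if c then 2 * i + 2 else 2 * i + 1 :: nat) ` (S \<times> (UNIV :: bool set))"
  define A where "A = {1..n} - P"
  have inj: "inj_on (\<lambda>(i, c). if c then 2 * i + 2 else 2 * i + 1 :: nat) (S \<times> (UNIV :: bool set))"
    by (rule inj_onI) (auto split: if_splits; presburger)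
  have finS: "finite S" using S finite_subset by blast
  have P: "P \<subseteq> {1..n}" using S m by (fastforce simp: P_def)
  have cardP: "card P = 2 * j"
    unfolding P_def card_image[OF inj] by (simp add: card_cartesian_product j_def)
  have A: "A \<subseteq> {1..n}" "finite A" "card A = n - 2 * j"
    using P cardP by (auto simp: A_def card_Diff_subset finite_subset)
  obtain v where v: "v \<in> fvec (fst r)" "v \<noteq> 0"
    "\<And>i. i < m \<Longrightarrow> act r (pair_swap i) v = cscale (weight_sign S i) v"
    using S(2) unfolding has_weight_def by blast
  have swap_fixed: "act r (transpose x y) v = v" if x: "x \<in> A" and y: "y \<in> A" and xy: "x \<noteq> y" for x y
  proof (rule ccontr)
    assume neq: "act r (transpose x y) v \<noteq> v"
    have tr: "transpose x y permutes {1..n}" using x y A by (intro permutes_swap_id) auto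
    \<comment> \<open>Subtracting the swapped vector makes \<open>u\<close> an eigenvector of the
      swap for \<open>-1\<close>; it is nonzero by assumption.\<close>
    define u where "u = v - act r (transpose x y) v"
    have u: "u \<in> fvec (fst r)" "u \<noteq> 0"
      using v neq by (auto simp: u_def intro: fun_subspace_diff[OF fun_subspace_fvec])
    have u_xy: "act r (transpose x y) u = - u"
      using act_inv(1)[OF rep tr v(1)] by (simp add: u_def act_simps)
    \<comment> \<open>Two points outside the pairs of \<open>S\<close> leave room for one more pair
      among the \<open>m\<close> pairs, also when \<open>n\<close> is odd.\<close>
    have "card {x, y} \<le> card A" using A x y by (intro card_mono) auto
    then have jm: "j + 1 \<le> m" using xy A n by simp
    obtain s where s: "bij_betw s {..<j} S" using ex_bij_betw_nat_finite[OF finS]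
      by (auto simp: j_def lessThan_atLeast0)
    have sS: "s i \<in> S" if "i < j" for i using s that by (auto simp: bij_betw_def)
    \<comment> \<open>The first \<open>j\<close> transpositions are the pairs of \<open>S\<close>,
      the last one exchanges \<open>x\<close> and \<open>y\<close>.\<close>
    define a where "a = (\<lambda>i c. if i < j then if c then 2 * s i + 2 else 2 * s i + 1
      else if c then y else x)"
    have aP: "a i c \<in> P" if "i < j" for i c
      unfolding P_def a_def using sS[OF that] that by (intro image_eqI[of _ _ "(s i, c)"]) auto
    have "inj_on (\<lambda>(i, c). a i c) ({..<j + 1} \<times> UNIV)"
    proof (rule inj_onI, clarify)
      fix i i' c c' assume i: "i < j + 1" "i' < j + 1" and eq: "a i c = a i' c'"
      consider "i < j" "i' < j" | "i < j" "i' = j" | "i = j" "i' < j" | "i = j" "i' = j"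
        using i by linarith
      then show "i = i' \<and> c = c'"
      proof cases
        case 1
        then have "s i = s i' \<and> c = c'" using eq unfolding a_def by (cases c; cases c'; simp; presburger)
        then show ?thesis using s 1 by (auto simp: bij_betw_def inj_on_def)
      next
        case 2
        then have "a i' c' \<in> A" using x y by (simp add: a_def)
        then show ?thesis using aP[OF 2(1), of c] eq by (simp add: A_def)
      next
        case 3
        then have "a i c \<in> A" using x y by (simp add: a_def)
        then show ?thesis using aP[OF 3(2), of c'] eq by (simp add: A_def)
      next
        case 4
        then show ?thesis using eq xy by (auto simp: a_def split: if_splits)
      qed
    qed
    moreover have "a i c \<in> {1..n}" if "i < j + 1" for i c
      using aP[of i c] P x y A(1) that by (cases "i < j") (auto simp: a_def)
    ultimately obtain g where g: "g permutes {1..n}"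
      "\<And>i v. i < j + 1 \<Longrightarrow> act r (pair_swap i) (act r g v) = act r g (act r (transpose (a i False) (a i True)) v)"
      using conjugate_to_pair_swaps[of a "j + 1"] jm by blast
    have u_neg: "act r (transpose (a i False) (a i True)) u = - u" if "i < j + 1" for i
    proof (cases "i < j")
      case True
      have si: "s i < m" using sS[OF True] S by auto
      have eq: "transpose (a i False) (a i True) = pair_swap (s i)"
        using True by (simp add: a_def pair_swap_def)
      have "2 * s i + 1 \<in> P" "2 * s i + 2 \<in> P"
        using aP[OF True, of False] aP[OF True, of True] True by (simp_all add: a_def)
      \<comment> \<open>Since \<open>x\<close> and \<open>y\<close> avoid the pairs of
        \<open>S\<close>, the old minus signs survive the antisymmetrisation.\<close>
      then have "pair_swap (s i) \<circ> transpose x y = transpose x y \<circ> pair_swap (s i)"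
        unfolding pair_swap_def using x y by (intro transpose_commute_disjoint) (auto simp: A_def)
      then have "act r (pair_swap (s i)) (act r (transpose x y) v) =
          act r (transpose x y) (act r (pair_swap (s i)) v)"
        using act_comp[OF rep] tr pair_swap_in[OF si] by metis
      moreover have "act r (pair_swap (s i)) v = - v"
        using v(3)[OF si] sS[OF True] by (simp add: weight_sign_def)
      ultimately show ?thesis unfolding eq by (simp add: u_def act_simps)
    next
      case False
      then show ?thesis using u_xy that by (simp add: a_def)
    qed
    define w where "w = act r g u"
    have "w \<noteq> 0" using act_eq_0_iff[OF rep g(1) u(1)] u(2) by (simp add: w_def)
    then obtain T where T: "T \<subseteq> {..<m}" "wproj T w \<noteq> 0" by (rule exists_wproj_nonzero)
    have w: "w \<in> fvec (fst r)" by (simp add: w_def)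
    have "i \<in> T" if i: "i < j + 1" for i
    proof (rule ccontr)
      assume "i \<notin> T"
      \<comment> \<open>Only the sign at index \<open>i\<close> matters here, so \<open>{i}\<close>
        may stand for any set that contains \<open>i\<close>.\<close>
      have "act r (pair_swap i) w = cscale (weight_sign {i} i) w"
        unfolding w_def g(2)[OF i] u_neg[OF i] by (simp add: act_simps weight_sign_def)
      then have "wproj T w = 0"
        using weight_proj_eq_0[of w m i "{i}" T] w i jm \<open>i \<notin> T\<close> by simp
      then show False using T by simp
    qed
    then have "{..<j + 1} \<subseteq> T" by auto
    then have "j + 1 \<le> card T" using T finite_subset card_mono[of T "{..<j + 1}"] by (metis card_lessThan finite_lessThan)
    moreover have "card T \<le> j"
      unfolding j_def using T w has_weight_of_wproj_nonzero by (intro max)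
    ultimately show False by simp
  qed
  have "act r p v = v" if "p permutes A" for p
    using that A(2)
  proof (induction rule: permutes_induct)
    case id
    show ?case by (rule act_id[OF rep v(1)])
  next
    case (swap x y p)
    have "act r (transpose x y \<circ> p) v = act r (transpose x y) (act r p v)"
      using swap A(1) by (intro act_comp[OF rep] permutes_swap_id permutes_subset[OF _ A(1)]) auto
    also have "\<dots> = v" using swap swap_fixed by simp
    finally show ?case by (simp only: o_def)
  qed
  then have "has_fixed r A" unfolding has_fixed_def using v by blast
  then show ?thesis using that A by (simp add: j_def)
qed

text \<open>A transposition changes at most two of the pairs, hence moves a weight vector into the
  weight spaces whose number of minus signs differs by at most two.\<close>

lemma weights_below_gap:
  assumes irr: "irreducible_rep (sym_group n) r"
    and gap: "\<And>T. T \<subseteq> {..<m} \<Longrightarrow> has_weight r m T \<Longrightarrow> card T \<noteq> k + 1 \<and> card T \<noteq> k + 2"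
    and S: "S \<subseteq> {..<m}" "has_weight r m S" "card S \<le> k"
    and T: "T \<subseteq> {..<m}" "has_weight r m T"
  shows "card T \<le> k"
proof (rule ccontr)
  assume "\<not> card T \<le> k"
  \<comment> \<open>The sum of the weight spaces with at most \<open>k\<close> minus signs,
    described by the vanishing of all other projections.\<close>
  define U where "U = {v \<in> fvec (fst r). \<forall>T\<subseteq>{..<m}. card T > k \<longrightarrow> wproj T v = 0}"
  have "fun_subspace U"
    unfolding fun_subspace_def U_def
    by (auto simp: fun_linear_0[OF linear_weight_proj] fun_linear_add[OF linear_weight_proj]
        fun_linear_scale[OF linear_weight_proj] fun_subspace_0[OF fun_subspace_fvec]
        intro!: fun_subspace_add[OF fun_subspace_fvec] fun_subspace_scale[OF fun_subspace_fvec]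
        simp del: plus_fun_def)
  moreover have swap_in_U: "act r (transpose b c) v \<in> U" if b: "b \<in> {1..n}" and c: "c \<in> {1..n}" and v: "v \<in> U" for b c v
  proof -
    have tr: "transpose b c permutes {1..n}" using b c by (intro permutes_swap_id)
    have vV: "v \<in> fvec (fst r)" using v by (simp add: U_def)
    have "wproj T (act r (transpose b c) v) = 0" if T: "T \<subseteq> {..<m}" "card T > k" for T
    proof (rule ccontr)
      assume "wproj T (act r (transpose b c) v) \<noteq> 0"
      then have "has_weight r m T" by (intro has_weight_of_wproj_nonzero) auto
      then have cardT: "card T \<ge> k + 3" using gap[OF T(1)] T(2) by linarith
      have "wproj T (act r (transpose b c) (wproj S v)) = 0" if S: "S \<subseteq> {..<m}" for S
      proof (cases "card S \<le> k")
        case False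
        then have "wproj S v = 0" using v S by (simp add: U_def)
        then show ?thesis by (simp only: act_simps fun_linear_0[OF linear_weight_proj])
      next
        case True
        \<comment> \<open>The point \<open>b\<close> lies in the pair of index
          \<open>(b - 1) div 2\<close>. As \<open>T\<close> has at least \<open>k + 3\<close>
          elements and \<open>B\<close> at most \<open>k + 2\<close>, some index in \<open>T\<close>
          has sign \<open>1\<close> in \<open>S\<close> and its pair is untouched by the
          transposition.\<close>
        define B where "B = S \<union> {(b - 1) div 2, (c - 1) div 2}"
        have finS: "finite S" using S finite_subset by blast
        have "card {(b - 1) div 2, (c - 1) div 2} \<le> 2" by (simp add: card_insert_if)
        then have "card B \<le> k + 2"
          unfolding B_def using card_Un_le[of S "{(b - 1) div 2, (c - 1) div 2}"] True by linarith
        then have "\<not> T \<subseteq> B"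
          using card_mono[of B T] cardT finS by (auto simp: B_def)
        then obtain i where i: "i \<in> T" "i \<notin> S" "i \<noteq> (b - 1) div 2" "i \<noteq> (c - 1) div 2"
          unfolding B_def by blast
        have im: "i < m" using i T by auto
        have "2 * i + 1 \<noteq> b" "2 * i + 2 \<noteq> b" "2 * i + 1 \<noteq> c" "2 * i + 2 \<noteq> c"
          using i by auto
        then have "pair_swap i \<circ> transpose b c = transpose b c \<circ> pair_swap i"
          unfolding pair_swap_def by (intro transpose_commute_disjoint)
        then have "act r (pair_swap i) (act r (transpose b c) (wproj S v)) =
            act r (transpose b c) (act r (pair_swap i) (wproj S v))"
          using act_comp[OF rep] tr pair_swap_in[OF im] by metis
        also have "\<dots> = cscale (weight_sign S i) (act r (transpose b c) (wproj S v))"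
          using weight_proj_eigen[OF vV order.refl im, of S] by (simp add: act_simps)
        finally show ?thesis
          by (intro weight_proj_eq_0[of _ m i S T]) (use i im in auto)
      qed
      then have "(\<Sum>S\<in>Pow {..<m}. wproj T (act r (transpose b c) (wproj S v))) = 0"
        by (intro sum.neutral) auto
      then have "wproj T (act r (transpose b c) (\<Sum>S\<in>Pow {..<m}. wproj S v)) = 0"
        by (simp only: act_simps fun_linear_sum[OF linear_weight_proj])
      then have "wproj T (act r (transpose b c) v) = 0" by (simp only: sum_weight_proj[OF order.refl])
      then show False using \<open>wproj T (act r (transpose b c) v) \<noteq> 0\<close> by simp
    qed
    then show ?thesis by (simp add: U_def)
  qed
  moreover have "act r p v \<in> U" if "p permutes {1..n}" "v \<in> U" for p v
    using that(1) finite_atLeastAtMost[of 1 n]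
  proof (induction rule: permutes_induct)
    case id
    have "act r id v = v" using that(2) by (intro act_id[OF rep]) (simp add: U_def)
    then show ?case using that(2) by metis
  next
    case (swap x y p)
    then have "act r (transpose x y \<circ> p) v = act r (transpose x y) (act r p v)"
      by (intro act_comp[OF rep] permutes_swap_id) auto
    also have "\<dots> \<in> U" using swap.hyps swap.IH by (intro swap_in_U)
    finally show ?case by (simp only: o_def)
  qed
  ultimately have "U = {0} \<or> U = fvec (fst r)"
    by (intro irreducible_rep_invariant_cases[OF irr]) (auto simp: U_def sym_group_carrier)
  moreover have "U \<noteq> {0}"
  proof -
    obtain v where v: "v \<in> fvec (fst r)" "v \<noteq> 0"
      "\<And>i. i < m \<Longrightarrow> act r (pair_swap i) v = cscale (weight_sign S i) v"
      using S(2) unfolding has_weight_def by blast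
    have "wproj T v = 0" if T: "T \<subseteq> {..<m}" "card T > k" for T
    proof -
      obtain i where "(i \<in> T) \<noteq> (i \<in> S)" using S(3) T(2) by (cases "T = S") auto
      moreover from this have "i < m" using S T by blast
      ultimately show ?thesis using weight_proj_eq_0[of v m i S T] v by simp
    qed
    then have "v \<in> U" using v by (simp add: U_def)
    then show ?thesis using v by auto
  qed
  moreover have "U \<noteq> fvec (fst r)"
  proof -
    obtain v where v: "v \<in> fvec (fst r)" "v \<noteq> 0"
      "\<And>i. i < m \<Longrightarrow> act r (pair_swap i) v = cscale (weight_sign T i) v"
      using T(2) unfolding has_weight_def by blast
    then have "wproj T v = v" by (intro weight_proj_eq_self) auto
    then have "v \<notin> U" using v T \<open>\<not> card T \<le> k\<close> by (auto simp: U_def)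
    then show ?thesis using v by blast
  qed
  ultimately show False by blast
qed

end

section \<open>Twisting by the sign\<close>

lemma vec_mat_fun:
  assumes "A \<in> carrier_mat d d"
  shows "A *\<^sub>v vec d v = vec d (mat_fun d d (\<lambda>i j. A $$ (i, j)) v)"
  using assms by (intro eq_vecI) (auto simp: mat_fun_def scalar_prod_def lessThan_atLeast0)

text \<open>The converse of \<open>irreducible_rep_invariant_cases\<close>: an invariant subspace of
  coordinate vectors is pulled back along \<open>vec d\<close>.\<close>

lemma irreducible_repI:
  assumes rep: "is_rep G r" and nz: "fst r \<noteq> 0"
    and inv: "\<And>W. fun_subspace W \<Longrightarrow> W \<subseteq> fvec (fst r) \<Longrightarrow>
      (\<And>g w. g \<in> carrier G \<Longrightarrow> w \<in> W \<Longrightarrow> act r g w \<in> W) \<Longrightarrow> W = {0} \<or> W = fvec (fst r)"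
  shows "irreducible_rep G r"
proof -
  obtain d \<rho> where r: "r = (d, \<rho>)" by force
  have "W = {0\<^sub>v d} \<or> W = carrier_vec d" if W: "invariant_subspace G (d, \<rho>) W" for W
  proof -
    have sub: "submodule class_ring W (module_vec TYPE(complex) d)"
      using W by (simp add: invariant_subspace_def VectorSpace.subspace_def)
    have Wc: "W \<subseteq> carrier_vec d" and W0: "0\<^sub>v d \<in> W"
      and Wadd: "\<And>u v. u \<in> W \<Longrightarrow> v \<in> W \<Longrightarrow> u + v \<in> W"
      and Wsm: "\<And>c w. w \<in> W \<Longrightarrow> c \<cdot>\<^sub>v w \<in> W"
      using submodule.subset[OF sub] submodule.zero_closed[OF sub] submodule.smult_closed[OF sub]
        submodule.m_closed[OF sub]
      by (auto simp: module_vec_simps)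
    have Wact: "\<rho> g *\<^sub>v w \<in> W" if "g \<in> carrier G" "w \<in> W" for g w
      using W that by (simp add: invariant_subspace_def)
    define U where "U = {v \<in> fvec d. vec d v \<in> W}"
    have v0: "vec d 0 = 0\<^sub>v d" by auto
    have vadd: "vec d (u + v) = vec d u + vec d v" for u v by auto
    have vsm: "vec d (cscale c v) = c \<cdot>\<^sub>v vec d v" for c v by (auto simp: cscale_def)
    have "fun_subspace U"
      unfolding fun_subspace_def
    proof (intro conjI ballI allI)
      show "0 \<in> U" unfolding U_def mem_Collect_eq v0
        using W0 fun_subspace_0[OF fun_subspace_fvec] by blast
      show "u + v \<in> U" if "u \<in> U" "v \<in> U" for u v
        using that Wadd fun_subspace_add[OF fun_subspace_fvec] unfolding U_def mem_Collect_eq vadd by blast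
      show "cscale c v \<in> U" if "v \<in> U" for c v
        using that Wsm fun_subspace_scale[OF fun_subspace_fvec] unfolding U_def mem_Collect_eq vsm by blast
    qed
    moreover have "act r g w \<in> U" if g: "g \<in> carrier G" and w: "w \<in> U" for g w
    proof -
      have "\<rho> g \<in> carrier_mat d d" using rep_carrier[of G d \<rho> g] rep g by (simp add: r)
      then have "vec d (act r g w) = \<rho> g *\<^sub>v vec d w" by (simp add: vec_mat_fun act_def r)
      then show ?thesis using Wact[OF g] w act_in_fvec[of r g w] by (simp add: U_def r)
    qed
    ultimately consider "U = {0}" | "U = fvec d"
      using inv[of U] by (auto simp: U_def r)
    then show ?thesis
    proof cases
      case 1
      have "w = 0\<^sub>v d" if w: "w \<in> W" for w
      proof -
        define v where "v = (\<lambda>i. if i < d then w $ i else 0)"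
        have "vec d v = w" using w Wc by (intro eq_vecI) (auto simp: v_def)
        moreover from this have "v \<in> U" using w by (auto simp: U_def v_def fvec_def)
        then have "v = 0" using 1 by blast
        ultimately show ?thesis using v0 by metis
      qed
      then show ?thesis using W0 by blast
    next
      case 2
      have "w \<in> W" if w: "w \<in> carrier_vec d" for w
      proof -
        define v where "v = (\<lambda>i. if i < d then w $ i else 0)"
        have "vec d v = w" using w by (intro eq_vecI) (auto simp: v_def)
        moreover have "v \<in> U" unfolding 2 by (auto simp: v_def fvec_def)
        ultimately show ?thesis unfolding U_def by blast
      qed
      then show ?thesis using Wc by blast
    qed
  qed
  then show ?thesis using rep nz by (simp add: irreducible_rep_def r)
qed

lemma iso_rep_of_eq_on_carrier:
  assumes "is_rep G r" "fst r = fst s" "\<And>g. g \<in> carrier G \<Longrightarrow> snd r g = snd s g"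
  shows "iso_rep G r s"
proof -
  obtain d \<rho> \<sigma> where r: "r = (d, \<rho>)" and s: "s = (d, \<sigma>)" using assms(2) by (cases r; cases s) auto
  have "1\<^sub>m d \<in> carrier (GL d)" by (auto simp: carrier_GL intro!: bexI[of _ "1\<^sub>m d"])
  moreover have "1\<^sub>m d * \<rho> g = \<sigma> g * 1\<^sub>m d" if "g \<in> carrier G" for g
    using rep_carrier[of G d \<rho> g] assms that by (auto simp: r s)
  ultimately show ?thesis by (auto simp: iso_rep_def r s)
qed

section \<open>The sign twist and the one-dimensional representations\<close>

definition twist :: "(nat \<Rightarrow> nat) mat_rep \<Rightarrow> (nat \<Rightarrow> nat) mat_rep" where
  "twist r = (fst r, \<lambda>p. of_int (sign p) \<cdot>\<^sub>m snd r p)"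

lemma fst_twist [simp]: "fst (twist r) = fst r"
  by (simp add: twist_def)

lemma of_int_sign_square: "of_int (sign p) * of_int (sign p) = (1 :: complex)"
  by (simp add: sign_def)

lemma sign_smult_twice:
  "of_int (sign p) \<cdot>\<^sub>m (of_int (sign p) \<cdot>\<^sub>m A) = (A :: complex mat)"
  by (intro eq_matI) (auto simp: mult.assoc[symmetric] of_int_sign_square)

lemma act_twist:
  assumes "is_rep (sym_group n) r" "p permutes {1..n}"
  shows "act (twist r) p v = cscale (of_int (sign p)) (act r p v)"
proof -
  have "snd r p \<in> carrier_mat (fst r) (fst r)"
    using rep_carrier[of "sym_group n" "fst r" "snd r" p] assms by (simp add: sym_group_carrier)
  then show ?thesis
    by (auto simp: act_def mat_fun_def twist_def cscale_def fun_eq_iff sum_distrib_left mult.assoc)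
qed

lemma is_rep_twist:
  assumes rep: "is_rep (sym_group n) r"
  shows "is_rep (sym_group n) (twist r)"
proof -
  obtain d \<rho> where r: "r = (d, \<rho>)" by force
  let ?s = "\<lambda>p. of_int (sign p) :: complex"
  have hom: "\<rho> \<in> hom (sym_group n) (GL d)" using rep by (simp add: is_rep_def r)
  have c: "\<rho> p \<in> carrier_mat d d" if "p permutes {1..n}" for p
    using rep_carrier[of "sym_group n" d \<rho> p] rep that by (simp add: sym_group_carrier r)
  have "?s p \<cdot>\<^sub>m \<rho> p \<in> carrier (GL d)" if p: "p permutes {1..n}" for p
  proof -
    have "\<rho> p \<in> carrier (GL d)" using hom p by (auto simp: hom_def sym_group_carrier)
    then obtain B where B: "B \<in> carrier_mat d d" "B * \<rho> p = 1\<^sub>m d" "\<rho> p * B = 1\<^sub>m d"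
      by (auto simp: carrier_GL)
    have "(?s p \<cdot>\<^sub>m B) * (?s p \<cdot>\<^sub>m \<rho> p) = (?s p * ?s p) \<cdot>\<^sub>m (B * \<rho> p)"
      using B(1) c[OF p] by (intro eq_matI) auto
    moreover have "(?s p \<cdot>\<^sub>m \<rho> p) * (?s p \<cdot>\<^sub>m B) = (?s p * ?s p) \<cdot>\<^sub>m (\<rho> p * B)"
      using B(1) c[OF p] by (intro eq_matI) auto
    moreover have "1 \<cdot>\<^sub>m 1\<^sub>m d = (1\<^sub>m d :: complex mat)" by (intro eq_matI) auto
    ultimately show ?thesis
      unfolding carrier_GL using B c[OF p]
      by (auto simp: of_int_sign_square intro!: bexI[of _ "?s p \<cdot>\<^sub>m B"])
  qed
  moreover have "?s (p \<circ> q) \<cdot>\<^sub>m \<rho> (p \<circ> q) = (?s p \<cdot>\<^sub>m \<rho> p) * (?s q \<cdot>\<^sub>m \<rho> q)"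
    if p: "p permutes {1..n}" and q: "q permutes {1..n}" for p q
  proof -
    have "permutation p" "permutation q" using p q permutation_permutes by blast+
    then have "?s (p \<circ> q) = ?s p * ?s q" by (simp add: sign_compose)
    moreover have "\<rho> (p \<circ> q) = \<rho> p * \<rho> q"
      using hom p q by (auto simp: hom_def sym_group_carrier sym_group_mult mult_GL)
    ultimately show ?thesis using c[OF p] c[OF q] by (intro eq_matI) auto
  qed
  ultimately show ?thesis
    by (auto simp: is_rep_def twist_def r hom_def sym_group_carrier sym_group_mult mult_GL)
qed

text \<open>Each operator changes by a scalar that is its own inverse, so the invariant subspaces
  stay the same.\<close>

lemma irreducible_rep_twist:
  assumes irr: "irreducible_rep (sym_group n) r"
  shows "irreducible_rep (sym_group n) (twist r)"
proof (rule irreducible_repI)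
  have rep: "is_rep (sym_group n) r" using irr by (rule irreducible_imp_rep)
  then show "is_rep (sym_group n) (twist r)" by (rule is_rep_twist)
  show "fst (twist r) \<noteq> 0" using irr by (cases r) (simp add: irreducible_rep_def)
  fix W assume W: "fun_subspace W" "W \<subseteq> fvec (fst (twist r))"
    and inv: "\<And>g w. g \<in> carrier (sym_group n) \<Longrightarrow> w \<in> W \<Longrightarrow> act (twist r) g w \<in> W"
  have "act r g w \<in> W" if g: "g \<in> carrier (sym_group n)" and w: "w \<in> W" for g w
  proof -
    have "act r g w = cscale (of_int (sign g)) (act (twist r) g w)"
      using act_twist[OF rep, of g w] g by (simp add: sym_group_carrier of_int_sign_square)
    then show ?thesis using fun_subspace_scale[OF W(1)] inv[OF g w] by simp
  qed
  then show "W = {0} \<or> W = fvec (fst (twist r))"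
    using irreducible_rep_invariant_cases[OF irr W(1)] W(2) by simp
qed

lemma iso_rep_of_twist:
  assumes r: "is_rep (sym_group n) r" and s: "is_rep (sym_group n) s"
    and iso: "iso_rep (sym_group n) (twist r) (twist s)"
  shows "iso_rep (sym_group n) r s"
proof -
  obtain d \<rho> e \<sigma> where eq: "r = (d, \<rho>)" "s = (e, \<sigma>)" by (cases r; cases s) auto
  obtain P where de: "d = e" and P: "P \<in> carrier (GL d)"
    and int: "\<And>g. g \<in> carrier (sym_group n) \<Longrightarrow>
      P * (of_int (sign g) \<cdot>\<^sub>m \<rho> g) = (of_int (sign g) \<cdot>\<^sub>m \<sigma> g) * P"
    using iso by (auto simp: iso_rep_def twist_def eq)
  have Pc: "P \<in> carrier_mat d d" using P by (auto simp: carrier_GL)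
  have "P * \<rho> g = \<sigma> g * P" if g: "g \<in> carrier (sym_group n)" for g
  proof -
    let ?s = "of_int (sign g) :: complex"
    have c: "\<rho> g \<in> carrier_mat d d" "\<sigma> g \<in> carrier_mat d d"
      using rep_carrier[OF _ g] r s de by (auto simp: eq)
    have "?s \<cdot>\<^sub>m (P * \<rho> g) = ?s \<cdot>\<^sub>m (\<sigma> g * P)"
      using int[OF g] mult_smult_distrib[OF Pc c(1), of ?s] mult_smult_assoc_mat[OF c(2) Pc, of ?s]
      by simp
    then have "?s \<cdot>\<^sub>m (?s \<cdot>\<^sub>m (P * \<rho> g)) = ?s \<cdot>\<^sub>m (?s \<cdot>\<^sub>m (\<sigma> g * P))" by simp
    then show ?thesis unfolding sign_smult_twice .
  qed
  then show ?thesis using P de by (auto simp: iso_rep_def eq)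
qed

text \<open>Transpositions are odd, so the twist exchanges the two signs at every index. Weights
  with many minus signs are thereby turned into weights with few.\<close>

lemma has_weight_twist:
  assumes rep: "is_rep (sym_group n) r" and m: "2 * m \<le> n"
  shows "has_weight (twist r) m S \<longleftrightarrow> has_weight r m ({..<m} - S)"
proof -
  have "act (twist r) (pair_swap i) v = cscale (weight_sign S i) v \<longleftrightarrow>
      act r (pair_swap i) v = cscale (weight_sign ({..<m} - S) i) v" if i: "i < m" for i v
  proof -
    have "act (twist r) (pair_swap i) v = - act r (pair_swap i) v"
      using act_twist[OF rep pair_swap_permutes, of i v] m i
      by (simp add: pair_swap_def sign_swap_id)
    moreover have "cscale (weight_sign S i) v = - cscale (weight_sign ({..<m} - S) i) v"
      using i by (auto simp: weight_sign_def)
    ultimately show ?thesis by simp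
  qed
  then show ?thesis by (auto simp: has_weight_def)
qed

text \<open>The fixed vectors form an invariant subspace, so by irreducibility every vector is
  fixed.\<close>

lemma trivial_of_has_fixed_all:
  assumes irr: "irreducible_rep (sym_group n) r" and fixed: "has_fixed r {1..n}"
  shows "fst r = 1" and "\<And>p. p permutes {1..n} \<Longrightarrow> snd r p = 1\<^sub>m 1"
proof -
  have rep: "is_rep (sym_group n) r" using irr by (rule irreducible_imp_rep)
  define U where "U = {v \<in> fvec (fst r). \<forall>p. p permutes {1..n} \<longrightarrow> act r p v = v}"
  have "fun_subspace U"
    unfolding fun_subspace_def U_def
    using fun_subspace_0[OF fun_subspace_fvec] fun_subspace_add[OF fun_subspace_fvec]
      fun_subspace_scale[OF fun_subspace_fvec]
    by (auto simp: act_simps simp del: plus_fun_def)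
  then have "U = {0} \<or> U = fvec (fst r)"
    by (rule irreducible_rep_invariant_cases[OF irr]) (auto simp: U_def sym_group_carrier)
  moreover have "U \<noteq> {0}" using fixed unfolding has_fixed_def U_def by blast
  ultimately have all: "act r p v = v" if "v \<in> fvec (fst r)" "p permutes {1..n}" for p v
    using that by (auto simp: U_def)
  \<comment> \<open>Every subspace is invariant now, so the line through the first unit vector must
    be the whole space.\<close>
  define W where "W = {v \<in> fvec (fst r). \<forall>i>0. v i = 0}"
  have "fun_subspace W"
    unfolding fun_subspace_def W_def by (auto simp: fvec_def cscale_def)
  then have W: "W = {0} \<or> W = fvec (fst r)"
    by (rule irreducible_rep_invariant_cases[OF irr])
      (auto simp: W_def sym_group_carrier all)
  have d0: "fst r \<noteq> 0" using irr by (cases r) (simp add: irreducible_rep_def)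
  then have "delta 0 \<in> fvec (fst r)" by (intro delta_in_fvec) simp
  then have "delta 0 \<in> W" by (simp add: W_def) (simp add: delta_def)
  then have W: "W = fvec (fst r)" using W delta_nonzero by auto
  show d: "fst r = 1"
  proof (rule ccontr)
    assume "fst r \<noteq> 1"
    then have "delta 1 \<in> W" unfolding W using d0 by (intro delta_in_fvec) simp
    then have "delta 1 1 = 0" by (simp add: W_def)
    then show False by (simp add: delta_def)
  qed
  fix p assume p: "p permutes {1..n}"
  have "snd r p \<in> carrier_mat 1 1"
    using rep_carrier[of "sym_group n" "fst r" "snd r" p, unfolded d] rep p
    by (metis d prod.collapse sym_group_carrier)
  moreover have "act r p (delta 0) 0 = delta 0 0" using all[OF delta_in_fvec p, of 0] d by simp
  then have "snd r p $$ (0, 0) = 1" by (simp add: act_def mat_fun_def d delta_def)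
  ultimately show "snd r p = 1\<^sub>m 1" by (intro eq_matI) auto
qed

lemma iso_triv_of_has_fixed_all:
  assumes irr: "irreducible_rep (sym_group n) r" and fixed: "has_fixed r {1..n}"
  shows "iso_rep (sym_group n) r triv_rep"
  by (rule iso_rep_of_eq_on_carrier[OF irreducible_imp_rep[OF irr]])
    (simp_all add: trivial_of_has_fixed_all[OF assms] triv_rep_def sym_group_carrier)

lemma iso_sign_of_twist_has_fixed_all:
  assumes irr: "irreducible_rep (sym_group n) r" and fixed: "has_fixed (twist r) {1..n}"
  shows "iso_rep (sym_group n) r sign_rep"
proof (rule iso_rep_of_eq_on_carrier[OF irreducible_imp_rep[OF irr]])
  note triv = trivial_of_has_fixed_all[OF irreducible_rep_twist[OF irr] fixed]
  show "fst r = fst sign_rep" using triv(1) by (simp add: sign_rep_def)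
  fix p assume "p \<in> carrier (sym_group n)"
  then have "of_int (sign p) \<cdot>\<^sub>m snd r p = 1\<^sub>m 1"
    using triv(2)[of p] by (simp add: sym_group_carrier twist_def)
  then have "of_int (sign p) \<cdot>\<^sub>m (of_int (sign p) \<cdot>\<^sub>m snd r p) = of_int (sign p) \<cdot>\<^sub>m 1\<^sub>m 1" by simp
  then show "snd r p = snd sign_rep p" unfolding sign_smult_twice by (simp add: sign_rep_def)
qed

text \<open>With \<open>i\<close> the smaller of \<open>j\<close> and \<open>m - j\<close>, the
  estimate \<open>(m choose i) \<ge> (m / i) ^ i\<close> has base at least 2 and exponent at least
  \<open>q\<close>.\<close>

lemma power_two_le_middle_binomial:
  assumes "q \<le> j" "j \<le> m - q" "q \<le> m"
  shows "2 ^ q \<le> m choose j"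
proof -
  define i where "i = min j (m - j)"
  have i: "q \<le> i" "2 * i \<le> m" using assms by (auto simp: i_def)
  have eq: "m choose j = m choose i"
    using binomial_symmetric[of j m] assms by (auto simp: i_def min_def)
  show ?thesis
  proof (cases "i = 0")
    case False
    have "(2 :: real) ^ q \<le> 2 ^ i" using i by (intro power_increasing) auto
    also have "\<dots> \<le> (real m / real i) ^ i" using i False by (intro power_mono) (auto simp: field_simps)
    also have "\<dots> \<le> real (m choose i)" using i by (intro binomial_ge_n_over_k_pow_k) auto
    finally have "real (2 ^ q) \<le> real (m choose i)" by simp
    then show ?thesis unfolding eq by (simp only: of_nat_le_iff)
  qed (use i in \<open>auto simp: eq\<close>)
qed

text \<open>Take \<open>j\<close> to be the largest size of a weight. It is at most \<open>q\<close>
  by \<open>low\<close>, and it is not zero, since otherwise the fixing set \<open>A\<close> would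
  be all of \<open>{1..n}\<close>.\<close>

lemma low_weights_cases:
  assumes irr: "irreducible_rep (sym_group n) r" and mn: "m = n div 2"
    and low: "\<And>S. S \<subseteq> {..<m} \<Longrightarrow> has_weight r m S \<Longrightarrow> card S \<le> q"
    and triv: "\<not> has_fixed r {1..n}"
  shows "\<exists>j\<in>{1..q}. (\<exists>A\<subseteq>{1..n}. card A = n - 2 * j \<and> has_fixed r A) \<and> m choose j \<le> fst r"
proof -
  interpret sym_rep n m r
    by unfold_locales (use mn in \<open>auto intro: irreducible_imp_rep[OF irr]\<close>)
  define J where "J = card ` {S. S \<subseteq> {..<m} \<and> has_weight r m S}"
  have fin: "finite J" unfolding J_def by (rule finite_imageI, rule finite_subset[of _ "Pow {..<m}"]) auto
  have "fst r \<noteq> 0" using irr by (cases r) (simp add: irreducible_rep_def)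
  then have "delta 0 \<in> fvec (fst r)" by (intro delta_in_fvec) simp
  moreover obtain R where R: "R \<subseteq> {..<m}" "wproj R (delta 0) \<noteq> 0"
    by (rule exists_wproj_nonzero[OF delta_nonzero[of 0]])
  ultimately have "has_weight r m R" by (intro has_weight_of_wproj_nonzero)
  then have "card R \<in> J" using R unfolding J_def by blast
  then have "J \<noteq> {}" by blast
  then have "Max J \<in> J" using fin by (rule Max_in[rotated])
  then obtain S where S: "S \<subseteq> {..<m}" "has_weight r m S" "card S = Max J" by (auto simp: J_def)
  have max: "card T \<le> card S" if "T \<subseteq> {..<m}" "has_weight r m T" for T
    unfolding S(3) using that fin by (intro Max_ge) (auto simp: J_def)
  have nm: "n \<le> 2 * m + 1" unfolding mn by presburger
  obtain A where A: "A \<subseteq> {1..n}" "card A = n - 2 * card S" "has_fixed r A"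
    using has_fixed_of_maximal_weight[OF S(1,2) max nm] by blast
  have "card S \<noteq> 0"
  proof
    assume "card S = 0"
    then have "A = {1..n}" using A(1,2) by (intro card_subset_eq) auto
    then show False using triv A(3) by simp
  qed
  then have "card S \<in> {1..q}" using low[OF S(1,2)] by simp
  then show ?thesis using A binomial_le_dim[OF S(1,2)] by blast
qed

text \<open>Either all weights have few minus signs, or all have many and the twist has few, or a
  weight of middle size exists because gaps are short. A middle weight makes the dimension at least
  \<open>2 ^ q\<close>.\<close>

lemma small_depth_or_large_dim:
  assumes irr: "irreducible_rep (sym_group n) r" and mn: "m = n div 2"
    and q: "1 \<le> q" "2 * q + 1 \<le> m"
    and triv: "\<not> has_fixed r {1..n}" and sgn: "\<not> has_fixed (twist r) {1..n}"
  shows "(\<exists>j\<in>{1..q}. (\<exists>A\<subseteq>{1..n}. card A = n - 2 * j \<and> (has_fixed r A \<or> has_fixed (twist r) A)) \<and>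
      m choose j \<le> fst r) \<or> 2 ^ q \<le> fst r"
proof -
  interpret sym_rep n m r
    by unfold_locales (use mn in \<open>auto intro: irreducible_imp_rep[OF irr]\<close>)
  consider (low) "\<forall>S. S \<subseteq> {..<m} \<longrightarrow> has_weight r m S \<longrightarrow> card S \<le> q"
    | (high) "\<forall>S. S \<subseteq> {..<m} \<longrightarrow> has_weight r m S \<longrightarrow> m - q \<le> card S"
    | (both) S T where "S \<subseteq> {..<m}" "has_weight r m S" "card S < m - q"
        "T \<subseteq> {..<m}" "has_weight r m T" "q < card T"
    by (meson not_le)
  then show ?thesis
  proof cases
    case low
    then show ?thesis using low_weights_cases[OF irr mn _ triv, of q] by blast
  next
    case high
    have "card S \<le> q" if S: "S \<subseteq> {..<m}" "has_weight (twist r) m S" for S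
    proof -
      have "has_weight r m ({..<m} - S)"
        using has_weight_twist[OF rep, of m S] S m by simp
      then have "m - q \<le> card ({..<m} - S)" using high[rule_format, of "{..<m} - S"] by auto
      also have "\<dots> = m - card S" using S finite_subset by (subst card_Diff_subset) auto
      finally show ?thesis
        using card_mono[OF _ S(1)] q by simp
    qed
    then show ?thesis
      using low_weights_cases[OF irreducible_rep_twist[OF irr] mn _ sgn, of q] by auto
  next
    case both
    have "\<exists>R\<subseteq>{..<m}. has_weight r m R \<and> q \<le> card R \<and> card R \<le> m - q"
    proof (rule ccontr)
      assume neg: "\<not> ?thesis"
      have "card T \<le> q - 1"
      \<comment> \<open>The gap consists of the sizes \<open>q\<close> and \<open>q + 1\<close>;
        both are middle sizes because \<open>2 * q + 1 \<le> m\<close>.\<close>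
      proof (rule weights_below_gap[OF irr _ both(1,2) _ both(4,5)])
        show "card S \<le> q - 1" using neg both(1-3) by force
        fix R assume "R \<subseteq> {..<m}" "has_weight r m R"
        then show "card R \<noteq> q - 1 + 1 \<and> card R \<noteq> q - 1 + 2"
          using neg q by force
      qed
      then show False using both(6) by simp
    qed
    then obtain R where R: "R \<subseteq> {..<m}" "has_weight r m R" "q \<le> card R" "card R \<le> m - q" by blast
    have "2 ^ q \<le> m choose card R" using R q by (intro power_two_le_middle_binomial) auto
    also have "\<dots> \<le> fst r" using R by (intro binomial_le_dim)
    finally show ?thesis by simp
  qed
qed

section \<open>The standard representation\<close>

text \<open>The action on the basis \<open>e\<^sub>j\<^sub>+\<^sub>1 - e\<^sub>n\<close>, \<open>j < n - 1\<close>, of the sum-zero vectors.\<close>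

definition std_rep :: "nat \<Rightarrow> (nat \<Rightarrow> nat) mat_rep" where
  "std_rep n = (n - 1, \<lambda>p. mat (n - 1) (n - 1)
    (\<lambda>(i, j). of_bool (p (Suc j) = Suc i) - of_bool (p n = Suc i)))"

lemma std_rep_mult:
  assumes n: "n > 0" and p: "p permutes {1..n}" and q: "q permutes {1..n}"
  shows "snd (std_rep n) (p \<circ> q) = snd (std_rep n) p * snd (std_rep n) q"
proof (rule eq_matI)
  fix i l assume "i < dim_row (snd (std_rep n) p * snd (std_rep n) q)"
    "l < dim_col (snd (std_rep n) p * snd (std_rep n) q)"
  then have il: "i < n - 1" "l < n - 1" by (auto simp: std_rep_def)
  define F where "F = (\<lambda>x. of_bool (p x = Suc i) - of_bool (p n = Suc i) :: complex)"
  define H where "H = (\<lambda>x. of_bool (q (Suc l) = x) - of_bool (q n = x) :: complex)"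
  have "(snd (std_rep n) p * snd (std_rep n) q) $$ (i, l) = (\<Sum>j<n - 1. F (Suc j) * H (Suc j))"
    using il by (simp add: std_rep_def scalar_prod_def F_def H_def lessThan_atLeast0)
  \<comment> \<open>The added summand vanishes because \<open>F n = 0\<close>, so the sum runs over
    all points of \<open>{1..n}\<close>.\<close>
  also have "\<dots> = (\<Sum>j<n. F (Suc j) * H (Suc j))"
    using n by (cases n) (auto simp: F_def)
  also have "\<dots> = (\<Sum>x\<in>{1..n}. F x * H x)"
    by (rule sum.reindex_bij_witness[of _ "\<lambda>x. x - 1" Suc]) auto
  also have "\<dots> = (\<Sum>x\<in>{1..n}. (if q (Suc l) = x then F x else 0) - (if q n = x then F x else 0))"
    by (intro sum.cong) (auto simp: H_def)
  also have "\<dots> = F (q (Suc l)) - F (q n)"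
  proof -
    have "q (Suc l) \<in> {1..n}" "q n \<in> {1..n}"
      using permutes_in_image[OF q, of "Suc l"] permutes_in_image[OF q, of n] il n by auto
    then show ?thesis by (simp add: sum_subtractf)
  qed
  also have "\<dots> = snd (std_rep n) (p \<circ> q) $$ (i, l)"
    using il by (simp add: std_rep_def F_def)
  finally show "snd (std_rep n) (p \<circ> q) $$ (i, l) = (snd (std_rep n) p * snd (std_rep n) q) $$ (i, l)" ..
qed (auto simp: std_rep_def)

lemma is_rep_std_rep:
  assumes n: "n > 0"
  shows "is_rep (sym_group n) (std_rep n)"
proof -
  let ?M = "snd (std_rep n)"
  have one: "?M id = 1\<^sub>m (n - 1)"
    by (rule eq_matI) (auto simp: std_rep_def)
  have "?M p \<in> carrier (GL (n - 1))" if p: "p permutes {1..n}" for p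
  proof -
    have "?M (inv' p) * ?M p = 1\<^sub>m (n - 1)" "?M p * ?M (inv' p) = 1\<^sub>m (n - 1)"
      using std_rep_mult[OF n p permutes_inv[OF p]] std_rep_mult[OF n permutes_inv[OF p] p]
      by (simp_all add: permutes_inv_o[OF p] one)
    then show ?thesis
      unfolding carrier_GL by (auto simp: std_rep_def intro!: bexI[of _ "?M (inv' p)"])
  qed
  then have "?M \<in> hom (sym_group n) (GL (n - 1))"
    using std_rep_mult[OF n] by (auto simp: hom_def sym_group_carrier sym_group_mult mult_GL)
  then show ?thesis by (simp add: is_rep_def std_rep_def)
qed

lemma act_std_rep:
  "act (std_rep n) p v = (\<lambda>i. if i < n - 1 then
    (\<Sum>j<n - 1. (of_bool (p (Suc j) = Suc i) - of_bool (p n = Suc i)) * v j) else 0)"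
  by (auto simp: act_def mat_fun_def std_rep_def fun_eq_iff)

text \<open>Subtracting from \<open>w\<close> its image under the swap of \<open>Suc a\<close> and
  \<open>n\<close> leaves a multiple of \<open>delta a\<close>. One unit vector in \<open>W\<close>
  yields all others by transpositions of points below \<open>n\<close>.\<close>

lemma irreducible_std_rep:
  assumes n: "n \<ge> 2"
  shows "irreducible_rep (sym_group n) (std_rep n)"
proof (rule irreducible_repI)
  show "is_rep (sym_group n) (std_rep n)" using n by (intro is_rep_std_rep) simp
  have fst: "fst (std_rep n) = n - 1" by (simp add: std_rep_def)
  show "fst (std_rep n) \<noteq> 0" using n fst by simp
  fix W assume W: "fun_subspace W" "W \<subseteq> fvec (fst (std_rep n))"
    and inv: "\<And>g w. g \<in> carrier (sym_group n) \<Longrightarrow> w \<in> W \<Longrightarrow> act (std_rep n) g w \<in> W"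
  have inv: "act (std_rep n) (transpose a b) w \<in> W" if "a \<in> {1..n}" "b \<in> {1..n}" "w \<in> W" for a b w
    using that inv permutes_swap_id by (metis sym_group_carrier)
  have "W = fvec (n - 1)" if nz: "W \<noteq> {0}"
  proof -
    obtain w where w: "w \<in> W" "w \<noteq> 0" using nz fun_subspace_0[OF W(1)] by blast
    have wf: "w i = 0" if "i \<ge> n - 1" for i using w W that by (auto simp: fst fvec_def)
    define s where "s = (\<Sum>j<n - 1. w j)"
    \<comment> \<open>As a sum-zero vector, \<open>w\<close> has coordinate \<open>- s\<close> at
      the point \<open>n\<close>. If all other coordinates were \<open>- s\<close> too, the vector
      would be constant with sum zero.\<close>
    have "\<exists>a<n - 1. w a + s \<noteq> 0"
    proof (rule ccontr)
      assume "\<not> ?thesis"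
      then have wa: "w a = - s" if "a < n - 1" for a
        using that by (simp add: add_eq_0_iff2)
      have "s = (\<Sum>j<n - 1. w j)" by (rule s_def)
      also have "\<dots> = (\<Sum>j<n - 1. - s)" by (rule sum.cong) (auto simp: wa)
      finally have "s + of_nat (n - 1) * s = 0"
        by (simp only: sum_constant card_lessThan mult_minus_right eq_neg_iff_add_eq_0)
      moreover have "of_nat n = 1 + (of_nat (n - 1) :: complex)" using n by (simp add: of_nat_diff)
      ultimately have "of_nat n * s = 0" by (simp only: distrib_right mult_1_left)
      then have "s = 0" using n by simp
      then have "w i = 0" for i using wa wf by (cases "i < n - 1") auto
      then show False using w(2) by (auto simp: fun_eq_iff)
    qed
    then obtain a where a: "a < n - 1" "w a + s \<noteq> 0" by blast
    have "w - act (std_rep n) (transpose (Suc a) n) w = cscale (w a + s) (delta a)"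
    proof
      fix i
      show "(w - act (std_rep n) (transpose (Suc a) n) w) i = cscale (w a + s) (delta a) i"
      proof (cases "i < n - 1")
        case True
        \<comment> \<open>Since \<open>n\<close> goes to \<open>Suc a\<close>, only row
          \<open>a\<close> carries the subtracted term; since \<open>Suc a\<close> goes to
          \<open>n\<close>, the first term contributes nothing in column \<open>a\<close>.\<close>
        have "(\<Sum>j<n - 1. (of_bool (transpose (Suc a) n (Suc j) = Suc i) - of_bool (a = i)) * w j) =
            (\<Sum>j<n - 1. (if j = i then of_bool (i \<noteq> a) * w i else 0) - of_bool (a = i) * w j)"
        proof (intro sum.cong refl)
          fix j assume "j \<in> {..<n - 1}"
          then show "(of_bool (transpose (Suc a) n (Suc j) = Suc i) - of_bool (a = i)) * w j =
              (if j = i then of_bool (i \<noteq> a) * w i else 0) - of_bool (a = i) * w j"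
            using True a by (auto simp: transpose_def)
        qed
        also have "\<dots> = of_bool (i \<noteq> a) * w i - of_bool (a = i) * s"
          using True by (simp add: sum_subtractf s_def sum_distrib_left)
        finally show ?thesis
          using True by (auto simp: act_std_rep cscale_def delta_def)
      qed (use a wf in \<open>auto simp: act_std_rep cscale_def delta_def\<close>)
    qed
    moreover have "w - act (std_rep n) (transpose (Suc a) n) w \<in> W"
      using a w n by (intro fun_subspace_diff[OF W(1)] inv) auto
    ultimately have "cscale (w a + s) (delta a) \<in> W" by simp
    then have "cscale (1 / (w a + s)) (cscale (w a + s) (delta a)) \<in> W"
      by (rule fun_subspace_scale[OF W(1)])
    then have da: "delta a \<in> W" using a(2) by simp
    have "delta b \<in> W" if b: "b < n - 1" for b
    proof (cases "b = a")
      case False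
      have "act (std_rep n) (transpose (Suc a) (Suc b)) (delta a) = delta b"
      proof
        fix i
        have "(\<Sum>j<n - 1. (of_bool (transpose (Suc a) (Suc b) (Suc j) = Suc i) -
            of_bool (transpose (Suc a) (Suc b) n = Suc i)) * delta a j) =
            of_bool (b = i)" if "i < n - 1"
        proof -
          have "transpose (Suc a) (Suc b) n = n" using a b by (auto simp: transpose_def)
          then show ?thesis using that a by (auto simp: delta_def if_distrib cong: if_cong)
        qed
        then show "act (std_rep n) (transpose (Suc a) (Suc b)) (delta a) i = delta b i"
          using b by (auto simp: act_std_rep delta_def)
      qed
      then show ?thesis using inv[of "Suc a" "Suc b" "delta a"] a b da by simp
    qed (use da in simp)
    then have "(\<Sum>i<n - 1. cscale (v i) (delta i)) \<in> W" for v
      by (intro fun_subspace_sum[OF W(1)] fun_subspace_scale[OF W(1)]) simp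
    then have "v \<in> W" if "v \<in> fvec (n - 1)" for v using fvec_expand[OF that] by metis
    then show ?thesis using W(2) by (auto simp: fst)
  qed
  then show "W = {0} \<or> W = fvec (fst (std_rep n))" by (auto simp: fst)
qed

section \<open>The Witten zeta function\<close>

definition irr_representative :: "'g mat_rep set \<Rightarrow> 'g mat_rep" where
  "irr_representative C = (SOME r. r \<in> C)"

lemma irr_representative:
  assumes "C \<in> Irr G"
  shows "irreducible_rep G (irr_representative C)"
    and "C = irrep_rel G `` {irr_representative C}"
    and "dim_irr C = fst (irr_representative C)"
proof -
  obtain r where r: "irreducible_rep G r" "C = irrep_rel G `` {r}"
    using assms by (auto simp: Irr_def elim: quotientE)
  then have "r \<in> C" using equiv_class_self[OF equiv_irrep_rel] by blast
  then have "irr_representative C \<in> C" unfolding irr_representative_def by (rule someI)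
  then have rel: "(r, irr_representative C) \<in> irrep_rel G" using r by blast
  then show irr: "irreducible_rep G (irr_representative C)" by (simp add: irrep_rel_def)
  show C: "C = irrep_rel G `` {irr_representative C}"
    unfolding r(2) using equiv_class_eq[OF equiv_irrep_rel rel] r(2) by simp
  show "dim_irr C = fst (irr_representative C)"
    using dim_irr_class[of G "fst (irr_representative C)" "snd (irr_representative C)"] irr C by simp
qed

lemma irr_representative_not_iso:
  assumes "C \<in> Irr G" "D \<in> Irr G" "C \<noteq> D"
  shows "\<not> iso_rep G (irr_representative C) (irr_representative D)"
proof
  assume "iso_rep G (irr_representative C) (irr_representative D)"
  then have "(irr_representative C, irr_representative D) \<in> irrep_rel G"
    using irr_representative(1)[OF assms(1)] irr_representative(1)[OF assms(2)]
    by (simp add: irrep_rel_def)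
  then have "irrep_rel G `` {irr_representative C} = irrep_rel G `` {irr_representative D}"
    by (rule equiv_class_eq[OF equiv_irrep_rel])
  then show False using irr_representative(2) assms by metis
qed

text \<open>Every finite set of classes obeys one common bound, which forces the whole set to be
  finite.\<close>

lemma finite_Irr_sym_group: "finite (Irr (sym_group n))"
  and card_Irr_sym_group_le: "card (Irr (sym_group n)) \<le> (n + 1) * class_bound n"
proof -
  have "card I \<le> (n + 1) * class_bound n" if "I \<subseteq> Irr (sym_group n)" "finite I" for I
    by (rule card_pairwise_not_iso_le[where r = irr_representative])
      (use that irr_representative(1) irr_representative_not_iso in blast)+
  then show "finite (Irr (sym_group n))" "card (Irr (sym_group n)) \<le> (n + 1) * class_bound n"
    using finite_if_finite_subsets_card_bdd[of "Irr (sym_group n)"] by blast+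
qed

definition low_depth_Irr :: "nat \<Rightarrow> nat \<Rightarrow> (nat \<Rightarrow> nat) mat_rep set set" where
  "low_depth_Irr n K = {C \<in> Irr (sym_group n). \<exists>A\<subseteq>{1..n}. card A = n - K \<and>
    (has_fixed (irr_representative C) A \<or> has_fixed (twist (irr_representative C)) A)}"

text \<open>The factor 2 accounts for the representation and its twist. Twists of non-isomorphic
  representations are non-isomorphic, so the depth count applies to both.\<close>

lemma card_low_depth_Irr_le:
  assumes K: "K \<le> n"
  shows "card (low_depth_Irr n K) \<le> 2 * ((K + 1) * class_bound K)"
proof -
  define P where "P = (\<lambda>f. {C \<in> Irr (sym_group n). \<exists>A\<subseteq>{1..n}. card A = n - K \<and>
    has_fixed (f (irr_representative C)) A})"
  have fin: "finite (P f)" for f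
    unfolding P_def by (rule finite_subset[OF _ finite_Irr_sym_group[of n]]) auto
  have "card (P id) \<le> (K + 1) * class_bound K"
    by (rule card_depth_le[where r = irr_representative, OF fin _ _ K])
      (auto simp: P_def irr_representative(1) irr_representative_not_iso)
  moreover have "card (P twist) \<le> (K + 1) * class_bound K"
  proof (rule card_depth_le[where r = "\<lambda>C. twist (irr_representative C)", OF fin _ _ K])
    fix C D assume "C \<in> P twist" "D \<in> P twist" "C \<noteq> D"
    then have "C \<in> Irr (sym_group n)" "D \<in> Irr (sym_group n)" "C \<noteq> D" by (auto simp: P_def)
    then show "\<not> iso_rep (sym_group n) (twist (irr_representative C)) (twist (irr_representative D))"
      using iso_rep_of_twist irr_representative(1) irr_representative_not_iso irreducible_imp_rep
      by metis
  qed (auto simp: P_def irr_representative(1) irreducible_rep_twist)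
  moreover have "low_depth_Irr n K = P id \<union> P twist" by (auto simp: low_depth_Irr_def P_def)
  ultimately show ?thesis using card_Un_le[of "P id" "P twist"] by simp
qed

lemma Irr_Sym_star_cases:
  assumes C: "C \<in> Irr_Sym_star n" and m: "m = n div 2" and q: "1 \<le> q" "2 * q + 1 \<le> m"
  shows "(\<exists>j\<in>{1..q}. C \<in> low_depth_Irr n (2 * j) \<and> m choose j \<le> dim_irr C) \<or> 2 ^ q \<le> dim_irr C"
proof -
  let ?r = "irr_representative C"
  have C': "C \<in> Irr (sym_group n)" using C by (simp add: Irr_Sym_star_def)
  have irr: "irreducible_rep (sym_group n) ?r" using irr_representative(1)[OF C'] .
  have not_iso: "\<not> iso_rep (sym_group n) ?r t"
    if "irreducible_rep (sym_group n) t" "C \<noteq> irrep_rel (sym_group n) `` {t}" for t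
  proof
    assume "iso_rep (sym_group n) ?r t"
    then have "(?r, t) \<in> irrep_rel (sym_group n)" using irr that by (simp add: irrep_rel_def)
    then have "irrep_rel (sym_group n) `` {?r} = irrep_rel (sym_group n) `` {t}"
      by (rule equiv_class_eq[OF equiv_irrep_rel])
    then show False using irr_representative(2)[OF C'] that(2) by simp
  qed
  have "\<not> has_fixed ?r {1..n}"
    using iso_triv_of_has_fixed_all[OF irr] not_iso[OF irreducible_triv_rep] C
    by (auto simp: Irr_Sym_star_def)
  moreover have "\<not> has_fixed (twist ?r) {1..n}"
    using iso_sign_of_twist_has_fixed_all[OF irr] not_iso[OF irreducible_sign_rep] C
    by (auto simp: Irr_Sym_star_def)
  ultimately show ?thesis
    using small_depth_or_large_dim[OF irr m q] C'
    unfolding low_depth_Irr_def irr_representative(3)[OF C'] by blast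
qed

section \<open>Bounding the zeta sum\<close>

lemma inverse_powr_antimono:
  assumes "0 < D" "D \<le> d" "0 \<le> s"
  shows "1 / real d powr s \<le> real D powr (- s)"
  using assms powr_mono2[of s "real D" "real d"]
  by (auto simp: powr_minus field_simps)

text \<open>The classes are covered by the sets \<open>Y j\<close> of low depth and dimension at
  least \<open>m choose j\<close>, and by the set \<open>Z\<close> of dimension at least
  \<open>2 ^ q\<close>. Each is estimated by its cardinality times its largest possible
  term.\<close>

lemma witten_zeta_le:
  assumes m: "m = n div 2" and q: "1 \<le> q" "2 * q + 1 \<le> m" and s: "0 \<le> s"
  shows "witten_zeta (Irr_Sym_star n) s \<le>
    (\<Sum>j=1..q. real (2 * ((2 * j + 1) * class_bound (2 * j))) * real (m choose j) powr (- s)) +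
    real ((n + 1) * class_bound n) * 2 powr (- (real q * s))"
proof -
  define f where "f = (\<lambda>C :: (nat \<Rightarrow> nat) mat_rep set. 1 / real (dim_irr C) powr s)"
  have f0: "f C \<ge> 0" for C by (simp add: f_def)
  define Y where "Y = (\<lambda>j. {C \<in> low_depth_Irr n (2 * j). m choose j \<le> dim_irr C})"
  define Z where "Z = {C \<in> Irr (sym_group n). 2 ^ q \<le> dim_irr C}"
  have fin: "finite (low_depth_Irr n K)" "finite (Y j)" "finite Z" for j K
    unfolding Y_def Z_def low_depth_Irr_def
    using finite_Irr_sym_group[of n] by auto
  have sub: "Irr_Sym_star n \<subseteq> (\<Union>j\<in>{1..q}. Y j) \<union> Z"
    using Irr_Sym_star_cases[OF _ m q] by (fastforce simp: Y_def Z_def Irr_Sym_star_def)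
  have "witten_zeta (Irr_Sym_star n) s \<le> sum f ((\<Union>j\<in>{1..q}. Y j) \<union> Z)"
    unfolding witten_zeta_def f_def[symmetric]
    by (rule sum_mono2) (use fin sub f0 in auto)
  also have "\<dots> \<le> sum f (\<Union>j\<in>{1..q}. Y j) + sum f Z"
    using fin f0 by (subst sum.union_inter[symmetric]) (auto intro: sum_nonneg)
  also have "sum f (\<Union>j\<in>{1..q}. Y j) \<le> (\<Sum>j=1..q. sum f (Y j))"
  proof -
    \<comment> \<open>The sets \<open>Y j\<close> may overlap; writing the union as an image of the
      disjoint union allows overcounting of nonnegative terms.\<close>
    have "(\<Union>j\<in>{1..q}. Y j) = snd ` (SIGMA j:{1..q}. Y j)" by force
    then have "sum f (\<Union>j\<in>{1..q}. Y j) \<le> sum (f \<circ> snd) (SIGMA j:{1..q}. Y j)"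
      using fin f0 by (simp only:) (intro sum_image_le, auto)
    then show ?thesis using fin by (simp add: sum.Sigma split_def)
  qed
  also have "(\<Sum>j=1..q. sum f (Y j)) \<le>
      (\<Sum>j=1..q. real (2 * ((2 * j + 1) * class_bound (2 * j))) * real (m choose j) powr (- s))"
  proof (rule sum_mono)
    fix j assume j: "j \<in> {1..q}"
    then have jm: "j \<le> m" "2 * j \<le> n" using q m by auto
    have "sum f (Y j) \<le> real (card (Y j)) * real (m choose j) powr (- s)"
      using jm s inverse_powr_antimono[of "m choose j"]
      by (intro sum_bounded_above) (auto simp: Y_def f_def)
    also have "card (Y j) \<le> card (low_depth_Irr n (2 * j))"
      using fin by (intro card_mono) (auto simp: Y_def)
    also have "\<dots> \<le> 2 * ((2 * j + 1) * class_bound (2 * j))"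
      using jm by (intro card_low_depth_Irr_le)
    finally show "sum f (Y j) \<le>
        real (2 * ((2 * j + 1) * class_bound (2 * j))) * real (m choose j) powr (- s)"
      by (simp add: mult_right_mono)
  qed
  also have "sum f Z \<le> real ((n + 1) * class_bound n) * 2 powr (- (real q * s))"
  proof -
    have "sum f Z \<le> real (card Z) * real (2 ^ q) powr (- s)"
      using s inverse_powr_antimono[of "2 ^ q"] by (intro sum_bounded_above) (auto simp: Z_def f_def)
    also have "real (2 ^ q) powr (- s) = 2 powr (- (real q * s))"
      by (simp add: powr_powr flip: powr_realpow)
    also have "card Z \<le> (n + 1) * class_bound n"
      using card_mono[of "Irr (sym_group n)" Z] finite_Irr_sym_group[of n] card_Irr_sym_group_le[of n]
      by (auto simp: Z_def)
    finally show ?thesis by (simp add: mult_right_mono)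
  qed
  finally show ?thesis by simp
qed

section \<open>Asymptotic estimates\<close>

lemma class_bound_pos: "class_bound k > 0"
  unfolding class_bound_def by (rule zero_less_power) simp

text \<open>From \<open>k^2 + 1 \<le> (1 + sqrt k) ^ 4\<close> the logarithm of the base is at most
  \<open>4 * sqrt k\<close>, and the exponent is at most \<open>3 * sqrt k\<close>.\<close>

lemma ln_class_bound_le:
  assumes "k \<ge> 1"
  shows "ln (real (class_bound k)) \<le> 12 * real k"
proof -
  let ?x = "sqrt (real k)"
  have x: "?x \<ge> 1" using assms by simp
  have xx: "?x * ?x = real k" by simp
  have "ln (real (k\<^sup>2 + 1)) \<le> ln ((1 + ?x) ^ 4)"
  proof (rule ln_mono)
    have "?x ^ 4 = (?x * ?x) * (?x * ?x)" by (simp only: power4_eq_xxxx mult.assoc)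
    then have "real (k\<^sup>2 + 1) = ?x ^ 4 + 1" unfolding xx by (simp add: power2_eq_square)
    also have "\<dots> \<le> (1 + ?x) ^ 4"
      using x by (simp add: power4_eq_xxxx algebra_simps)
    finally show "real (k\<^sup>2 + 1) \<le> (1 + ?x) ^ 4" .
  qed (use x in \<open>auto simp: add_pos_nonneg\<close>)
  also have "\<dots> = 4 * ln (1 + ?x)" using x by (subst ln_realpow) auto
  also have "\<dots> \<le> 4 * ?x" using ln_add_one_self_le_self[of ?x] x by simp
  finally have ln_le: "ln (real (k\<^sup>2 + 1)) \<le> 4 * ?x" .
  have "sqrt (2 * real k) = sqrt 2 * ?x" by (simp add: real_sqrt_mult)
  also have "\<dots> \<le> 2 * ?x" using x by (intro mult_right_mono) (auto intro: real_le_lsqrt)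
  finally have "real (nat \<lfloor>sqrt (2 * real k)\<rfloor> + 1) \<le> 3 * ?x" using x by linarith
  then have "real (nat \<lfloor>sqrt (2 * real k)\<rfloor> + 1) * ln (real (k\<^sup>2 + 1)) \<le> (3 * ?x) * (4 * ?x)"
    using ln_le x by (intro mult_mono) auto
  moreover have "(3 * ?x) * (4 * ?x) = 12 * real k" using xx by simp
  moreover have "ln (real (class_bound k)) =
      real (nat \<lfloor>sqrt (2 * real k)\<rfloor> + 1) * ln (real (k\<^sup>2 + 1))"
    unfolding class_bound_def of_nat_power by (rule ln_realpow)
  ultimately show ?thesis by simp
qed

text \<open>The sharper form serves the count of all classes: an exponent linear in \<open>n\<close>
  would not be beaten by the gain from \<open>2 ^ q\<close> with \<open>q\<close> of order
  \<open>n powr (3/4)\<close>.\<close>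

lemma class_bound_le_exp:
  "real (class_bound n) \<le> exp ((sqrt (2 * real n) + 1) * ln (real n ^ 2 + 1))"
proof -
  have "real (nat \<lfloor>sqrt (2 * real n)\<rfloor> + 1) \<le> sqrt (2 * real n) + 1" by simp
  then have "real (nat \<lfloor>sqrt (2 * real n)\<rfloor> + 1) * ln (real n ^ 2 + 1) \<le>
      (sqrt (2 * real n) + 1) * ln (real n ^ 2 + 1)"
    by (intro mult_right_mono) auto
  moreover have "real (class_bound n) = exp (real (nat \<lfloor>sqrt (2 * real n)\<rfloor> + 1) * ln (real n ^ 2 + 1))"
  proof -
    have "real n ^ 2 + 1 > 0" by (intro add_nonneg_pos) auto
    then show ?thesis unfolding class_bound_def by (simp only: exp_of_nat_mult exp_ln) (simp add: algebra_simps)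
  qed
  ultimately show ?thesis by simp
qed

text \<open>The constant is 27 = 1 + 2 + 24, from the factors \<open>2\<close>,
  \<open>2 * j + 1\<close> and \<open>class_bound (2 * j)\<close>.\<close>

lemma depth_count_le_exp:
  assumes "j \<ge> 1"
  shows "real (2 * ((2 * j + 1) * class_bound (2 * j))) \<le> exp (27 * real j)"
proof -
  have "1 \<le> real j" using assms by simp
  then have "(2 :: real) \<le> exp (real j)" using exp_ge_add_one_self[of "real j"] by linarith
  moreover have "real (2 * j + 1) \<le> exp (2 * real j)" using exp_ge_add_one_self[of "2 * real j"] by simp
  moreover have "real (class_bound (2 * j)) \<le> exp (24 * real j)"
  proof -
    have "real (class_bound (2 * j)) > 0" using class_bound_pos by simp
    then have "real (class_bound (2 * j)) = exp (ln (real (class_bound (2 * j))))" by simp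
    also have "\<dots> \<le> exp (24 * real j)" using ln_class_bound_le[of "2 * j"] assms by simp
    finally show ?thesis .
  qed
  ultimately have "2 * (real (2 * j + 1) * real (class_bound (2 * j))) \<le>
      exp (real j) * (exp (2 * real j) * exp (24 * real j))"
    by (intro mult_mono) auto
  also have "\<dots> = exp (27 * real j)" by (simp flip: exp_add)
  finally show ?thesis by (simp add: algebra_simps)
qed

text \<open>The contribution of the classes of dimension at least \<open>2 ^ q\<close>, using
  \<open>q \<ge> n powr (3/4) / 8 - 1\<close> and \<open>s n \<ge> 1 / ln n\<close>. It tends to
  zero because \<open>n powr (3/4) / ln n\<close> outgrows \<open>sqrt n * ln n\<close>.\<close>

definition tail_bound :: "nat \<Rightarrow> real" where
  "tail_bound n = (real n + 1) * exp ((sqrt (2 * real n) + 1) * ln (real n ^ 2 + 1)) *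
    exp (- ((real n powr (3 / 4) / 8 - 1) * ln 2 / ln (real n)))"

lemma tail_bound_tendsto: "tail_bound \<longlonglongrightarrow> 0"
  unfolding tail_bound_def by real_asymp

text \<open>For \<open>j \<le> q\<close> the quotient \<open>m / j\<close> is at least
  \<open>n powr (1/4)\<close>, so \<open>m choose j\<close> is at least \<open>n powr (j/4)\<close>.
  The \<open>j\<close>-th term of \<open>witten_zeta_le\<close> is then at most
  \<open>x ^ j\<close>, and a geometric series bounds the sum.\<close>

lemma eventually_witten_zeta_le:
  fixes s :: "nat \<Rightarrow> real"
  assumes s: "\<And>n. s n > 0" and lim: "filterlim (\<lambda>n. s n * ln (real n)) at_top sequentially"
  shows "eventually (\<lambda>n. witten_zeta (Irr_Sym_star n) (s n) \<le>
    2 * exp (27 - s n * ln (real n) / 4) + tail_bound n) sequentially"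
proof -
  \<comment> \<open>Since 112 = 4 * 28, this gives \<open>x \<le> exp (-1) \<le> 1/2\<close>; it
    also gives \<open>s n \<ge> 1 / ln n\<close>.\<close>
  have "eventually (\<lambda>n. s n * ln (real n) \<ge> 112) sequentially"
    using lim unfolding filterlim_at_top by blast
  moreover have "eventually (\<lambda>n. real n powr (3 / 4) / 8 \<ge> 1) sequentially" by real_asymp
  \<comment> \<open>This ensures \<open>2 * q + 1 \<le> m\<close>; the next condition ensures
    \<open>m / j \<ge> n powr (1/4)\<close> for \<open>j \<le> q\<close>.\<close>
  moreover have "eventually (\<lambda>n. 2 * (real n powr (3 / 4) / 8) + 1 \<le> (real n - 1) / 2) sequentially"
    by real_asymp
  moreover have "eventually (\<lambda>n. real n powr (3 / 4) / 8 * real n powr (1 / 4) \<le> (real n - 1) / 2) sequentially"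
    by real_asymp
  moreover have "eventually (\<lambda>n. n > (1 :: nat)) sequentially" by (rule eventually_gt_at_top)
  ultimately show ?thesis
  proof eventually_elim
    case (elim n)
    define m where "m = n div 2"
    define q where "q = nat \<lfloor>real n powr (3 / 4) / 8\<rfloor>"
    define x where "x = exp (27 - s n * ln (real n) / 4)"
    have "n \<le> 2 * m + 1" unfolding m_def by presburger
    then have "real n \<le> real (2 * m + 1)" by (simp only: of_nat_le_iff)
    then have mn: "(real n - 1) / 2 \<le> real m" by simp
    have q: "real q \<le> real n powr (3 / 4) / 8" "real n powr (3 / 4) / 8 - 1 \<le> real q" "1 \<le> q"
      using elim(2) unfolding q_def by linarith+
    have "real (2 * q + 1) \<le> real m" using q(1) elim(3) mn by simp
    then have qm: "2 * q + 1 \<le> m" by (simp only: of_nat_le_iff)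
    have lnn: "ln (real n) > 0" using elim(5) by simp
    have x: "0 < x" "x \<le> 1 / 2"
    proof -
      have "x \<le> exp (- 1)" unfolding x_def using elim(1) by simp
      also have "\<dots> \<le> 1 / 2"
        using exp_ge_add_one_self[of 1] by (simp add: exp_minus field_simps)
      finally show "x \<le> 1 / 2" .
    qed (simp add: x_def)
    have term_le: "real (2 * ((2 * j + 1) * class_bound (2 * j))) * real (m choose j) powr (- s n) \<le> x ^ j"
      if j: "j \<in> {1..q}" for j
    proof -
      have j: "1 \<le> j" "j \<le> q" using j by auto
      have "real j * real n powr (1 / 4) \<le> real n powr (3 / 4) / 8 * real n powr (1 / 4)"
        using j q by (intro mult_right_mono) auto
      also have "\<dots> \<le> real m" using elim(4) mn by linarith
      finally have "real n powr (1 / 4) \<le> real m / real j" using j by (simp add: field_simps)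
      then have "(real n powr (1 / 4)) ^ j \<le> (real m / real j) ^ j" by (intro power_mono) auto
      also have "\<dots> \<le> real (m choose j)" using j qm by (intro binomial_ge_n_over_k_pow_k) auto
      finally have "real n powr (real j / 4) \<le> real (m choose j)"
        using elim(5) by (simp add: powr_powr flip: powr_realpow)
      then have "real (m choose j) powr (- s n) \<le> (real n powr (real j / 4)) powr (- s n)"
        using s[of n] elim(5) by (intro powr_mono2') auto
      also have "\<dots> = exp (- (real j * (s n * ln (real n) / 4)))"
        using elim(5) by (simp add: powr_powr powr_def mult_ac)
      finally have "real (2 * ((2 * j + 1) * class_bound (2 * j))) * real (m choose j) powr (- s n) \<le>
          exp (27 * real j) * exp (- (real j * (s n * ln (real n) / 4)))"
        using depth_count_le_exp[OF j(1)] by (intro mult_mono) auto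
      also have "\<dots> = x ^ j"
        unfolding x_def exp_add[symmetric] exp_of_nat_mult[symmetric] by (simp add: algebra_simps)
      finally show ?thesis .
    qed
    have "(\<Sum>j=1..q. real (2 * ((2 * j + 1) * class_bound (2 * j))) * real (m choose j) powr (- s n)) \<le>
        (\<Sum>j=1..q. x ^ j)"
      by (rule sum_mono) (rule term_le)
    also have "\<dots> \<le> 2 * x"
    proof -
      \<comment> \<open>The subtracted term strengthens the claim so that the induction closes with
        \<open>x \<le> 1/2\<close>.\<close>
      have "(\<Sum>j=1..k. x ^ j) \<le> 2 * x - x ^ k * (2 * x)" for k
      proof (induction k)
        case (Suc k)
        have "x ^ k * x * (2 * x) \<le> x ^ k * x * 1" using x by (intro mult_left_mono) auto
        then show ?case using Suc by (simp add: algebra_simps)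
      qed simp
      from this[of q] show ?thesis using x by (smt (verit) mult_nonneg_nonneg zero_le_power)
    qed
    finally have part1: "(\<Sum>j=1..q. real (2 * ((2 * j + 1) * class_bound (2 * j))) *
        real (m choose j) powr (- s n)) \<le> 2 * x" .
    have "real ((n + 1) * class_bound n) * 2 powr (- (real q * s n)) \<le> tail_bound n"
    proof -
      have "1 / ln (real n) \<le> s n" using elim(1) lnn by (simp add: field_simps)
      moreover have "0 \<le> real n powr (3 / 4) / 8 - 1" using elim(2) by simp
      ultimately have "(real n powr (3 / 4) / 8 - 1) * (1 / ln (real n)) \<le> real q * s n"
        using q lnn by (intro mult_mono) auto
      then have "(real n powr (3 / 4) / 8 - 1) * (1 / ln (real n)) * ln 2 \<le> real q * s n * ln 2"
        by (intro mult_right_mono) auto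
      then have "2 powr (- (real q * s n)) \<le> exp (- ((real n powr (3 / 4) / 8 - 1) * ln 2 / ln (real n)))"
        by (simp add: powr_def)
      then show ?thesis
        unfolding tail_bound_def of_nat_mult of_nat_add of_nat_1 using class_bound_le_exp[of n]
        by (intro mult_mono) auto
    qed
    then show ?case
      using witten_zeta_le[OF m_def q(3) qm, of "s n"] s[of n] part1 by (simp add: x_def)
  qed
qed

section \<open>The lower bound and the equivalence\<close>

lemma witten_zeta_nonneg: "witten_zeta A s \<ge> 0"
  unfolding witten_zeta_def by (intro sum_nonneg) simp

text \<open>The standard representation contributes one term. For \<open>n \<ge> 3\<close> its
  degree is at least 2, which separates it from the trivial and the sign representation.\<close>

lemma witten_zeta_ge_std:
  assumes n: "n \<ge> 3"
  shows "1 / real (n - 1) powr s \<le> witten_zeta (Irr_Sym_star n) s"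
proof -
  let ?C = "irrep_rel (sym_group n) `` {std_rep n}"
  have irr: "irreducible_rep (sym_group n) (std_rep n)" using n by (intro irreducible_std_rep) simp
  have dim: "dim_irr ?C = n - 1"
    using dim_irr_class[of "sym_group n" "fst (std_rep n)" "snd (std_rep n)"] irr
    by (simp add: std_rep_def)
  have "?C \<noteq> irrep_rel (sym_group n) `` {(1, \<rho>)}" if "irreducible_rep (sym_group n) (1, \<rho>)" for \<rho>
    using dim dim_irr_class[OF that] n by auto
  then have "?C \<noteq> irrep_rel (sym_group n) `` {triv_rep}" "?C \<noteq> irrep_rel (sym_group n) `` {sign_rep}"
    using irreducible_triv_rep[of "sym_group n"] irreducible_sign_rep[of n]
    unfolding triv_rep_def sign_rep_def by blast+
  then have C: "?C \<in> Irr_Sym_star n"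
    using irr by (auto simp: Irr_Sym_star_def Irr_def intro!: quotientI)
  have "finite (Irr_Sym_star n)" using finite_Irr_sym_group[of n] by (simp add: Irr_Sym_star_def)
  then have "(\<Sum>C\<in>{?C}. 1 / real (dim_irr C) powr s) \<le> witten_zeta (Irr_Sym_star n) s"
    unfolding witten_zeta_def using C by (intro sum_mono2) auto
  then show ?thesis by (simp add: dim)
qed

theorem proposition1p8:
  fixes s :: "nat \<Rightarrow> real"
  assumes "\<And>n. s n > 0"
  shows "(\<lambda>n. witten_zeta (Irr_Sym_star n) (s n)) \<longlonglongrightarrow> 0 \<longleftrightarrow>
         filterlim (\<lambda>n. s n * ln (real n)) at_top sequentially"
proof
  assume lim: "(\<lambda>n. witten_zeta (Irr_Sym_star n) (s n)) \<longlonglongrightarrow> 0"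
  let ?d = "\<lambda>n. 1 / real (n - 1) powr s n"
  have "?d \<longlonglongrightarrow> 0"
  proof (rule tendsto_sandwich[OF _ _ tendsto_const lim])
    show "eventually (\<lambda>n. ?d n \<le> witten_zeta (Irr_Sym_star n) (s n)) sequentially"
      using eventually_ge_at_top[of 3] by eventually_elim (rule witten_zeta_ge_std)
  qed simp
  moreover have "eventually (\<lambda>n. ?d n > 0) sequentially"
    using eventually_ge_at_top[of 3] by eventually_elim simp
  \<comment> \<open>Eventual positivity makes this convergence from the right, so the logarithm
    tends to minus infinity.\<close>
  ultimately have "filterlim ?d (at_right 0) sequentially"
    by (auto simp: filterlim_at elim: eventually_mono)
  then have "filterlim (\<lambda>n. ln (?d n)) at_bot sequentially"
    by (rule filterlim_compose[OF ln_at_0])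
  then have "filterlim (\<lambda>n. - ln (?d n)) at_top sequentially"
    by (simp add: filterlim_uminus_at_bot)
  then show "filterlim (\<lambda>n. s n * ln (real n)) at_top sequentially"
  proof (rule filterlim_at_top_mono)
    show "eventually (\<lambda>n. - ln (?d n) \<le> s n * ln (real n)) sequentially"
      using eventually_ge_at_top[of 3]
    proof eventually_elim
      case (elim n)
      then have "- ln (?d n) = s n * ln (real (n - 1))" by (simp add: ln_div ln_powr)
      also have "\<dots> \<le> s n * ln (real n)"
        using elim assms[of n] by (intro mult_left_mono) auto
      finally show ?case .
    qed
  qed
next
  assume lim: "filterlim (\<lambda>n. s n * ln (real n)) at_top sequentially"
  \<comment> \<open>The geometric part depends on \<open>n\<close> only through
    \<open>s n * ln n\<close>, so its limit follows by composition with the hypothesis.\<close>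
  have "((\<lambda>x. 2 * exp (27 - x / 4)) \<longlongrightarrow> 0) (at_top :: real filter)" by real_asymp
  then have "(\<lambda>n. 2 * exp (27 - s n * ln (real n) / 4)) \<longlonglongrightarrow> 0"
    using lim by (rule filterlim_compose)
  then have upper: "(\<lambda>n. 2 * exp (27 - s n * ln (real n) / 4) + tail_bound n) \<longlonglongrightarrow> 0"
    using tendsto_add[OF _ tail_bound_tendsto] by fastforce
  show "(\<lambda>n. witten_zeta (Irr_Sym_star n) (s n)) \<longlonglongrightarrow> 0"
    by (rule tendsto_sandwich[OF _ eventually_witten_zeta_le[OF assms lim] tendsto_const upper])
      (simp add: witten_zeta_nonneg)
qed

end
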